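(* Let $0<\varepsilon<\omega_1$ and $2\le\iota<\omega$. Let $S=(\omega,\bar r,\bar\jmath,\bar k)$ be a cute $\mathcal{YZR}(\varepsilon)$-system, and let $\bar T^{\varepsilon,\iota}=\langle T_m^{\varepsilon,\iota}:m<\omega\rangle$ be a sequence of trees $T_m^{\varepsilon,\iota}\subseteq{}^{\omega>}2$ without maximal nodes and $\bar c=\langle c_m:m<\omega\rangle\subseteq\omega$ be such that $\bar T^{\varepsilon,\iota}$ has the $(\bar c,S)$-controlled amalgamation property and $\varepsilon\le\mathrm{ndrk}_\iota(\bar T^{\varepsilon,\iota})\le\omega\cdot(\varepsilon+2)+2$ (ordinal multiplication). Let $B_{\varepsilon,\iota}=\bigcup_{m<\omega}\lim(T_m^{\varepsilon,\iota})$. Then there exists a sequence $\langle\eta_\alpha:\alpha<\omega_1\rangle$ of distinct elements of ${}^{\omega}2$ such that $|(\eta_\alpha+B_{\varepsilon,\iota})\cap(\eta_\beta+B_{\varepsilon,\iota})|\ge2\iota$ for all $\alpha,\beta<\omega_1$, but there is no perfect set $P\subseteq{}^{\omega}2$ such that $|(\eta+B_{\varepsilon,\iota})\cap(\eta'+B_{\varepsilon,\iota})|\ge2\iota$ for all $\eta,\eta'\in P$.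
   Context: **Basic notation.** Every ordinal (in particular every natural number) is identified with the set of smaller ordinals; for a set $w$ of ordinals and an ordinal $b$, $w\cap b=\{a\in w:a<b\}$. $[X]^{<\omega}$ is the family of finite subsets of $X$. For a set $u$, $u^{\langle2\rangle}=\{(x,y)\in u\times u:x\ne y\}$. ${}^n2$ is the set of 0-1 sequences of length $n$, ${}^{\omega>}2=\bigcup_{n<\omega}{}^n2$, ${}^{\omega}2$ is the Cantor space; $+$ on ${}^n2$ and on ${}^{\omega}2$ is coordinatewise addition mod 2. $\nu\vartriangleleft\eta$ means that $\nu$ is a proper initial segment of $\eta$; $\nu\trianglelefteq\eta$ means $\nu\vartriangleleft\eta$ or $\nu=\eta$. A tree is a $\vartriangleleft$-downward closed set of sequences; $\lim(T)$ is the set of $\omega$-branches through $T\subseteq{}^{\omega>}2$. A perfect set is a nonempty closed set with no isolated points. **$\mathcal{YZR}$-systems.** Let $0<\varepsilon<\omega_1$. A $\mathcal{YZR}(\varepsilon)$-system is a tuple $s=(X^s,\bar r^s,\bar\jmath^s,\bar k^s)=(X,\bar r,\bar\jmath,\bar k)$ such that: $( * )_1$ $X$ is a nonempty set of ordinals; $( * )_2$ $\bar r:[X]^{<\omega}\setminus\{\emptyset\}\to\varepsilon+1$, $\bar\jmath,\bar k:[X]^{<\omega}\setminus\{\emptyset\}\to\omega$; $( * )_3$ if $\emptyset\ne u\subseteq w\in[X]^{<\omega}$ then $\bar r(u)\ge\bar r(w)$; $( * )_4$ $\bar r(\{a\})>0$ for all $a\in X$; $( * )_5$ if $\emptyset\neq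 w\in[X]^{<\omega}$ and $w=\{a_0,\dots,a_{n-1}\}$ is the increasing enumeration, then $\bar k(w)<n$ and there is no $b\in X\setminus w$ such that $|w\cap b|=\bar k(w)$ and $\bar\jmath((w\setminus\{a_{\bar k(w)}\})\cup\{b\})=\bar\jmath(w)$ and $\bar r(w\cup\{b\})=\bar r(w)$. It is finite if $X^s$ is finite. A quasi-embedding of $q$ in $s$ (both $\mathcal{YZR}(\varepsilon)$-systems) is an increasing injection $\varphi:X^q\to X^s$ such that for all nonempty finite $v\subseteq X^q$: $\bar r^s(\varphi[v])=\bar r^q(v)$, $\bar k^s(\varphi[v])=\bar k^q(v)$, and if $\bar r^q(v)>0$ then $\bar\jmath^s(\varphi[v])=\bar\jmath^q(v)$. If $w\subseteq X^s$, an increasing injection $\varphi:w\to X^s$ is a quasi-embedding (into $s$) if it is a quasi-embedding of the restricted system $s\restriction w$ in $s$. A $\mathcal{YZR}(\varepsilon)$-system $S$ is cute if $X^S=\omega$ and for every finite $\mathcal{YZR}(\varepsilon)$-system $q$ and $M<\omega$ there is a quasi-embedding $\varphi$ of $q$ in $S$ with $\mathrm{rng}(\varphi)\subseteq[M,\omega)$. **The family $\mathbf M_{\bar T,\iota}$.** Let $2\le\iota<\omega$ and let $\bar T=\langle T_n:n<\omega\rangle$ be a sequence of trees $T_n\subseteq{}^{\omega>}2$ with no maximal nodes. $\mathbf M_{\bar T,\iota}$ consists of all tuples $\mathbf m=(\ell_{\mathbf m},u_{\mathbf m},\bar h_{\mathbf m},\bar g_{\mathbf m})=(\ell,u,\bar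 h,\bar g)$ such that: (a) $0<\ell<\omega$, $u\subseteq{}^\ell2$, $|u|\ge2$; (b) $\bar h=\langle h_i:i<\iota\rangle$, $\bar g=\langle g_i:i<\iota\rangle$, $h_i:u^{\langle2\rangle}\to\omega$, $g_i:u^{\langle2\rangle}\to\bigcup_{n<\omega}(T_n\cap{}^\ell2)$; (c) $g_i(\eta,\nu)\in T_{h_i(\eta,\nu)}\cap{}^\ell2$ for all $(\eta,\nu)\in u^{\langle2\rangle}$, $i<\iota$; (d) $\eta+g_i(\eta,\nu)=\nu+g_i(\nu,\eta)$ for $(\eta,\nu)\in u^{\langle2\rangle}$, $i<\iota$; (e) for each $(\eta,\nu)\in u^{\langle2\rangle}$ there are no repetitions in $\langle g_i(\eta,\nu),g_i(\nu,\eta):i<\iota\rangle$; (f) there are $\langle F(\eta):\eta\in u\rangle$ and $\langle G_i(\eta,\nu):i<\iota,(\eta,\nu)\in u^{\langle2\rangle}\rangle$ such that $\eta\vartriangleleft F(\eta)\in{}^{\omega}2$, $g_i(\eta,\nu)\vartriangleleft G_i(\eta,\nu)\in\lim(T_{h_i(\eta,\nu)})$ and $F(\eta)+G_i(\eta,\nu)=F(\nu)+G_i(\nu,\eta)$ for all $i<\iota$, $(\eta,\nu)\in u^{\langle 2\rangle}$. We write $h_i^{\mathbf m},g_i^{\mathbf m}$ for the components. For $\rho\in{}^{\ell_{\mathbf m}}2$, $\mathbf m+\rho=(\ell',u',\bar h',\bar g')$ where $\ell'=\ell_{\mathbf m}$, $u'=\{\eta+\rho:\eta\in u_{\mathbf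 m}\}$, $h'_i(\eta+\rho,\nu+\rho)=h^{\mathbf m}_i(\eta,\nu)$, $g'_i(\eta+\rho,\nu+\rho)=g^{\mathbf m}_i(\eta,\nu)$. For $\mathbf m,\mathbf n\in\mathbf M_{\bar T,\iota}$, $\mathbf n$ essentially extends $\mathbf m$ ($\mathbf m\sqsubseteq^*\mathbf n$) iff $\ell_{\mathbf m}\le\ell_{\mathbf n}$, $u_{\mathbf m}=\{\eta\restriction\ell_{\mathbf m}:\eta\in u_{\mathbf n}\}$ and for every $(\eta,\nu)\in(u_{\mathbf n})^{\langle2\rangle}$ with $\eta'=\eta\restriction\ell_{\mathbf m}\ne\nu'=\nu\restriction\ell_{\mathbf m}$: if $\iota>2$ then $\{\{g_i^{\mathbf m}(\eta',\nu'),g_i^{\mathbf m}(\nu',\eta')\}:i<\iota\}=\{\{g_i^{\mathbf n}(\eta,\nu)\restriction\ell_{\mathbf m},g_i^{\mathbf n}(\nu,\eta)\restriction\ell_{\mathbf m}\}:i<\iota\}$; if $\iota=2$ then $\{g_0^{\mathbf m}(\eta',\nu'),g_0^{\mathbf m}(\nu',\eta'),g_1^{\mathbf m}(\eta',\nu'),g_1^{\mathbf m}(\nu',\eta')\}=\{g_0^{\mathbf n}(\eta,\nu)\restriction\ell_{\mathbf m},g_0^{\mathbf n}(\nu,\eta)\restriction\ell_{\mathbf m},g_1^{\mathbf n}(\eta,\nu)\restriction\ell_{\mathbf m},g_1^{\mathbf n}(\nu,\eta)\restriction\ell_{\mathbf m}\}$; and for $i,j<\iota$: if $g_i^{\mathbf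 m}(\eta',\nu')=g_j^{\mathbf n}(\eta,\nu)\restriction\ell_{\mathbf m}$ then $h_i^{\mathbf m}(\eta',\nu')=h_j^{\mathbf n}(\eta,\nu)$, and if $g_i^{\mathbf m}(\eta',\nu')=g_j^{\mathbf n}(\nu,\eta)\restriction\ell_{\mathbf m}$ then $h_i^{\mathbf m}(\eta',\nu')=h_j^{\mathbf n}(\nu,\eta)$. $\mathbf m,\mathbf n$ are essentially the same ($\mathbf m\doteqdot\mathbf n$) iff $\ell_{\mathbf m}=\ell_{\mathbf n}$, $u_{\mathbf m}=u_{\mathbf n}$ and these same conditions hold for all $(\eta,\nu)\in(u_{\mathbf m})^{\langle2\rangle}$ (with $\eta'=\eta$, $\nu'=\nu$). **Bricks.** Let $S=(\omega,\bar r,\bar\jmath,\bar k)$ be a cute $\mathcal{YZR}(\varepsilon)$-system and $\bar c=\langle c_m:m<\omega\rangle\subseteq\omega$. An $(S,\iota,\bar T,\bar c)$-brick is a tuple $\mathfrak b=(w^{\mathfrak b},n^{\mathfrak b},\bar\eta^{\mathfrak b},\bar h^{\mathfrak b},\bar g^{\mathfrak b},\mathcal M^{\mathfrak b})=(w,n,\bar\eta,\bar h,\bar g,\mathcal M)$ such that: $(\boxplus)_1$ $w\in[\omega]^{<\omega}$, $|w|\ge3$, $0<n<\omega$. $(\boxplus)_2$ $\bar\eta=\langle\eta_a:a\in w\rangle$ is a sequence of linearly independent vectors in ${}^n2$ over $\mathbb Z_2$. $(\boxplus)_3$ $\bar h=\langle h_i:i<\iota\rangle$, $h_i:w^{\langle2\rangle}\to\omega$,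 $c_{h_i(a,b)}\le n$ for all $(a,b)\in w^{\langle2\rangle}$, $i<\iota$; $\bar g=\langle g_i:i<\iota\rangle$, $g_i:w^{\langle2\rangle}\to\bigcup_{m<\omega}(T_m\cap{}^n2)$. $(\boxplus)_4$ Letting $n^*=n$, $u^*=\{\eta_a:a\in w\}$, $h_i^*(\eta_a,\eta_b)=h_i(a,b)$, $g_i^*(\eta_a,\eta_b)=g_i(a,b)$, we have $(n^*,u^*,\bar h^*,\bar g^* )\in\mathbf M_{\bar T,\iota}$. $(\boxplus)_5$ $\mathcal M$ consists of all $\mathbf m\in\mathbf M_{\bar T,\iota}$ such that for some $\ell_*,w_*$: $w_*\subseteq w$, $|w_*|\ge3$, $0<\ell_{\mathbf m}=\ell_*\le n$, and $c_{h_i(a,b)}\le\ell_*$ for all $(a,b)\in(w_* )^{\langle2\rangle}$, $i<\iota$; $u_{\mathbf m}=\{\eta_a\restriction\ell_*:a\in w_*\}$ and $\eta_a\restriction\ell_*\ne\eta_b\restriction\ell_*$ for distinct $a,b\in w_*$; $h_i^{\mathbf m}(\eta_a\restriction\ell_*,\eta_b\restriction\ell_* )=h_i(a,b)$ and $g_i^{\mathbf m}(\eta_a\restriction\ell_*,\eta_b\restriction\ell_* )=g_i(a,b)\restriction\ell_*$ for $(a,b)\in (w_* )^{\langle 2\rangle}$, $i<\iota$. In this situation we write $\mathbf m=\mathbf m(\ell_*,w_* )$. $(\boxplus)_6$ If $\mathbf m(\ell,w_0),\mathbf m(\ell,w_1)\in\mathcal M$, $\rho\in{}^\ell2$ and $\mathbf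 m(\ell,w_0)\doteqdot\mathbf m(\ell,w_1)+\rho$, then the order isomorphism $\pi:w_0\to w_1$ is a quasi-embedding (into $S$) and $(\eta_a\restriction\ell)+\rho=\eta_{\pi(a)}\restriction\ell$ for all $a\in w_0$. $(\boxplus)_7$ If $\mathbf m(\ell_*,w_* )\in\mathcal M$, $a\in w_*$, $|a\cap w_*|=\bar k(w_* )$, $\bar r(w_* )=0$ and $\mathbf m(\ell_*,w_* )\sqsubseteq^*\mathbf n\in\mathcal M$, then $|\{\nu\in u_{\mathbf n}:(\eta_a\restriction\ell_* )\trianglelefteq\nu\}|=1$. For bricks, $\mathfrak b_0\Subset\mathfrak b_1$ iff $w^{\mathfrak b_0}\subseteq w^{\mathfrak b_1}$, $n^{\mathfrak b_0}\le n^{\mathfrak b_1}$, $\eta_a^{\mathfrak b_0}\trianglelefteq\eta_a^{\mathfrak b_1}$ for $a\in w^{\mathfrak b_0}$, and $h_i^{\mathfrak b_1}\restriction(w^{\mathfrak b_0})^{\langle2\rangle}=h_i^{\mathfrak b_0}$, $g_i^{\mathfrak b_0}(a,b)\trianglelefteq g_i^{\mathfrak b_1}(a,b)$ for $i<\iota$, $(a,b)\in(w^{\mathfrak b_0})^{\langle2\rangle}$. For $w^*\subseteq w^{\mathfrak b}$ with $|w^*|\ge3$, $\mathfrak b\restriction w^*$ is the unique brick $\mathfrak b^*$ with $w^{\mathfrak b^*}=w^*$, $n^{\mathfrak b^*}=n^{\mathfrak b}$, $\mathfrak b^*\Subset\mathfrak b$. For a quasi-embedding $\varphi:w^{\mathfrak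 b}\to\omega$ (into $S$), $\varphi(\mathfrak b)$ is the unique brick $\mathfrak b^*$ with $w^{\mathfrak b^*}=\varphi[w^{\mathfrak b}]$, $n^{\mathfrak b^*}=n^{\mathfrak b}$, $\mathcal M^{\mathfrak b^*}=\mathcal M^{\mathfrak b}$, $\eta^{\mathfrak b}_a=\eta^{\mathfrak b^*}_{\varphi(a)}$, $h_i^{\mathfrak b}(a,b)=h_i^{\mathfrak b^*}(\varphi(a),\varphi(b))$, $g_i^{\mathfrak b}(a,b)=g_i^{\mathfrak b^*}(\varphi(a),\varphi(b))$. **Controlled amalgamation.** $\bar T$ has the $(\bar c,S)$-controlled amalgamation property if there is a sequence $\langle\mathfrak b_n:n<\omega\rangle$ of $(S,\iota,\bar T,\bar c)$-bricks such that: (1) $\mathfrak b_n\Subset\mathfrak b_{n+1}$ for each $n$; (2) $\bigcup_nw^{\mathfrak b_n}=\omega$ and $\lim_{n\to\infty}n^{\mathfrak b_n}=\infty$; (3) if (a) $n<\omega$, $u\subseteq w\subseteq w^{\mathfrak b_n}$, $|w|\ge3$, (b) $\bar k(v\cup\{\delta\})\ne|\delta\cap v|$ whenever $v\subseteq u$, $\delta\in w\setminus u$ and $\bar r(v\cup\{\delta\})=0$, and (c) $\pi_0,\pi_1:w\to\omega$ are quasi-embeddings (into $S$) with $\pi_0(a)=\pi_1(a)$ for $a\in u$ and $\pi_0[w\setminus u]\cap\pi_1[w\setminus u]=\emptyset$, then there are $K<\omega$ and a quasi-embedding $\pi:\mathrm{rng}(\pi_0)\cup\mathrm{rng}(\pi_1)\to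 w^{\mathfrak b_K}$ (into $S$) such that $(\pi\circ\pi_0)(\mathfrak b_n\restriction w)\Subset\mathfrak b_K\restriction(\pi\circ\pi_0[w])$ and $(\pi\circ\pi_1)(\mathfrak b_n\restriction w)\Subset\mathfrak b_K\restriction(\pi\circ\pi_1[w])$; (4) if $n<\omega$, $w\subseteq w^{\mathfrak b_n}$, $|w|\ge3$, $\pi_0:w\to\omega$ is a quasi-embedding (into $S$) and $\mathrm{rng}(\pi_0)\subseteq u\in[\omega]^{<\omega}$, then there are $K<\omega$ and a quasi-embedding $\pi:u\to w^{\mathfrak b_K}$ (into $S$) such that $(\pi\circ\pi_0)(\mathfrak b_n\restriction w)\Subset\mathfrak b_K\restriction(\pi\circ\pi_0[w])$. **Non-disjointness rank.** For $\mathbf m,\mathbf n\in\mathbf M_{\bar T,\iota}$, $\mathbf n$ extends $\mathbf m$ ($\mathbf m\sqsubseteq\mathbf n$) iff $\ell_{\mathbf m}\le\ell_{\mathbf n}$, $u_{\mathbf m}=\{\eta\restriction\ell_{\mathbf m}:\eta\in u_{\mathbf n}\}$, and for every $(\eta,\nu)\in(u_{\mathbf n})^{\langle2\rangle}$ with $\eta\restriction\ell_{\mathbf m}\ne\nu\restriction\ell_{\mathbf m}$ and each $i<\iota$: $h_i^{\mathbf m}(\eta\restriction\ell_{\mathbf m},\nu\restriction\ell_{\mathbf m})=h_i^{\mathbf n}(\eta,\nu)$ and $g_i^{\mathbf m}(\eta\restriction\ell_{\mathbf m},\nu\restriction\ell_{\mathbf m})=g_i^{\mathbf n}(\eta,\nu)\restriction\ell_{\mathbf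 m}$. The function $\mathrm{ndrk}_\iota:\mathbf M_{\bar T,\iota}\to\mathrm{ON}\cup\{\infty\}$ is defined by declaring when $\mathrm{ndrk}_\iota(\mathbf m)\ge\alpha$: always for $\alpha=0$; for limit $\alpha$ iff $\mathrm{ndrk}_\iota(\mathbf m)\ge\beta$ for all $\beta<\alpha$; for $\alpha=\beta+1$ iff for every $\nu\in u_{\mathbf m}$ there is $\mathbf n\in\mathbf M_{\bar T,\iota}$ with $\ell_{\mathbf n}>\ell_{\mathbf m}$, $\mathbf m\sqsubseteq\mathbf n$, $\mathrm{ndrk}_\iota(\mathbf n)\ge\beta$ and $|\{\eta\in u_{\mathbf n}:\nu\vartriangleleft\eta\}|\ge2$; and $\mathrm{ndrk}_\iota(\mathbf m)=\infty$ iff $\mathrm{ndrk}_\iota(\mathbf m)\ge\alpha$ for all ordinals $\alpha$. Put $\mathrm{ndrk}_\iota(\bar T)=\sup\{\mathrm{ndrk}_\iota(\mathbf m):\mathbf m\in\mathbf M_{\bar T,\iota}\}$. *)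

theory Defs
  imports "HOL-Analysis.Analysis" "HOL-Library.Sublist" "HOL-Library.Z2"
    "HOL-Library.Function_Algebras"
begin

section \<open>Ordinals\<close>

text \<open>
  The order types of the well-orders on sets of sets of natural numbers, i.e. all ordinals below
  the successor cardinal of the continuum.  This initial segment of the ordinals has no last
  element and is closed under suprema of at most continuum many elements; in particular
  \<open>\<omega>\<^sub>1\<close> belongs to it.
\<close>

lemma Well_order_empty: "Well_order {}"
  by (simp add: well_order_on_def linear_order_on_def partial_order_on_def preorder_on_def
      refl_on_def)

quotient_type ordinal = "nat set rel" / partial: "\<lambda>r s. (r, s) \<in> ordIso"
proof (rule part_equivpI)
  show "\<exists>r :: nat set rel. (r, r) \<in> ordIso"
    using ordIso_reflexive[OF Well_order_empty] by blast
  show "symp (\<lambda>r s :: nat set rel. (r, s) \<in> ordIso)"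
    using ordIso_symmetric by (auto simp: symp_def)
  show "transp (\<lambda>r s :: nat set rel. (r, s) \<in> ordIso)"
    using ordIso_transitive by (auto simp: transp_def)
qed

lemma Well_order_rep_ordinal: "Well_order (rep_ordinal x)"
  using Quotient_rep_reflp[OF Quotient_ordinal, of x] by (simp add: ordIso_def)

lemma ordinal_eq_iff: "x = y \<longleftrightarrow> (rep_ordinal x, rep_ordinal y) \<in> ordIso"
  using Quotient_rel_rep[OF Quotient_ordinal, of x y] by simp

instantiation ordinal :: wellorder
begin

lift_definition less_eq_ordinal :: "ordinal \<Rightarrow> ordinal \<Rightarrow> bool"
  is "\<lambda>r s. (r, s) \<in> ordLeq"
  using ordIso_ordLeq_trans ordLeq_ordIso_trans ordIso_symmetric by blast

lift_definition less_ordinal :: "ordinal \<Rightarrow> ordinal \<Rightarrow> bool"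
  is "\<lambda>r s. (r, s) \<in> ordLess"
  using ordIso_ordLess_trans ordLess_ordIso_trans ordIso_symmetric by blast

instance
proof
  fix x y z :: ordinal
  show "(x < y) = (x \<le> y \<and> \<not> y \<le> x)"
    unfolding less_ordinal.rep_eq less_eq_ordinal.rep_eq
    using not_ordLeq_iff_ordLess[OF Well_order_rep_ordinal Well_order_rep_ordinal]
      ordLess_imp_ordLeq by blast
  show "x \<le> x"
    unfolding less_eq_ordinal.rep_eq by (rule ordLeq_reflexive[OF Well_order_rep_ordinal])
  show "x \<le> y \<Longrightarrow> y \<le> z \<Longrightarrow> x \<le> z"
    unfolding less_eq_ordinal.rep_eq by (rule ordLeq_transitive)
  show "x \<le> y \<Longrightarrow> y \<le> x \<Longrightarrow> x = y"
    unfolding less_eq_ordinal.rep_eq ordinal_eq_iff ordIso_iff_ordLeq by blast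
  show "x \<le> y \<or> y \<le> x"
    unfolding less_eq_ordinal.rep_eq
    by (rule ordLeq_total[OF Well_order_rep_ordinal Well_order_rep_ordinal])
next
  fix P :: "ordinal \<Rightarrow> bool" and a :: ordinal
  assume step: "\<And>x. (\<And>y. y < x \<Longrightarrow> P y) \<Longrightarrow> P x"
  have "wf {(x, y :: ordinal). x < y}"
  proof (rule wf_subset)
    show "wf (inv_image ordLess rep_ordinal)"
      by (rule wf_inv_image[OF wf_ordLess])
    show "{(x, y :: ordinal). x < y} \<subseteq> inv_image ordLess rep_ordinal"
      by (auto simp: inv_image_def less_ordinal.rep_eq)
  qed
  then show "P a"
    by (rule wf_induct_rule) (use step in auto)
qed

end

lift_definition ord_zero :: ordinal is "{}"
  by (rule ordIso_reflexive[OF Well_order_empty])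

definition ord_succ :: "ordinal \<Rightarrow> ordinal" where
  "ord_succ \<alpha> = (LEAST \<beta>. \<alpha> < \<beta>)"

definition ord_limit :: "ordinal \<Rightarrow> bool" where
  "ord_limit \<alpha> \<longleftrightarrow> \<alpha> \<noteq> ord_zero \<and> (\<forall>\<beta>. \<alpha> \<noteq> ord_succ \<beta>)"

definition ord_omega :: ordinal where
  "ord_omega = (LEAST \<alpha>. infinite {..<\<alpha>})"

definition ord_omega1 :: ordinal where
  "ord_omega1 = (LEAST \<alpha>. uncountable {..<\<alpha>})"

text \<open>
  Ordinal sum and product, with the zero, successor and limit clauses merged into one:
  \<open>\<alpha> + \<beta> = max \<alpha> (sup {(\<alpha> + \<delta>) + 1 | \<delta> < \<beta>})\<close> and \<open>\<alpha> \<cdot> \<beta> = sup {\<alpha> \<cdot> \<delta> + \<alpha> | \<delta> < \<beta>}\<close>.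
\<close>

function ord_add :: "ordinal \<Rightarrow> ordinal \<Rightarrow> ordinal" where
  "ord_add \<alpha> \<beta> = (LEAST \<gamma>. \<alpha> \<le> \<gamma> \<and> (\<forall>\<sigma>\<in>(\<lambda>\<delta>. ord_add \<alpha> \<delta>) ` {..<\<beta>}. \<sigma> < \<gamma>))"
  by auto
termination
proof (relation "inv_image {(x, y). x < y} snd")
  show "wf (inv_image {(x, y :: ordinal). x < y} (snd :: ordinal \<times> ordinal \<Rightarrow> ordinal))"
    by (rule wf_inv_image[OF wf])
qed simp

declare ord_add.simps [simp del]

function ord_mult :: "ordinal \<Rightarrow> ordinal \<Rightarrow> ordinal" where
  "ord_mult \<alpha> \<beta> = (LEAST \<gamma>. \<forall>\<pi>\<in>(\<lambda>\<delta>. ord_mult \<alpha> \<delta>) ` {..<\<beta>}. ord_add \<pi> \<alpha> \<le> \<gamma>)"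
  by auto
termination
proof (relation "inv_image {(x, y). x < y} snd")
  show "wf (inv_image {(x, y :: ordinal). x < y} (snd :: ordinal \<times> ordinal \<Rightarrow> ordinal))"
    by (rule wf_inv_image[OF wf])
qed simp

declare ord_mult.simps [simp del]

text \<open>The class \<open>ON \<union> {\<infinity>}\<close>.\<close>

datatype ord_inf = Fin ordinal | Infty

instantiation ord_inf :: linorder
begin

definition less_eq_ord_inf :: "ord_inf \<Rightarrow> ord_inf \<Rightarrow> bool" where
  "x \<le> y \<longleftrightarrow> y = Infty \<or> (\<exists>\<alpha> \<beta>. x = Fin \<alpha> \<and> y = Fin \<beta> \<and> \<alpha> \<le> \<beta>)"

definition less_ord_inf :: "ord_inf \<Rightarrow> ord_inf \<Rightarrow> bool" where
  "x < y \<longleftrightarrow> x \<le> y \<and> \<not> y \<le> (x :: ord_inf)"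

instance
proof
  fix x y z :: ord_inf
  show "(x < y) = (x \<le> y \<and> \<not> y \<le> x)"
    by (simp add: less_ord_inf_def)
  show "x \<le> x"
    by (cases x) (auto simp: less_eq_ord_inf_def)
  show "x \<le> y \<Longrightarrow> y \<le> z \<Longrightarrow> x \<le> z"
    by (auto simp: less_eq_ord_inf_def)
  show "x \<le> y \<Longrightarrow> y \<le> x \<Longrightarrow> x = y"
    by (auto simp: less_eq_ord_inf_def)
  show "x \<le> y \<or> y \<le> x"
    by (cases x; cases y) (auto simp: less_eq_ord_inf_def)
qed

end

definition ord_inf_Sup :: "ord_inf set \<Rightarrow> ord_inf" where
  "ord_inf_Sup A = (LEAST x. \<forall>a\<in>A. a \<le> x)"


section \<open>Sequences and trees\<close>

text \<open>
  Finite 0-1 sequences are bit lists, elements of the Cantor space are functions \<open>nat \<Rightarrow> bit\<close>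
  (with the pointwise addition of \<open>Function_Algebras\<close>); addition on \<open>bit\<close> is addition modulo 2.
\<close>

definition list_add :: "bit list \<Rightarrow> bit list \<Rightarrow> bit list" where
  "list_add \<eta> \<nu> = map2 (+) \<eta> \<nu>"

definition init_seg :: "bit list \<Rightarrow> (nat \<Rightarrow> bit) \<Rightarrow> bool" where
  "init_seg \<eta> x \<longleftrightarrow> map x [0..<length \<eta>] = \<eta>"

definition pairs2 :: "'a set \<Rightarrow> ('a \<times> 'a) set" where
  "pairs2 u = {(x, y). x \<in> u \<and> y \<in> u \<and> x \<noteq> y}"

definition is_tree :: "bit list set \<Rightarrow> bool" where
  "is_tree T \<longleftrightarrow> (\<forall>\<eta>\<in>T. \<forall>\<nu>. strict_prefix \<nu> \<eta> \<longrightarrow> \<nu> \<in> T)"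

definition no_maximal_nodes :: "bit list set \<Rightarrow> bool" where
  "no_maximal_nodes T \<longleftrightarrow> (\<forall>\<eta>\<in>T. \<exists>\<nu>\<in>T. strict_prefix \<eta> \<nu>)"

definition lim_tree :: "bit list set \<Rightarrow> (nat \<Rightarrow> bit) set" where
  "lim_tree T = {x. \<forall>n. map x [0..<n] \<in> T}"

definition cantor_topology :: "(nat \<Rightarrow> bit) topology" where
  "cantor_topology = product_topology (\<lambda>_. discrete_topology UNIV) UNIV"

definition perfect_set :: "(nat \<Rightarrow> bit) set \<Rightarrow> bool" where
  "perfect_set P \<longleftrightarrow>
     P \<noteq> {} \<and> closedin cantor_topology P \<and> P \<subseteq> cantor_topology derived_set_of P"

text \<open>Since \<open>card\<close> is 0 on infinite sets, \<open>|A| \<ge> k\<close> needs a separate clause for them.\<close>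

definition card_ge :: "'a set \<Rightarrow> nat \<Rightarrow> bool" where
  "card_ge A k \<longleftrightarrow> infinite A \<or> k \<le> card A"


section \<open>YZR-systems\<close>

text \<open>
  The underlying set may live in any well-ordered type, so that both arbitrary sets of ordinals
  (type \<open>ordinal\<close>) and \<open>\<omega>\<close> (type \<open>nat\<close>) are covered.  The three functions are only relevant on
  the nonempty finite subsets of the underlying set; the system \<open>s \<restriction> w\<close> is therefore obtained
  by replacing the underlying set with \<open>w\<close>.
\<close>

record 'a yzr =
  yX :: "'a set"
  yr :: "'a set \<Rightarrow> ordinal"
  yj :: "'a set \<Rightarrow> nat"
  yk :: "'a set \<Rightarrow> nat"

definition yzr_system :: "ordinal \<Rightarrow> 'a::wellorder yzr \<Rightarrow> bool" where
  "yzr_system \<epsilon> s \<longleftrightarrow>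
     yX s \<noteq> {} \<and>
     (\<forall>w. w \<subseteq> yX s \<and> finite w \<and> w \<noteq> {} \<longrightarrow> yr s w \<le> \<epsilon>) \<and>
     (\<forall>u w. u \<noteq> {} \<and> u \<subseteq> w \<and> w \<subseteq> yX s \<and> finite w \<longrightarrow> yr s w \<le> yr s u) \<and>
     (\<forall>a\<in>yX s. ord_zero < yr s {a}) \<and>
     (\<forall>w. w \<subseteq> yX s \<and> finite w \<and> w \<noteq> {} \<longrightarrow>
        yk s w < card w \<and>
        \<not> (\<exists>b\<in>yX s - w.
             card {a\<in>w. a < b} = yk s w \<and>
             yj s (insert b (w - {sorted_list_of_set w ! yk s w})) = yj s w \<and>
             yr s (insert b w) = yr s w))"

definition quasi_embedding ::
    "'a::wellorder yzr \<Rightarrow> 'b::wellorder yzr \<Rightarrow> ('a \<Rightarrow> 'b) \<Rightarrow> bool" where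
  "quasi_embedding q s \<phi> \<longleftrightarrow>
     \<phi> \<in> yX q \<rightarrow> yX s \<and> strict_mono_on (yX q) \<phi> \<and>
     (\<forall>v. v \<subseteq> yX q \<and> finite v \<and> v \<noteq> {} \<longrightarrow>
        yr s (\<phi> ` v) = yr q v \<and> yk s (\<phi> ` v) = yk q v \<and>
        (ord_zero < yr q v \<longrightarrow> yj s (\<phi> ` v) = yj q v))"

definition quasi_embedding_into ::
    "'a::wellorder yzr \<Rightarrow> 'a set \<Rightarrow> ('a \<Rightarrow> 'a) \<Rightarrow> bool" where
  "quasi_embedding_into s w \<phi> \<longleftrightarrow> w \<subseteq> yX s \<and> quasi_embedding (s\<lparr>yX := w\<rparr>) s \<phi>"

definition cute :: "ordinal \<Rightarrow> nat yzr \<Rightarrow> bool" where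
  "cute \<epsilon> S \<longleftrightarrow>
     yzr_system \<epsilon> S \<and> yX S = UNIV \<and>
     (\<forall>(q :: ordinal yzr) M. yzr_system \<epsilon> q \<and> finite (yX q) \<longrightarrow>
        (\<exists>\<phi>. quasi_embedding q S \<phi> \<and> (\<forall>a\<in>yX q. M \<le> \<phi> a)))"


section \<open>The family M\<close>

text \<open>
  Here and for bricks, values of \<open>h\<close> and \<open>g\<close> at indices \<open>\<ge> \<iota>\<close> or outside the off-diagonal
  pairs are junk; no notion below depends on them.
\<close>

record mtuple =
  m_len :: nat
  m_set :: "bit list set"
  m_h :: "nat \<Rightarrow> bit list \<Rightarrow> bit list \<Rightarrow> nat"
  m_g :: "nat \<Rightarrow> bit list \<Rightarrow> bit list \<Rightarrow> bit list"

definition Mfam :: "nat \<Rightarrow> (nat \<Rightarrow> bit list set) \<Rightarrow> mtuple set" where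
  "Mfam \<iota> T = {m.
     0 < m_len m \<and> (\<forall>\<eta>\<in>m_set m. length \<eta> = m_len m) \<and> 2 \<le> card (m_set m) \<and>
     (\<forall>(\<eta>, \<nu>)\<in>pairs2 (m_set m). \<forall>i<\<iota>.
        m_g m i \<eta> \<nu> \<in> T (m_h m i \<eta> \<nu>) \<and> length (m_g m i \<eta> \<nu>) = m_len m \<and>
        list_add \<eta> (m_g m i \<eta> \<nu>) = list_add \<nu> (m_g m i \<nu> \<eta>)) \<and>
     (\<forall>(\<eta>, \<nu>)\<in>pairs2 (m_set m).
        distinct (map (\<lambda>i. m_g m i \<eta> \<nu>) [0..<\<iota>] @ map (\<lambda>i. m_g m i \<nu> \<eta>) [0..<\<iota>])) \<and>
     (\<exists>(F :: bit list \<Rightarrow> nat \<Rightarrow> bit) (G :: nat \<Rightarrow> bit list \<Rightarrow> bit list \<Rightarrow> nat \<Rightarrow> bit).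
        (\<forall>\<eta>\<in>m_set m. init_seg \<eta> (F \<eta>)) \<and>
        (\<forall>(\<eta>, \<nu>)\<in>pairs2 (m_set m). \<forall>i<\<iota>.
           init_seg (m_g m i \<eta> \<nu>) (G i \<eta> \<nu>) \<and>
           G i \<eta> \<nu> \<in> lim_tree (T (m_h m i \<eta> \<nu>)) \<and>
           F \<eta> + G i \<eta> \<nu> = F \<nu> + G i \<nu> \<eta>))}"

text \<open>As \<open>\<eta> + \<rho> + \<rho> = \<eta>\<close>, the shifted functions are obtained by shifting the arguments back.\<close>

definition m_shift :: "mtuple \<Rightarrow> bit list \<Rightarrow> mtuple" where
  "m_shift m \<rho> =
     \<lparr>m_len = m_len m,
      m_set = (\<lambda>\<eta>. list_add \<eta> \<rho>) ` m_set m,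
      m_h = (\<lambda>i \<eta> \<nu>. m_h m i (list_add \<eta> \<rho>) (list_add \<nu> \<rho>)),
      m_g = (\<lambda>i \<eta> \<nu>. m_g m i (list_add \<eta> \<rho>) (list_add \<nu> \<rho>))\<rparr>"

definition ess_match :: "nat \<Rightarrow> mtuple \<Rightarrow> mtuple \<Rightarrow> bit list \<Rightarrow> bit list \<Rightarrow> bool" where
  "ess_match \<iota> m n \<eta> \<nu> \<longleftrightarrow>
     (let \<eta>' = take (m_len m) \<eta>; \<nu>' = take (m_len m) \<nu>;
          g = m_g m; g' = (\<lambda>i x y. take (m_len m) (m_g n i x y))
      in (2 < \<iota> \<longrightarrow>
            (\<lambda>i. {g i \<eta>' \<nu>', g i \<nu>' \<eta>'}) ` {..<\<iota>} = (\<lambda>i. {g' i \<eta> \<nu>, g' i \<nu> \<eta>}) ` {..<\<iota>}) \<and>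
         (\<iota> = 2 \<longrightarrow>
            {g 0 \<eta>' \<nu>', g 0 \<nu>' \<eta>', g 1 \<eta>' \<nu>', g 1 \<nu>' \<eta>'} =
            {g' 0 \<eta> \<nu>, g' 0 \<nu> \<eta>, g' 1 \<eta> \<nu>, g' 1 \<nu> \<eta>}) \<and>
         (\<forall>i<\<iota>. \<forall>j<\<iota>.
            (g i \<eta>' \<nu>' = g' j \<eta> \<nu> \<longrightarrow> m_h m i \<eta>' \<nu>' = m_h n j \<eta> \<nu>) \<and>
            (g i \<eta>' \<nu>' = g' j \<nu> \<eta> \<longrightarrow> m_h m i \<eta>' \<nu>' = m_h n j \<nu> \<eta>)))"

definition ess_extends :: "nat \<Rightarrow> mtuple \<Rightarrow> mtuple \<Rightarrow> bool" where
  "ess_extends \<iota> m n \<longleftrightarrow>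
     m_len m \<le> m_len n \<and> m_set m = take (m_len m) ` m_set n \<and>
     (\<forall>(\<eta>, \<nu>)\<in>pairs2 (m_set n).
        take (m_len m) \<eta> \<noteq> take (m_len m) \<nu> \<longrightarrow> ess_match \<iota> m n \<eta> \<nu>)"

definition ess_same :: "nat \<Rightarrow> mtuple \<Rightarrow> mtuple \<Rightarrow> bool" where
  "ess_same \<iota> m n \<longleftrightarrow>
     m_len m = m_len n \<and> m_set m = m_set n \<and>
     (\<forall>(\<eta>, \<nu>)\<in>pairs2 (m_set m). ess_match \<iota> m n \<eta> \<nu>)"

definition m_extends :: "nat \<Rightarrow> mtuple \<Rightarrow> mtuple \<Rightarrow> bool" where
  "m_extends \<iota> m n \<longleftrightarrow>
     m_len m \<le> m_len n \<and> m_set m = take (m_len m) ` m_set n \<and>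
     (\<forall>(\<eta>, \<nu>)\<in>pairs2 (m_set n).
        take (m_len m) \<eta> \<noteq> take (m_len m) \<nu> \<longrightarrow>
        (\<forall>i<\<iota>.
           m_h m i (take (m_len m) \<eta>) (take (m_len m) \<nu>) = m_h n i \<eta> \<nu> \<and>
           m_g m i (take (m_len m) \<eta>) (take (m_len m) \<nu>) = take (m_len m) (m_g n i \<eta> \<nu>)))"


section \<open>Non-disjointness rank\<close>

text \<open>
  \<open>ndrk_ge \<iota> T \<alpha> m\<close> is the relation \<open>ndrk\<^sub>\<iota>(m) \<ge> \<alpha>\<close>.  Every premise concerns smaller ordinals only,
  so the inductive definition amounts to the definition by recursion on \<open>\<alpha>\<close>.
\<close>

inductive ndrk_ge :: "nat \<Rightarrow> (nat \<Rightarrow> bit list set) \<Rightarrow> ordinal \<Rightarrow> mtuple \<Rightarrow> bool"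
  for \<iota> :: nat and T :: "nat \<Rightarrow> bit list set" where
  zero: "m \<in> Mfam \<iota> T \<Longrightarrow> ndrk_ge \<iota> T ord_zero m"
| succ: "m \<in> Mfam \<iota> T \<Longrightarrow>
     \<forall>\<nu>\<in>m_set m. \<exists>n. n \<in> Mfam \<iota> T \<and> m_len m < m_len n \<and> m_extends \<iota> m n \<and>
        ndrk_ge \<iota> T \<beta> n \<and> 2 \<le> card {\<eta>\<in>m_set n. strict_prefix \<nu> \<eta>} \<Longrightarrow>
     ndrk_ge \<iota> T (ord_succ \<beta>) m"
| limit: "m \<in> Mfam \<iota> T \<Longrightarrow> ord_limit \<alpha> \<Longrightarrow> \<forall>\<beta><\<alpha>. ndrk_ge \<iota> T \<beta> m \<Longrightarrow> ndrk_ge \<iota> T \<alpha> m"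

definition ndrk :: "nat \<Rightarrow> (nat \<Rightarrow> bit list set) \<Rightarrow> mtuple \<Rightarrow> ord_inf" where
  "ndrk \<iota> T m =
     (if \<forall>\<alpha>. ndrk_ge \<iota> T \<alpha> m then Infty else Fin (GREATEST \<alpha>. ndrk_ge \<iota> T \<alpha> m))"

definition ndrk_trees :: "nat \<Rightarrow> (nat \<Rightarrow> bit list set) \<Rightarrow> ord_inf" where
  "ndrk_trees \<iota> T = ord_inf_Sup (ndrk \<iota> T ` Mfam \<iota> T)"


section \<open>Bricks\<close>

record brick =
  b_w :: "nat set"
  b_n :: nat
  b_eta :: "nat \<Rightarrow> bit list"
  b_h :: "nat \<Rightarrow> nat \<Rightarrow> nat \<Rightarrow> nat"
  b_g :: "nat \<Rightarrow> nat \<Rightarrow> nat \<Rightarrow> bit list"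
  b_M :: "mtuple set"

definition lin_indep_seqs :: "nat \<Rightarrow> nat set \<Rightarrow> (nat \<Rightarrow> bit list) \<Rightarrow> bool" where
  "lin_indep_seqs n w \<eta> \<longleftrightarrow>
     (\<forall>z :: nat \<Rightarrow> bit. (\<forall>k<n. (\<Sum>a\<in>w. z a * \<eta> a ! k) = 0) \<longrightarrow> (\<forall>a\<in>w. z a = 0))"

text \<open>\<open>brick_piece \<iota> T c b l v m\<close> says that \<open>m\<close> is the tuple \<open>m(l, v)\<close> of the brick \<open>b\<close>.\<close>

definition brick_piece ::
    "nat \<Rightarrow> (nat \<Rightarrow> bit list set) \<Rightarrow> (nat \<Rightarrow> nat) \<Rightarrow> brick \<Rightarrow> nat \<Rightarrow> nat set \<Rightarrow> mtuple \<Rightarrow> bool" where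
  "brick_piece \<iota> T c b l v m \<longleftrightarrow>
     m \<in> Mfam \<iota> T \<and> v \<subseteq> b_w b \<and> 3 \<le> card v \<and> 0 < l \<and> m_len m = l \<and> l \<le> b_n b \<and>
     (\<forall>(x, y)\<in>pairs2 v. \<forall>i<\<iota>. c (b_h b i x y) \<le> l) \<and>
     m_set m = (\<lambda>a. take l (b_eta b a)) ` v \<and>
     (\<forall>(x, y)\<in>pairs2 v. take l (b_eta b x) \<noteq> take l (b_eta b y)) \<and>
     (\<forall>(x, y)\<in>pairs2 v. \<forall>i<\<iota>.
        m_h m i (take l (b_eta b x)) (take l (b_eta b y)) = b_h b i x y \<and>
        m_g m i (take l (b_eta b x)) (take l (b_eta b y)) = take l (b_g b i x y))"

definition brick_family ::
    "nat \<Rightarrow> (nat \<Rightarrow> bit list set) \<Rightarrow> (nat \<Rightarrow> nat) \<Rightarrow> brick \<Rightarrow> mtuple set" where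
  "brick_family \<iota> T c b = {m. \<exists>l v. brick_piece \<iota> T c b l v m}"

definition is_brick ::
    "nat yzr \<Rightarrow> nat \<Rightarrow> (nat \<Rightarrow> bit list set) \<Rightarrow> (nat \<Rightarrow> nat) \<Rightarrow> brick \<Rightarrow> bool" where
  "is_brick S \<iota> T c b \<longleftrightarrow>
     (finite (b_w b) \<and> 3 \<le> card (b_w b) \<and> 0 < b_n b) \<and>
     ((\<forall>a\<in>b_w b. length (b_eta b a) = b_n b) \<and> lin_indep_seqs (b_n b) (b_w b) (b_eta b)) \<and>
     (\<forall>(x, y)\<in>pairs2 (b_w b). \<forall>i<\<iota>.
        c (b_h b i x y) \<le> b_n b \<and>
        b_g b i x y \<in> (\<Union>m. T m) \<and> length (b_g b i x y) = b_n b) \<and>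
     (\<exists>m\<in>Mfam \<iota> T.
        m_len m = b_n b \<and> m_set m = b_eta b ` b_w b \<and>
        (\<forall>(x, y)\<in>pairs2 (b_w b). \<forall>i<\<iota>.
           m_h m i (b_eta b x) (b_eta b y) = b_h b i x y \<and>
           m_g m i (b_eta b x) (b_eta b y) = b_g b i x y)) \<and>
     b_M b = brick_family \<iota> T c b \<and>
     (\<forall>l w0 w1 m0 m1 \<rho>.
        brick_piece \<iota> T c b l w0 m0 \<and> brick_piece \<iota> T c b l w1 m1 \<and>
        length \<rho> = l \<and> ess_same \<iota> m0 (m_shift m1 \<rho>) \<longrightarrow>
        (\<exists>\<pi>. bij_betw \<pi> w0 w1 \<and> strict_mono_on w0 \<pi> \<and> quasi_embedding_into S w0 \<pi> \<and>
           (\<forall>a\<in>w0. list_add (take l (b_eta b a)) \<rho> = take l (b_eta b (\<pi> a))))) \<and>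
     (\<forall>l v m a n.
        brick_piece \<iota> T c b l v m \<and> a \<in> v \<and> card {x\<in>v. x < a} = yk S v \<and>
        yr S v = ord_zero \<and> n \<in> b_M b \<and> ess_extends \<iota> m n \<longrightarrow>
        card {\<nu>\<in>m_set n. prefix (take l (b_eta b a)) \<nu>} = 1)"

definition brick_le :: "nat \<Rightarrow> brick \<Rightarrow> brick \<Rightarrow> bool" where
  "brick_le \<iota> b0 b1 \<longleftrightarrow>
     b_w b0 \<subseteq> b_w b1 \<and> b_n b0 \<le> b_n b1 \<and>
     (\<forall>a\<in>b_w b0. prefix (b_eta b0 a) (b_eta b1 a)) \<and>
     (\<forall>(x, y)\<in>pairs2 (b_w b0). \<forall>i<\<iota>.
        b_h b1 i x y = b_h b0 i x y \<and> prefix (b_g b0 i x y) (b_g b1 i x y))"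

text \<open>The last component is recomputed, since it is determined by the other ones.\<close>

definition brick_restrict ::
    "nat \<Rightarrow> (nat \<Rightarrow> bit list set) \<Rightarrow> (nat \<Rightarrow> nat) \<Rightarrow> brick \<Rightarrow> nat set \<Rightarrow> brick" where
  "brick_restrict \<iota> T c b v = (b\<lparr>b_w := v\<rparr>)\<lparr>b_M := brick_family \<iota> T c (b\<lparr>b_w := v\<rparr>)\<rparr>"

definition brick_image :: "(nat \<Rightarrow> nat) \<Rightarrow> brick \<Rightarrow> brick" where
  "brick_image \<phi> b =
     (let \<psi> = inv_into (b_w b) \<phi>
      in \<lparr>b_w = \<phi> ` b_w b,
          b_n = b_n b,
          b_eta = (\<lambda>a. b_eta b (\<psi> a)),
          b_h = (\<lambda>i x y. b_h b i (\<psi> x) (\<psi> y)),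
          b_g = (\<lambda>i x y. b_g b i (\<psi> x) (\<psi> y)),
          b_M = b_M b\<rparr>)"


section \<open>Controlled amalgamation\<close>

definition controlled_amalgamation ::
    "nat \<Rightarrow> (nat \<Rightarrow> bit list set) \<Rightarrow> (nat \<Rightarrow> nat) \<Rightarrow> nat yzr \<Rightarrow> bool" where
  "controlled_amalgamation \<iota> T c S \<longleftrightarrow>
     (\<exists>b :: nat \<Rightarrow> brick.
        (\<forall>n. is_brick S \<iota> T c (b n)) \<and>
        (\<forall>n. brick_le \<iota> (b n) (b (Suc n))) \<and>
        (\<Union>n. b_w (b n)) = UNIV \<and>
        filterlim (\<lambda>n. b_n (b n)) at_top sequentially \<and>
        (\<forall>n u w \<pi>0 \<pi>1.
           u \<subseteq> w \<and> w \<subseteq> b_w (b n) \<and> 3 \<le> card w \<and>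
           (\<forall>v \<delta>. v \<subseteq> u \<and> \<delta> \<in> w - u \<and> yr S (insert \<delta> v) = ord_zero \<longrightarrow>
              yk S (insert \<delta> v) \<noteq> card {x\<in>v. x < \<delta>}) \<and>
           quasi_embedding_into S w \<pi>0 \<and> quasi_embedding_into S w \<pi>1 \<and>
           (\<forall>a\<in>u. \<pi>0 a = \<pi>1 a) \<and> \<pi>0 ` (w - u) \<inter> \<pi>1 ` (w - u) = {} \<longrightarrow>
           (\<exists>K \<pi>. quasi_embedding_into S (\<pi>0 ` w \<union> \<pi>1 ` w) \<pi> \<and>
              \<pi> ` (\<pi>0 ` w \<union> \<pi>1 ` w) \<subseteq> b_w (b K) \<and>
              brick_le \<iota> (brick_image (\<pi> \<circ> \<pi>0) (brick_restrict \<iota> T c (b n) w))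
                (brick_restrict \<iota> T c (b K) ((\<pi> \<circ> \<pi>0) ` w)) \<and>
              brick_le \<iota> (brick_image (\<pi> \<circ> \<pi>1) (brick_restrict \<iota> T c (b n) w))
                (brick_restrict \<iota> T c (b K) ((\<pi> \<circ> \<pi>1) ` w)))) \<and>
        (\<forall>n w \<pi>0 u.
           w \<subseteq> b_w (b n) \<and> 3 \<le> card w \<and> quasi_embedding_into S w \<pi>0 \<and>
           \<pi>0 ` w \<subseteq> u \<and> finite u \<longrightarrow>
           (\<exists>K \<pi>. quasi_embedding_into S u \<pi> \<and> \<pi> ` u \<subseteq> b_w (b K) \<and>
              brick_le \<iota> (brick_image (\<pi> \<circ> \<pi>0) (brick_restrict \<iota> T c (b n) w))
                (brick_restrict \<iota> T c (b K) ((\<pi> \<circ> \<pi>0) ` w)))))"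

end

theory Submission
  imports Defs
begin

text \<open>
  The first half asks for an uncountable structure that amalgamation only produces countably, and
  the idea is to organise the finite pieces so that an uncountable limit exists.  Call a finite set
  of indices plain if its singletons have rank \<open>1\<close> and \<open>j\<close>-value \<open>0\<close>, its larger subsets have rank
  \<open>0\<close>, and \<open>k\<close> vanishes on all its nonempty subsets.  Finite systems of this kind exist in every size,
  so a cute system contains them (\<open>plain_on_exists\<close>), and every increasing map between plain sets is a
  quasi-embedding.  Since \<open>k\<close> vanishes, amalgamation over an initial segment is always permitted: two
  copies of a finite configuration can be glued along any common initial segment
  (\<open>placed_step\<close>).  Iterating this with prescribed cuts gives configurations on positions
  \<open>{..<size_at n}\<close>, each one being two copies of the one before.

  A path through the levels picks a position at every level, moving to one of the two copies.  The
  sequences \<open>\<eta>\<close> at its positions grow to a point of the Cantor space.  If two paths eventually always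
  move to the same copy, then the tree indices of the pair stay constant and its nodes grow to
  branches; translating these gives \<open>2 * \<iota>\<close> points common to the two sets (\<open>overlap\<close>).  It remains to find
  uncountably many paths that pairwise have this property.  This is a combinatorial statement about
  the cuts alone, of the kind that simplified gap-one morasses provide: if the cuts come back to all
  positions often enough, a countable coherent family can be extended by one more path
  (\<open>good_family_extend\<close>), so a maximal family is uncountable.

  For the second half, suppose that \<open>P\<close> is a perfect set of translations which overlap in \<open>2 * \<iota>\<close>
  points.  The trees and the initial segments involved give every pair from \<open>P\<close> one of countably many
  colours, and having a given colour is a closed relation by compactness (\<open>closed_coloured\<close>).  By
  Baire's theorem rectangles in \<open>P \<times> P\<close> contain smaller rectangles of one colour
  (\<open>baire_rectangle\<close>).  Hence there are tuples all of whose pairs are realised on whole boxes, and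
  such a tuple can be extended to another one in which a given vector is split (\<open>large_step\<close>).  So
  its rank is infinite, against the assumed bound on the rank.
\<close>

section \<open>Ordinals\<close>

text \<open>
  A well-order that leaves a point of its type free is an initial segment of a longer one.  In an
  infinite type every well-order has a copy that avoids some point, so this is what makes the ordinals unbounded.
\<close>
lemma Well_order_add_top:
  fixes r :: "'a rel"
  assumes r: "Well_order r" and z: "z \<notin> Field r"
  shows "\<exists>r' :: 'a rel. Well_order r' \<and> (r, r') \<in> ordLess"
proof -
  define r' where "r' = r \<union> insert z (Field r) \<times> {z}"
  have F: "Field r' = insert z (Field r)" by (auto simp: r'_def Field_def)
  have zr: "(z, x) \<notin> r" "(x, z) \<notin> r" for x using z by (auto simp: Field_def)
  have props: "refl_on (Field r) r" "r \<subseteq> Field r \<times> Field r" "trans r" "antisym r"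
      "total_on (Field r) r" "wf (r - Id)"
    using r by (auto simp: well_order_on_def linear_order_on_def partial_order_on_def
        preorder_on_def Field_def)
  have "refl_on (Field r') r'" "r' \<subseteq> Field r' \<times> Field r'"
    using props(1,2) unfolding F by (auto simp: r'_def refl_on_def)
  moreover have "trans r'"
    using props(2,3) zr by (auto simp: r'_def trans_def)
  moreover have "antisym r'"
    using props(4) zr by (auto simp: r'_def antisym_def)
  moreover have "total_on (Field r') r'"
    using props(5) unfolding F by (auto simp: r'_def total_on_def)
  moreover have "wf (r' - Id)"
  proof -
    have "wf (Field r \<times> {z})" 
      by (rule wf_subset[of "inv_image less_than (\<lambda>x. if x = z then 1 else 0)"]) (use z in auto)
    then have "wf ((r - Id) \<union> Field r \<times> {z})"
      using props(6) zr by (intro wf_Un) auto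
    moreover have "r' - Id \<subseteq> (r - Id) \<union> Field r \<times> {z}" by (auto simp: r'_def)
    ultimately show ?thesis by (rule wf_subset)
  qed
  ultimately have W: "Well_order r'"
    by (simp add: well_order_on_def linear_order_on_def partial_order_on_def preorder_on_def)
  have "underS r' z = Field r" using z by (auto simp: underS_def r'_def Field_def)
  moreover have "Restr r' (Field r) = r" using z props(2) by (auto simp: r'_def)
  ultimately have "(r, r') \<in> ordLess" using underS_Restr_ordLess[OF W, of z] F by simp
  then show ?thesis using W by blast
qed

lemma ordinal_no_top: "\<exists>\<beta>. \<alpha> < (\<beta> :: ordinal)"
proof -
  let ?r = "rep_ordinal \<alpha>"
  \<comment> \<open>The copy of the order under \<open>f\<close> avoids the set \<open>{0}\<close>.\<close>
  define f where "f A = Suc ` A" for A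
  have f: "inj_on f (Field ?r)" by (auto simp: f_def inj_on_def inj_image_eq_iff)
  have W: "Well_order (dir_image ?r f)" and iso: "(?r, dir_image ?r f) \<in> ordIso"
    using Well_order_dir_image[OF Well_order_rep_ordinal f]
      dir_image_ordIso[OF Well_order_rep_ordinal f] by auto
  have "{0} \<notin> Field (dir_image ?r f)" by (auto simp: f_def dir_image_def Field_def)
  then obtain r' :: "nat set rel" where r': "Well_order r'" "(dir_image ?r f, r') \<in> ordLess"
    using Well_order_add_top[OF W] by blast
  then have "(?r, r') \<in> ordLess" using iso ordIso_ordLess_trans by blast
  moreover have "(r', rep_ordinal (abs_ordinal r')) \<in> ordIso"
    using Quotient_rep_abs[OF Quotient_ordinal] ordIso_reflexive[OF r'(1)] ordIso_symmetric by blast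
  ultimately have "\<alpha> < abs_ordinal r'"
    unfolding less_ordinal.rep_eq using ordLess_ordIso_trans by blast
  then show ?thesis by blast
qed

lemma less_ord_succ: "\<alpha> < ord_succ \<alpha>"
  unfolding ord_succ_def using ordinal_no_top by (rule LeastI_ex)

lemma ord_succ_le: "\<alpha> < \<beta> \<Longrightarrow> ord_succ \<alpha> \<le> \<beta>"
  unfolding ord_succ_def by (rule Least_le)

lemma infinite_ordinals: "infinite (UNIV :: ordinal set)"
  using ordinal_no_top infinite_growing[of "UNIV :: ordinal set"] by blast

lemma countable_below_omega1: "\<alpha> < ord_omega1 \<Longrightarrow> countable {..<\<alpha>}"
  unfolding ord_omega1_def using not_less_Least by blast

text \<open>
  Choose values recursively: before stage \<open>\<alpha>\<close> only countably many have been used.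
\<close>
lemma inj_omega1:
  assumes "uncountable X"
  shows "\<exists>f :: ordinal \<Rightarrow> 'a. inj_on f {..<ord_omega1} \<and> f ` {..<ord_omega1} \<subseteq> X"
proof -
  define f :: "ordinal \<Rightarrow> 'a" where
    "f = wfrec {(x, y). x < y} (\<lambda>f \<alpha>. SOME x. x \<in> X \<and> x \<notin> f ` {..<\<alpha>})"
  have f: "f \<alpha> = (SOME x. x \<in> X \<and> x \<notin> f ` {..<\<alpha>})" for \<alpha>
  proof -
    have "Wfrec.cut f {(x, y). x < y} \<alpha> ` {..<\<alpha>} = f ` {..<\<alpha>}"
      by (intro image_cong) (auto simp: Wfrec.cut_def)
    then show ?thesis
      using wfrec[OF wf, of "\<lambda>f \<alpha>. SOME x. x \<in> X \<and> x \<notin> f ` {..<\<alpha>}" \<alpha>] by (simp add: f_def)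
  qed
  have "f \<alpha> \<in> X \<and> f \<alpha> \<notin> f ` {..<\<alpha>}" if "\<alpha> < ord_omega1" for \<alpha>
  proof -
    have "uncountable (X - f ` {..<\<alpha>})"
      using assms countable_below_omega1[OF that] by (simp add: uncountable_minus_countable)
    then have "\<exists>x. x \<in> X \<and> x \<notin> f ` {..<\<alpha>}"
      by (metis Diff_eq_empty_iff countable_empty subsetI)
    then show ?thesis unfolding f[of \<alpha>] by (rule someI_ex)
  qed
  then show ?thesis
    by (intro exI[of _ f]) (auto simp: inj_on_def, metis imageI lessThan_iff linorder_neqE)
qed

section \<open>Uncountably many coherent paths through a gluing scheme\<close>

text \<open>
  The pair \<open>(t, s)\<close> at level \<open>n\<close> prescribes how the next configuration arises: two copies of a
  configuration on \<open>{..<t}\<close> are glued along their common initial segment \<open>{..<s}\<close>.  The cut \<open>s\<close> runs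
  down to \<open>0\<close> one by one and is then reset to the full size, so that it passes just above every
  position again and again (\<open>cut_hits\<close> below).  It starts with three positions because bricks have
  at least three indices.
\<close>
primrec scheme :: "nat \<Rightarrow> nat \<times> nat" where
  "scheme 0 = (3, 3)"
| "scheme (Suc n) = (case scheme n of (t, s) \<Rightarrow> (t + (t - s), if s = 0 then t + (t - s) else s - 1))"

definition size_at :: "nat \<Rightarrow> nat" where "size_at n = fst (scheme n)"
definition cut_at :: "nat \<Rightarrow> nat" where "cut_at n = snd (scheme n)"

lemma scheme_0: "size_at 0 = 3" "cut_at 0 = 3"
  by (simp_all add: size_at_def cut_at_def)

lemma size_Suc: "size_at (Suc n) = size_at n + (size_at n - cut_at n)"
  and cut_Suc: "cut_at (Suc n) = (if cut_at n = 0 then size_at (Suc n) else cut_at n - 1)"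
  by (simp_all add: size_at_def cut_at_def split: prod.split)

lemma cut_le_size: "cut_at n \<le> size_at n"
  by (induction n) (auto simp: scheme_0 size_Suc cut_Suc)

lemma size_ge_3: "3 \<le> size_at n"
  by (induction n) (auto simp: scheme_0 size_Suc)

text \<open>
  The inclusions of level \<open>n\<close> into level \<open>n + 1\<close>: the first copy (\<open>b = False\<close>) is included
  identically, the second one (\<open>b = True\<close>) moves all positions from the cut on above the first copy.
\<close>
definition shift :: "nat \<Rightarrow> bool \<Rightarrow> nat \<Rightarrow> nat" where
  "shift n b i = (if b \<and> cut_at n \<le> i then i + (size_at n - cut_at n) else i)"

lemma shift_mono: "i < j \<Longrightarrow> shift n b i < shift n b j"
  by (auto simp: shift_def)

lemma shift_less_size: "i < size_at n \<Longrightarrow> shift n b i < size_at (Suc n)"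
  by (auto simp: shift_def size_Suc)

lemma shift_below_cut: "i < cut_at n \<Longrightarrow> shift n b i = i"
  by (simp add: shift_def)

text \<open>
  A path \<open>x\<close> lists the positions, level by level, of one point of a future uncountable structure.
  Paths that always move into the same copy keep the finite configuration that they once spanned.
\<close>
definition coherent :: "(nat \<Rightarrow> nat) set \<Rightarrow> nat \<Rightarrow> bool" where
  "coherent F n \<longleftrightarrow> (\<forall>m\<ge>n. \<exists>b. \<forall>x\<in>F. x (Suc m) = shift m b (x m))"

lemma coherent_later: "coherent F n \<Longrightarrow> n \<le> m \<Longrightarrow> coherent F m"
  by (auto simp: coherent_def)

lemma coherent_subset: "coherent F n \<Longrightarrow> G \<subseteq> F \<Longrightarrow> coherent G n"
  by (fastforce simp: coherent_def)

lemma coherent_order: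
  assumes "coherent F n" "x \<in> F" "y \<in> F" "x n < y n" "n \<le> m"
  shows "x m < y m"
  using assms(5)
proof (induction m rule: dec_induct)
  case base
  then show ?case using assms by simp
next
  case (step m)
  then obtain b where "\<forall>x\<in>F. x (Suc m) = shift m b (x m)"
    using assms(1) by (auto simp: coherent_def)
  then show ?case using shift_mono[OF step.IH, of m b] assms by simp
qed

lemma cut_reset: "\<exists>m\<ge>n. cut_at m = size_at m"
proof (induction "cut_at n" arbitrary: n rule: less_induct)
  case less
  show ?case
  proof (cases "cut_at n = 0")
    case True
    then show ?thesis by (intro exI[of _ "Suc n"]) (simp add: cut_Suc)
  next
    case False
    then have "cut_at (Suc n) < cut_at n" by (simp add: cut_Suc)
    from less[OF this] show ?thesis using Suc_leD by blast
  qed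
qed

text \<open>
  Directly after a reset the position lies below the cut.  It does not move before the cut has come
  down to it, and the cut comes down in steps of one.
\<close>
lemma cut_hits:
  assumes "coherent {x} n" "\<And>m. x m < size_at m"
  shows "\<exists>m\<ge>n. cut_at m = Suc (x m)"
proof -
  obtain m0 where m0: "n \<le> m0" "cut_at m0 = size_at m0" using cut_reset by blast
  have "\<exists>m'\<ge>m. cut_at m' = Suc (x m')" if "n \<le> m" "x m < cut_at m" for m
    using that
  proof (induction "cut_at m - x m" arbitrary: m rule: less_induct)
    case less
    show ?case
    proof (cases "cut_at m = Suc (x m)")
      case False
      obtain b where "x (Suc m) = shift m b (x m)"
        using assms(1) less.prems by (auto simp: coherent_def)
      then have "x (Suc m) = x m" using less.prems by (simp add: shift_below_cut)
      moreover have "cut_at (Suc m) = cut_at m - 1" using less.prems by (simp add: cut_Suc)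
      ultimately have lt: "x (Suc m) < cut_at (Suc m)" and "cut_at (Suc m) - x (Suc m) < cut_at m - x m"
        using less.prems False by auto
      from less.hyps[OF this(2) _ lt] less.prems(1) show ?thesis by (auto dest: Suc_leD)
    qed blast
  qed
  from this[of m0] show ?thesis using m0 assms(2)[of m0] le_trans by metis
qed

text \<open>
  A reserve of freedom: infinitely often the cut is just above \<open>x\<close> and \<open>y\<close> is not moved.  At such
  a level a new path may move to the second copy without losing coherence with \<open>x\<close> or with anything
  below \<open>x\<close>, and thereby overtake \<open>y\<close>.
\<close>
definition stays :: "(nat \<Rightarrow> nat) \<Rightarrow> (nat \<Rightarrow> nat) \<Rightarrow> bool" where
  "stays x y \<longleftrightarrow> (\<forall>N. \<exists>m\<ge>N. cut_at m = Suc (x m) \<and> y (Suc m) = y m)"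

text \<open>
  The zero path is a member so that a new path has something to be above from the start.  The last
  clause is the promise that keeps countable families extendable.
\<close>
definition good_family :: "(nat \<Rightarrow> nat) set \<Rightarrow> bool" where
  "good_family X \<longleftrightarrow> (\<lambda>_. 0) \<in> X \<and> (\<forall>x\<in>X. \<forall>n. x n < size_at n) \<and>
     (\<forall>F\<subseteq>X. finite F \<longrightarrow> (\<exists>n. coherent F n)) \<and>
     (\<forall>x\<in>X. \<forall>y\<in>X. x \<noteq> y \<longrightarrow> (\<exists>n. coherent {x, y} n \<and> x n \<noteq> y n)) \<and>
     (\<forall>x\<in>X. \<forall>y\<in>X. \<forall>n. coherent {x, y} n \<and> x n < y n \<longrightarrow> stays x y)"

lemma good_familyD:
  assumes "good_family X"
  shows "x \<in> X \<Longrightarrow> x n < size_at n"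
    and "F \<subseteq> X \<Longrightarrow> finite F \<Longrightarrow> \<exists>n. coherent F n"
    and "x \<in> X \<Longrightarrow> y \<in> X \<Longrightarrow> x \<noteq> y \<Longrightarrow> \<exists>n. coherent {x, y} n \<and> x n \<noteq> y n"
    and "x \<in> X \<Longrightarrow> y \<in> X \<Longrightarrow> coherent {x, y} n \<Longrightarrow> x n < y n \<Longrightarrow> stays x y"
  using assms unfolding good_family_def by (simp, simp, simp, meson)

text \<open>
  A path can be made to follow the paths of \<open>F\<close>.  It has to obey them only at levels where one of
  them is at or above the cut; at all other levels its choice \<open>d\<close> is free, because then neither
  inclusion moves a member of \<open>F\<close>.
\<close>
lemma follow:
  assumes F: "coherent F n" and x: "\<And>m. x m < size_at m"
  shows "\<exists>q. (\<forall>i\<le>n. q i = x i) \<and> (\<forall>m. q m < size_at m) \<and> coherent (insert q F) n \<and>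
    (\<forall>m\<ge>n. (\<forall>y\<in>F. y m < cut_at m) \<longrightarrow> q (Suc m) = shift m (d m) (q m))"
proof -
  obtain b0 where b0: "\<And>m y. n \<le> m \<Longrightarrow> y \<in> F \<Longrightarrow> y (Suc m) = shift m (b0 m) (y m)"
    using F unfolding coherent_def by metis
  define b where "b m = (if \<forall>y\<in>F. y m < cut_at m then d m else b0 m)" for m
  define q where "q = rec_nat (x 0) (\<lambda>m v. if m < n then x (Suc m) else shift m (b m) v)"
  have qx: "q i = x i" if "i \<le> n" for i
    using that by (cases i) (auto simp: q_def)
  have qS: "q (Suc m) = shift m (b m) (q m)" if "n \<le> m" for m
    using that by (simp add: q_def)
  have "q m < size_at m" for m
  proof (induction m)
    case 0 then show ?case using x by (simp add: q_def)
  next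
    case (Suc m)
    then show ?case using x[of "Suc m"] shift_less_size[of "q m" m]
      by (cases "m < n") (auto simp: qx qS)
  qed
  moreover have "coherent (insert q F) n"
    unfolding coherent_def
  proof (intro allI impI)
    fix m assume m: "n \<le> m"
    have "y (Suc m) = shift m (b m) (y m)" if "y \<in> F" for y
      using b0[OF m that] that shift_below_cut[of "y m" m] by (auto simp: b_def)
    then show "\<exists>b. \<forall>x\<in>insert q F. x (Suc m) = shift m b (x m)" using qS[OF m] by auto
  qed
  ultimately show ?thesis using qx qS by (intro exI[of _ q]) (auto simp: b_def)
qed

text \<open>
  A point at or above the cut that stays has chosen the first copy, and then all points stay.
\<close>
lemma shift_stays:
  assumes "y (Suc m) = shift m b (y m)" "y (Suc m) = y m" "cut_at m \<le> y m" "y m < size_at m"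
  shows "shift m b i = i"
  using assms by (auto simp: shift_def split: if_splits)

text \<open>
  One stage in the construction of a path above all members of a countable family.  The path built
  so far lies above the finite set \<open>F\<close>; it has to get above \<open>z\<close> as well, and it has to stay at
  least once while the cut is just above \<open>y\<close>, for each \<open>y\<close> in \<open>F\<close>.
  
  Staying whenever there is a choice meets the second demand: for the topmost \<open>y\<close> the choice is free,
  and for any other \<open>y\<close> a member of \<open>F\<close> above \<open>y\<close> stays by the definition of a good family and
  forces all the others to stay.  If \<open>z\<close> is then still not below the path, a level where the cut is
  just above the topmost member of \<open>F\<close> and \<open>z\<close> stays allows the path to jump over \<open>z\<close>.
\<close>
lemma stage_step:
  assumes X: "good_family X" and F: "F \<subseteq> X" "finite F" "F \<noteq> {}"
    and x: "\<And>m. x m < size_at m" and n: "coherent F n" and top: "\<And>y. y \<in> F \<Longrightarrow> y n < x n"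
    and z: "z \<in> X"
  shows "\<exists>x' n'. n < n' \<and> (\<forall>i\<le>n. x' i = x i) \<and> (\<forall>m. x' m < size_at m) \<and> coherent (insert x' F) n \<and>
    coherent (insert z F) n' \<and> (\<forall>y\<in>insert z F. y n' < x' n') \<and>
    (\<forall>y\<in>F. \<exists>m. n \<le> m \<and> m < n' \<and> cut_at m = Suc (y m) \<and> x' (Suc m) = x' m)"
proof -
  have Xb: "\<And>y m. y \<in> X \<Longrightarrow> y m < size_at m"
    and Xc: "\<And>F. F \<subseteq> X \<Longrightarrow> finite F \<Longrightarrow> \<exists>n. coherent F n"
    and Xs: "\<And>x y n. x \<in> X \<Longrightarrow> y \<in> X \<Longrightarrow> coherent {x, y} n \<Longrightarrow> x n < y n \<Longrightarrow> stays x y"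
    using good_familyD[OF X] by auto
  obtain q where q: "\<And>i. i \<le> n \<Longrightarrow> q i = x i" "\<And>m. q m < size_at m" "coherent (insert q F) n"
    "\<And>m. n \<le> m \<Longrightarrow> (\<forall>y\<in>F. y m < cut_at m) \<Longrightarrow> q (Suc m) = shift m False (q m)"
    using follow[OF n x, of "\<lambda>_. False"] by blast
  have qtop: "y m < q m" if "y \<in> F" "n \<le> m" for y m
    using coherent_order[OF q(3), of y q m] that q(1) top by simp
  have "\<exists>m\<ge>n. cut_at m = Suc (y m) \<and> q (Suc m) = q m" if y: "y \<in> F" for y
  proof (cases "\<exists>y'\<in>F. y n < y' n")
    case True
    then obtain y' where y': "y' \<in> F" "y n < y' n" by blast
    have "stays y y'"
      using y y' F(1) coherent_subset[OF n] by (intro Xs[of y y' n]) auto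
    then obtain m where m: "n \<le> m" "cut_at m = Suc (y m)" "y' (Suc m) = y' m"
      by (auto simp: stays_def)
    have "y m < y' m" using coherent_order[OF n y y'(1,2) m(1)] .
    moreover obtain b where "\<forall>x\<in>insert q F. x (Suc m) = shift m b (x m)"
      using q(3) m(1) by (auto simp: coherent_def)
    ultimately have "q (Suc m) = q m"
      using shift_stays[of y' m b "q m"] y'(1) m Xb[of y' m] F(1) by auto
    then show ?thesis using m by blast
  next
    case False
    obtain m where m: "n \<le> m" "cut_at m = Suc (y m)"
      using cut_hits[of y n] coherent_subset[OF n, of "{y}"] y Xb F(1) by auto
    have "y' m \<le> y m" if "y' \<in> F" for y'
    proof (rule ccontr)
      assume c: "\<not> y' m \<le> y m"
      show False
      proof (cases "y' n = y n")
        case True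
        have "y' k = y k" if "n \<le> k" for k
          using that
        proof (induction k rule: dec_induct)
          case (step k)
          then show ?case using n y \<open>y' \<in> F\<close> unfolding coherent_def by metis
        qed (use True in simp)
        then show False using c m(1) by simp
      next
        case neq: False
        then have "y' n < y n" using False that by (meson linorder_neqE_nat)
        then show False using coherent_order[OF n that y _ m(1)] c by simp
      qed
    qed
    then have "q (Suc m) = shift m False (q m)"
      using m by (intro q(4)) (auto simp: less_Suc_eq_le)
    then show ?thesis using m by (auto simp: shift_def)
  qed
  then obtain t where t: "\<And>y. y \<in> F \<Longrightarrow> n \<le> t y \<and> cut_at (t y) = Suc (y (t y)) \<and> q (Suc (t y)) = q (t y)"
    by metis
  obtain n0 where n0: "coherent (insert z F) n0" using Xc[of "insert z F"] F z by auto
  \<comment> \<open>From level \<open>n1\<close> on \<open>z\<close> is coherent with \<open>F\<close>, and all required stays have happened.\<close>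
  define n1 where "n1 = Suc (n0 + n + Max (t ` F))"
  have n1: "coherent (insert z F) n1" "n < n1" "\<And>y. y \<in> F \<Longrightarrow> t y < n1"
    using coherent_later[OF n0] F(2) by (auto simp: n1_def le_imp_less_Suc trans_le_add2)
  show ?thesis
  proof (cases "z n1 < q n1")
    case True
    moreover have "\<exists>m. n \<le> m \<and> m < n1 \<and> cut_at m = Suc (y m) \<and> q (Suc m) = q m" if "y \<in> F" for y
      using t[OF that] n1(3)[OF that] by blast
    ultimately show ?thesis
      using q n1 qtop by (intro exI[of _ q] exI[of _ n1]) (auto simp: less_imp_le)
  next
    case False
    have "Max ((\<lambda>y. y n1) ` F) \<in> (\<lambda>y. y n1) ` F" using F by (intro Max_in) auto
    then obtain y0 where y0: "y0 \<in> F" "y0 n1 = Max ((\<lambda>y. y n1) ` F)" by auto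
    have y0max: "y n1 \<le> y0 n1" if "y \<in> F" for y
      using that F y0(2) by auto
    have "y0 n1 < z n1" using False qtop[OF y0(1), of n1] n1 by simp
    moreover have "coherent {y0, z} n1" using coherent_subset[OF n1(1)] y0 by auto
    ultimately have "stays y0 z" using Xs y0(1) F(1) z by blast
    then obtain m where m: "n1 \<le> m" "cut_at m = Suc (y0 m)" "z (Suc m) = z m"
      unfolding stays_def by blast
    have max_m: "y m < cut_at m" if y: "y \<in> F" for y
    proof (rule ccontr)
      assume "\<not> y m < cut_at m"
      then have "y0 m < y m" using m by simp
      moreover have "y n1 = y0 n1 \<or> y n1 < y0 n1" using y0max[OF y] by linarith
      moreover have "y k = y0 k" if "y n1 = y0 n1" "n1 \<le> k" for k
        using that(2)
      proof (induction k rule: dec_induct)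
        case (step k)
        then show ?case using n1(1) y y0(1) unfolding coherent_def by (metis insertCI)
      qed (use that in simp)
      ultimately show False using coherent_order[OF n1(1) _ _ _ m(1), of y y0] y y0(1) m(1) by auto
    qed
    obtain q' where q': "\<And>i. i \<le> m \<Longrightarrow> q' i = q i" "\<And>i. q' i < size_at i" "coherent (insert q' F) m"
      "\<And>i. m \<le> i \<Longrightarrow> (\<forall>y\<in>F. y i < cut_at i) \<Longrightarrow> q' (Suc i) = shift i True (q' i)"
      using follow[of F m q "\<lambda>_. True"] coherent_later[OF n] q(2) n1(2) m(1) by auto
    have "q' (Suc m) = shift m True (q m)" using q'(4)[of m] max_m q'(1) by simp
    moreover have qm: "cut_at m \<le> q m" using qtop[OF y0(1), of m] m n1(2) by simp
    \<comment> \<open>The second copy lies above all positions of level \<open>m\<close>, and \<open>z\<close> keeps its position there.\<close>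
    ultimately have big: "size_at m \<le> q' (Suc m)" by (simp add: shift_def)
    have "z (Suc m) < q' (Suc m)" using big Xb[OF z, of m] m(3) by simp
    moreover have "y (Suc m) < q' (Suc m)" if "y \<in> F" for y
    proof -
      have "y m < q' m" using qtop[OF that, of m] q'(1)[of m] m(1) n1(2) by simp
      then show ?thesis using coherent_order[OF q'(3), of y q' "Suc m"] that by simp
    qed
    moreover have "coherent (insert q' F) n"
      unfolding coherent_def
    proof (intro allI impI)
      fix i assume i: "n \<le> i"
      show "\<exists>b. \<forall>x\<in>insert q' F. x (Suc i) = shift i b (x i)"
      proof (cases "i < m")
        case True
        then show ?thesis using q(3) i q'(1)[of i] q'(1)[of "Suc i"] by (auto simp: coherent_def)
      next
        case False
        then show ?thesis using q'(3) by (simp add: coherent_def)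
      qed
    qed
    moreover have "\<exists>j. n \<le> j \<and> j < Suc m \<and> cut_at j = Suc (y j) \<and> q' (Suc j) = q' j" if "y \<in> F" for y
      using t[OF that] n1(3)[OF that] m(1) q'(1)[of "t y"] q'(1)[of "Suc (t y)"]
      by (intro exI[of _ "t y"]) auto
    moreover have "coherent (insert z F) (Suc m)" using coherent_later[OF n1(1)] m(1) by simp
    ultimately show ?thesis using q'(1,2) q(1) m(1) n1(2)
      by (intro exI[of _ q'] exI[of _ "Suc m"]) auto
  qed
qed

text \<open>
  The finite stages exhaust the family.  Each stage fixes the new path up to some level, and its
  coherence with the members treated so far from the preceding level on.  The stays collected at the
  stages are infinitely many for every member.
\<close>
lemma good_family_extend:
  assumes X: "good_family X" "countable X"
  shows "\<exists>x. x \<notin> X \<and> good_family (insert x X)"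
proof -
  have zero: "(\<lambda>_. 0) \<in> X" using X by (simp add: good_family_def)
  define \<beta> where "\<beta> = from_nat_into X"
  have \<beta>: "range \<beta> = X" unfolding \<beta>_def by (rule range_from_nat_into) (use X zero in auto)
  define F where "F k = insert (\<lambda>_. 0) (\<beta> ` {..<k})" for k :: nat
  have F: "F k \<subseteq> X" "finite (F k)" "F k \<noteq> {}" for k using \<beta> zero by (auto simp: F_def)
  have FS: "F (Suc k) = insert (\<beta> k) (F k)" for k by (auto simp: F_def lessThan_Suc)
  \<comment> \<open>A stage is a path together with the level up to which it is final.\<close>
  define P where "P k p \<longleftrightarrow> (\<forall>m. fst p m < size_at m) \<and> coherent (F k) (snd p) \<and>
     (\<forall>y\<in>F k. y (snd p) < fst p (snd p))" for k and p :: "(nat \<Rightarrow> nat) \<times> nat"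
  define Q where "Q k p p' \<longleftrightarrow> snd p < snd p' \<and> (\<forall>i\<le>snd p. fst p' i = fst p i) \<and>
     coherent (insert (fst p') (F k)) (snd p) \<and>
     (\<forall>y\<in>F k. \<exists>m. snd p \<le> m \<and> m < snd p' \<and> cut_at m = Suc (y m) \<and> fst p' (Suc m) = fst p' m)"
    for k and p p' :: "(nat \<Rightarrow> nat) \<times> nat"
  have "\<exists>s. \<forall>k. P k (s k) \<and> Q k (s k) (s (Suc k))"
  proof (rule dependent_nat_choice)
    have "coherent {\<lambda>_. 0} 0" by (auto simp: coherent_def shift_def intro!: exI[of _ False])
    moreover have "1 < size_at m" for m using size_ge_3[of m] by simp
    ultimately show "\<exists>p. P 0 p" by (intro exI[of _ "(\<lambda>_. 1, 0)"]) (auto simp: P_def F_def)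
  next
    fix p k assume "P k p"
    then have "\<exists>x' n'. snd p < n' \<and> (\<forall>i\<le>snd p. x' i = fst p i) \<and> (\<forall>m. x' m < size_at m) \<and>
      coherent (insert x' (F k)) (snd p) \<and> coherent (insert (\<beta> k) (F k)) n' \<and>
      (\<forall>y\<in>insert (\<beta> k) (F k). y n' < x' n') \<and>
      (\<forall>y\<in>F k. \<exists>m. snd p \<le> m \<and> m < n' \<and> cut_at m = Suc (y m) \<and> x' (Suc m) = x' m)"
      using \<beta> by (intro stage_step[OF X(1) F]) (auto simp: P_def)
    then obtain x' n' where "snd p < n' \<and> (\<forall>i\<le>snd p. x' i = fst p i) \<and> (\<forall>m. x' m < size_at m) \<and>
      coherent (insert x' (F k)) (snd p) \<and> coherent (insert (\<beta> k) (F k)) n' \<and>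
      (\<forall>y\<in>insert (\<beta> k) (F k). y n' < x' n') \<and>
      (\<forall>y\<in>F k. \<exists>m. snd p \<le> m \<and> m < n' \<and> cut_at m = Suc (y m) \<and> x' (Suc m) = x' m)" by blast
    then show "\<exists>p'. P (Suc k) p' \<and> Q k p p'"
      by (intro exI[of _ "(x', n')"]) (auto simp: P_def Q_def FS)
  qed
  then obtain s where s: "\<And>k. P k (s k)" "\<And>k. Q k (s k) (s (Suc k))" by blast
  define n where "n k = snd (s k)" for k
  define xs where "xs k = fst (s k)" for k
  have nS: "n k < n (Suc k)" for k using s(2)[of k] by (simp add: Q_def n_def)
  then have nm: "strict_mono n" by (simp add: strict_mono_Suc_iff)
  then have n_ge: "k \<le> n k" for k by (simp add: strict_mono_imp_increasing)
  have xsS: "xs (Suc k) i = xs k i" if "i \<le> n k" for k i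
    using s(2)[of k] that by (simp add: Q_def n_def xs_def)
  have agree: "xs j i = xs k i" if "k \<le> j" "i \<le> n k" for j k i
    using that(1)
  proof (induction j rule: dec_induct)
    case (step j)
    have "i \<le> n j" using that(2) step(1) nm by (meson le_trans strict_mono_less_eq)
    then show ?case using step xsS by simp
  qed simp
  \<comment> \<open>The levels \<open>n k\<close> strictly increase, so \<open>xs i\<close> is final at \<open>i\<close>.\<close>
  define x where "x i = xs i i" for i
  have x: "x i = xs k i" if "i \<le> n k" for i k
    using agree[of k i i] agree[of i k i] that n_ge[of i] unfolding x_def by (metis nat_le_linear)
  have xb: "x m < size_at m" for m using s(1)[of m] by (simp add: P_def x_def xs_def)
  have block: "\<exists>j\<ge>k. n j \<le> m \<and> m < n (Suc j)" if "n k \<le> m" for k m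
  proof -
    have "m < n (Suc m)" using n_ge[of "Suc m"] by simp
    define j where "j = (LEAST j. m < n (Suc j))"
    have j: "m < n (Suc j)" unfolding j_def by (rule LeastI[of _ m]) fact
    have "n j \<le> m"
    proof (cases j)
      case 0
      then show ?thesis using that nm by (metis le0 le_trans strict_mono_less_eq)
    next
      case (Suc j')
      then have "\<not> m < n (Suc j')" using not_less_Least[of j' "\<lambda>j. m < n (Suc j)"] by (simp add: j_def)
      then show ?thesis using Suc by simp
    qed
    moreover have "k \<le> j" using that j nm by (metis le_less_trans less_Suc_eq_le strict_mono_less)
    ultimately show ?thesis using j by blast
  qed
  have Fmono: "F k \<subseteq> F j" if "k \<le> j" for k j using that by (auto simp: F_def)
  have coh: "coherent (insert x (F k)) (n k)" for k
    unfolding coherent_def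
  proof (intro allI impI)
    fix m assume "n k \<le> m"
    then obtain j where j: "k \<le> j" "n j \<le> m" "m < n (Suc j)" using block by blast
    have "coherent (insert (xs (Suc j)) (F j)) (n j)"
      using s(2)[of j] by (simp add: Q_def n_def xs_def)
    then obtain b where b: "\<forall>y\<in>insert (xs (Suc j)) (F j). y (Suc m) = shift m b (y m)"
      using j by (auto simp: coherent_def)
    have "x m = xs (Suc j) m" "x (Suc m) = xs (Suc j) (Suc m)" using x[of _ "Suc j"] j by auto
    then show "\<exists>b. \<forall>x\<in>insert x (F k). x (Suc m) = shift m b (x m)"
      using b Fmono[OF j(1)] by auto
  qed
  have above: "y (n k) < x (n k)" if "y \<in> F k" for y k
    using s(1)[of k] that x[of "n k" k] by (simp add: P_def n_def xs_def)
  have Fin: "\<exists>k. G \<subseteq> F k" if "G \<subseteq> X" "finite G" for G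
    using that(2,1)
  proof (induction G rule: finite_induct)
    case (insert y G)
    then obtain k where k: "G \<subseteq> F k" by blast
    obtain i where i: "y = \<beta> i" using \<beta> insert by auto
    then have "y \<in> F (Suc (max i k))" by (auto simp: F_def)
    moreover have "F k \<subseteq> F (Suc (max i k))" by (rule Fmono) simp
    ultimately show ?case using k by blast
  qed auto
  have pair: "\<exists>m. coherent {x, y} m \<and> y m < x m" if "y \<in> X" for y
  proof -
    obtain k where "y \<in> F k" using Fin[of "{y}"] \<open>y \<in> X\<close> by auto
    then show ?thesis using coh[of k] above coherent_subset by (meson bot_least insert_mono insert_subset)
  qed
  have x_new: "x \<notin> X" using pair by blast
  have Xst: "stays y x" if "y \<in> X" for y
    unfolding stays_def
  proof
    fix N
    obtain k0 where k0: "y \<in> F k0" using Fin[of "{y}"] \<open>y \<in> X\<close> by auto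
    define k where "k = max k0 N"
    have "y \<in> F k" using k0 Fmono[of k0 k] by (auto simp: k_def)
    then obtain m where m: "n k \<le> m" "m < n (Suc k)" "cut_at m = Suc (y m)" "xs (Suc k) (Suc m) = xs (Suc k) m"
      using s(2)[of k] by (auto simp: Q_def n_def xs_def)
    then have "x (Suc m) = x m" using x[of _ "Suc k"] by simp
    moreover have "N \<le> m" using m(1) n_ge[of k] by (simp add: k_def)
    ultimately show "\<exists>m\<ge>N. cut_at m = Suc (y m) \<and> x (Suc m) = x m" using m by blast
  qed
  have Xns: False if yX: "y \<in> X" and "coherent {x, y} m" "x m < y m" for y m
  proof -
    obtain k where k: "coherent {x, y} k" "y k < x k" using pair[OF yX] by blast
    have "x (max m k) < y (max m k)"
      by (rule coherent_order[OF that(2), of x y "max m k"]) (simp_all add: that(3))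
    moreover have "y (max m k) < x (max m k)"
      by (rule coherent_order[OF k(1), of y x "max m k"]) (simp_all add: k(2))
    ultimately show False by simp
  qed
  have "good_family (insert x X)"
    unfolding good_family_def
  proof (intro conjI ballI allI impI)
    fix G assume "G \<subseteq> insert x X" "finite G"
    then obtain k where "G - {x} \<subseteq> F k" using Fin[of "G - {x}"] by auto
    then show "\<exists>n. coherent G n" using coherent_subset[OF coh[of k], of G] by blast
  next
    fix u v assume uv: "u \<in> insert x X" "v \<in> insert x X" "u \<noteq> v"
    have "\<exists>n. coherent {u, v} n \<and> u n \<noteq> v n" if "u \<in> X" "v \<in> X"
      using X(1) that uv(3) by (simp add: good_family_def)
    then show "\<exists>n. coherent {u, v} n \<and> u n \<noteq> v n"
      using uv pair[of u] pair[of v] by (metis insertE insert_commute less_irrefl_nat)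
  next
    fix u v m assume uv: "u \<in> insert x X" "v \<in> insert x X" "coherent {u, v} m \<and> u m < v m"
    have "stays u v" if "u \<in> X" "v \<in> X"
      using good_familyD(4)[OF X(1) that] uv(3) by blast
    then show "stays u v"
      using uv Xst[of u] Xns[of v] by blast
  qed (use xb X(1) in \<open>auto simp: good_family_def\<close>)
  then show ?thesis using x_new by blast
qed

text \<open>
  Goodness only speaks about finitely many paths at a time, so a maximal good family exists; by the
  previous lemma it is not countable.
\<close>
lemma uncountable_good_family: "\<exists>X. good_family X \<and> uncountable X"
proof -
  have "\<exists>M\<in>Collect good_family. \<forall>X\<in>Collect good_family. M \<subseteq> X \<longrightarrow> X = M"
  proof (rule subset_Zorn_nonempty)
    have z: "coherent F 0" if "F \<subseteq> {\<lambda>_. 0}" for F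
      using that by (auto simp: coherent_def shift_def intro!: exI[of _ False])
    have "0 < size_at n" for n using size_ge_3[of n] by simp
    then have "good_family {\<lambda>_. 0}" using z by (auto simp: good_family_def)
    then show "Collect good_family \<noteq> {}" by blast
  next
    fix \<C> assume C: "\<C> \<noteq> {}" "subset.chain (Collect good_family) \<C>"
    have fin: "\<exists>X\<in>\<C>. G \<subseteq> X" if "finite G" "G \<subseteq> \<Union>\<C>" for G
      using finite_subset_Union_chain[OF that C] by blast
    have good: "good_family X" if "X \<in> \<C>" for X using C that by (auto simp: subset.chain_def)
    have goodD: "\<exists>n. coherent G n" if "X \<in> \<C>" "G \<subseteq> X" "finite G" for X G
      using good[OF that(1)] that(2,3) by (simp add: good_family_def)
    have goodD2: "u \<noteq> v \<Longrightarrow> \<exists>n. coherent {u, v} n \<and> u n \<noteq> v n"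
        "coherent {u, v} n \<Longrightarrow> u n < v n \<Longrightarrow> stays u v"
      if uv: "u \<in> \<Union>\<C>" "v \<in> \<Union>\<C>" for u v n
    proof -
      obtain X where "X \<in> \<C>" "u \<in> X" "v \<in> X" using fin[of "{u, v}"] uv by auto
      with good_familyD(3,4)[OF good[of X], of u v]
      show "u \<noteq> v \<Longrightarrow> \<exists>n. coherent {u, v} n \<and> u n \<noteq> v n"
        "coherent {u, v} n \<Longrightarrow> u n < v n \<Longrightarrow> stays u v"
        by auto
    qed
    have "good_family (\<Union>\<C>)"
      unfolding good_family_def
    proof (intro conjI ballI allI impI)
      show "(\<lambda>_. 0) \<in> \<Union>\<C>" using C(1) good by (auto simp: good_family_def)
    next
      fix x n assume "x \<in> \<Union>\<C>"
      then show "x n < size_at n" using good by (auto simp: good_family_def)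
    next
      fix G assume "G \<subseteq> \<Union>\<C>" "finite G"
      then show "\<exists>n. coherent G n" using fin[of G] goodD[of _ G] by blast
    next
      fix u v assume "u \<in> \<Union>\<C>" "v \<in> \<Union>\<C>" "u \<noteq> v"
      then show "\<exists>n. coherent {u, v} n \<and> u n \<noteq> v n" by (rule goodD2(1))
    next
      fix u v n assume "u \<in> \<Union>\<C>" "v \<in> \<Union>\<C>" "coherent {u, v} n \<and> u n < v n"
      then show "stays u v" using goodD2(2) by blast
    qed
    then show "\<Union>\<C> \<in> Collect good_family" by simp
  qed
  then obtain M where M: "good_family M" "\<And>X. good_family X \<Longrightarrow> M \<subseteq> X \<Longrightarrow> X = M" by auto
  then show ?thesis using good_family_extend[of M] by (metis insertI1 subset_insertI)
qed

section \<open>Plain sets of a YZR-system\<close>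

text \<open>
  The restriction of the system to \<open>W\<close> is as simple as the axioms permit.  Such sets are what the
  construction uses, because they admit all increasing maps as quasi-embeddings.
\<close>
definition plain_on :: "'a yzr \<Rightarrow> 'a set \<Rightarrow> bool" where
  "plain_on S W \<longleftrightarrow> (\<forall>v\<subseteq>W. finite v \<and> v \<noteq> {} \<longrightarrow> yk S v = 0 \<and>
     yr S v = (if card v = 1 then ord_succ ord_zero else ord_zero) \<and> (card v = 1 \<longrightarrow> yj S v = 0))"

lemma plain_on_subset: "plain_on S W \<Longrightarrow> V \<subseteq> W \<Longrightarrow> plain_on S V"
  unfolding plain_on_def by blast

lemma plain_onD:
  assumes "plain_on S W" "v \<subseteq> W" "finite v" "v \<noteq> {}"
  shows "yk S v = 0" "yr S v = (if card v = 1 then ord_succ ord_zero else ord_zero)"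
    and "card v = 1 \<Longrightarrow> yj S v = 0"
  using assms unfolding plain_on_def by blast+

lemma quasi_embeddingD:
  assumes "quasi_embedding q s \<phi>"
  shows "strict_mono_on (yX q) \<phi>"
    and "v \<subseteq> yX q \<Longrightarrow> finite v \<Longrightarrow> v \<noteq> {} \<Longrightarrow> yr s (\<phi> ` v) = yr q v \<and> yk s (\<phi> ` v) = yk q v \<and>
        (ord_zero < yr q v \<longrightarrow> yj s (\<phi> ` v) = yj q v)"
  using assms unfolding quasi_embedding_def by blast+

lemma plain_on_quasi_embedding:
  assumes "yX S = UNIV" "plain_on S W" "plain_on S (\<phi> ` W)" "strict_mono_on W \<phi>"
  shows "quasi_embedding_into S W \<phi>"
  unfolding quasi_embedding_into_def quasi_embedding_def
proof (intro conjI allI impI)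
  fix v assume "v \<subseteq> yX (S\<lparr>yX := W\<rparr>) \<and> finite v \<and> v \<noteq> {}"
  then have v: "v \<subseteq> W" "finite v" "v \<noteq> {}" by simp_all
  have c: "card (\<phi> ` v) = card v"
    using v(1) assms(4) by (meson card_image inj_on_subset strict_mono_on_imp_inj_on)
  have v': "\<phi> ` v \<subseteq> \<phi> ` W" "finite (\<phi> ` v)" "\<phi> ` v \<noteq> {}" using v by (simp_all add: image_mono)
  note d = plain_onD[OF assms(2) v] plain_onD[OF assms(3) v']
  show "yr S (\<phi> ` v) = yr (S\<lparr>yX := W\<rparr>) v" "yk S (\<phi> ` v) = yk (S\<lparr>yX := W\<rparr>) v"
    using d(1,2,4,5) c by simp_all
  assume "ord_zero < yr (S\<lparr>yX := W\<rparr>) v"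
  then have "card v = 1" using d(2) by (simp split: if_splits)
  then show "yj S (\<phi> ` v) = yj (S\<lparr>yX := W\<rparr>) v" using d(3,6) c by simp
qed (use assms in simp_all)

lemma plain_on_image_of:
  assumes "quasi_embedding q S \<phi>" "plain_on q W" "W \<subseteq> yX q"
  shows "plain_on S (\<phi> ` W)"
  unfolding plain_on_def
proof (intro allI impI)
  fix v assume v: "v \<subseteq> \<phi> ` W" "finite v \<and> v \<noteq> {}"
  then obtain v' where v': "v' \<subseteq> W" "v = \<phi> ` v'" "finite v'"
    using finite_subset_image by metis
  have ne: "v' \<noteq> {}" using v v'(2) by blast
  have "inj_on \<phi> (yX q)" using quasi_embeddingD(1)[OF assms(1)] strict_mono_on_imp_inj_on by blast
  then have c: "card v = card v'" using v' assms(3) by (metis card_image inj_on_subset subset_trans)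
  have q: "yr S v = yr q v'" "yk S v = yk q v'" "ord_zero < yr q v' \<longrightarrow> yj S v = yj q v'"
    using quasi_embeddingD(2)[OF assms(1), of v'] v' ne assms(3) by auto
  show "yk S v = 0 \<and> yr S v = (if card v = 1 then ord_succ ord_zero else ord_zero) \<and>
      (card v = 1 \<longrightarrow> yj S v = 0)"
    using plain_onD[OF assms(2) v'(1,3) ne] q c less_ord_succ[of ord_zero] by simp
qed

lemma plain_on_image:
  assumes "quasi_embedding_into S W \<phi>" "plain_on S W"
  shows "plain_on S (\<phi> ` W)"
proof (rule plain_on_image_of)
  show "quasi_embedding (S\<lparr>yX := W\<rparr>) S \<phi>" using assms(1) by (simp add: quasi_embedding_into_def)
  show "plain_on (S\<lparr>yX := W\<rparr>) W" using assms(2) by (simp add: plain_on_def)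
qed simp

text \<open>
  A system all of whose finite sets are plain.  On sets with at least two elements \<open>j\<close> encodes the
  minimum, which is the element that \<open>k = 0\<close> singles out; so no other element can replace it.
  Quasi-embeddings need not respect \<open>j\<close> on these sets, as their rank is \<open>0\<close>.
\<close>
definition plain_system :: "'a::wellorder set \<Rightarrow> ('a \<Rightarrow> nat) \<Rightarrow> 'a yzr" where
  "plain_system X g = \<lparr>yX = X,
     yr = (\<lambda>w. if card w = 1 then ord_succ ord_zero else ord_zero),
     yj = (\<lambda>w. if card w = 1 then 0 else g (Min w)), yk = (\<lambda>_. 0)\<rparr>"

lemma ord_zero_le: "ord_zero \<le> \<alpha>"
  unfolding less_eq_ordinal.rep_eq
proof -
  have "(rep_ordinal ord_zero, {} :: nat set rel) \<in> ordIso"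
    unfolding ord_zero_def using ordIso_reflexive[OF Well_order_empty]
    by (rule Quotient_rep_abs[OF Quotient_ordinal])
  moreover have "({} :: nat set rel, rep_ordinal \<alpha>) \<in> ordLeq"
    using Well_order_empty Well_order_rep_ordinal[of \<alpha>]
    by (auto simp: ordLeq_def embed_def)
  ultimately show "(rep_ordinal ord_zero, rep_ordinal \<alpha>) \<in> ordLeq"
    using ordIso_ordLeq_trans by blast
qed

lemma plain_system:
  assumes "ord_zero < \<epsilon>" "finite X" "X \<noteq> {}" "inj_on g X"
  shows "yzr_system \<epsilon> (plain_system X g)"
proof -
  have c1: "card w \<noteq> 0" if "w \<subseteq> X" "w \<noteq> {}" for w
    using that finite_subset[OF that(1) assms(2)] by simp
  have "False" if w: "w \<subseteq> X" "w \<noteq> {}" and b: "b \<in> X" "b \<notin> w" "card {a \<in> w. a < b} = 0"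
    and j: "yj (plain_system X g) (insert b (w - {sorted_list_of_set w ! 0})) = yj (plain_system X g) w"
    and r: "yr (plain_system X g) (insert b w) = yr (plain_system X g) w" for w b
  proof -
    have fw: "finite w" using w assms(2) finite_subset by auto
    have "{a \<in> w. a < b} = {}" using b fw by simp
    then have bl: "\<And>a. a \<in> w \<Longrightarrow> b < a" using b(2) by (metis (mono_tags, lifting) empty_iff linorder_neqE mem_Collect_eq)
    have "card w \<noteq> 1" using r b(2) fw w(2) less_ord_succ[of ord_zero] by (auto simp: plain_system_def)
    moreover have hd: "sorted_list_of_set w ! 0 = Min w"
      using fw w by (simp add: sorted_list_of_set_nonempty)
    moreover have Mw: "Min w \<in> w" using fw w by simp
    ultimately have "card (insert b (w - {Min w})) = card w" "card w \<noteq> 1"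
      using fw b(2) c1[OF w] card_Suc_Diff1[OF fw Mw] by (simp_all add: card_insert_if)
    moreover have "Min (insert b (w - {Min w})) = b"
      using fw bl by (intro Min_eqI) (auto simp: less_imp_le)
    ultimately have "g b = g (Min w)" using j hd by (simp add: plain_system_def)
    then show False using assms(4) b Mw w by (auto simp: inj_on_def)
  qed
  note key = this
  have one: "card u = 1" if "u \<noteq> {}" "u \<subseteq> w" "w \<subseteq> X" "card w = 1" for u w
    using that by (metis card_1_singletonE subset_singletonD)
  show ?thesis
    unfolding yzr_system_def
  proof (intro conjI allI impI ballI)
    show "yX (plain_system X g) \<noteq> {}" using assms(3) by (simp add: plain_system_def)
    show "yr (plain_system X g) w \<le> \<epsilon>" for w
      using assms(1) ord_succ_le[of ord_zero \<epsilon>] ord_zero_le by (simp add: plain_system_def)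
    show "ord_zero < yr (plain_system X g) {a}" for a
      by (simp add: plain_system_def less_ord_succ)
  next
    fix u w assume "u \<noteq> {} \<and> u \<subseteq> w \<and> w \<subseteq> yX (plain_system X g) \<and> finite w"
    then show "yr (plain_system X g) w \<le> yr (plain_system X g) u"
      using one[of u w] ord_zero_le by (simp add: plain_system_def)
  next
    fix w assume "w \<subseteq> yX (plain_system X g) \<and> finite w \<and> w \<noteq> {}"
    then have w: "w \<subseteq> X" "w \<noteq> {}" "finite w" by (simp_all add: plain_system_def)
    show "yk (plain_system X g) w < card w" using c1[OF w(1,2)] by (simp add: plain_system_def)
    show "\<not> (\<exists>b\<in>yX (plain_system X g) - w. card {a \<in> w. a < b} = yk (plain_system X g) w \<and>
        yj (plain_system X g) (insert b (w - {sorted_list_of_set w ! yk (plain_system X g) w})) =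
          yj (plain_system X g) w \<and>
        yr (plain_system X g) (insert b w) = yr (plain_system X g) w)"
    proof
      assume "\<exists>b\<in>yX (plain_system X g) - w. card {a \<in> w. a < b} = yk (plain_system X g) w \<and>
        yj (plain_system X g) (insert b (w - {sorted_list_of_set w ! yk (plain_system X g) w})) =
          yj (plain_system X g) w \<and>
        yr (plain_system X g) (insert b w) = yr (plain_system X g) w"
      then obtain b where b: "b \<in> yX (plain_system X g) - w"
        "card {a \<in> w. a < b} = yk (plain_system X g) w"
        "yj (plain_system X g) (insert b (w - {sorted_list_of_set w ! yk (plain_system X g) w})) =
          yj (plain_system X g) w"
        "yr (plain_system X g) (insert b w) = yr (plain_system X g) w" by blast
      have q: "yX (plain_system X g) = X" "yk (plain_system X g) w = 0"
        by (simp_all add: plain_system_def)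
      show False using key[OF w(1,2) _ _ _ _ b(4)] b(1-3) unfolding q by simp
    qed
  qed
qed

text \<open>
  Cuteness embeds a plain system on \<open>N\<close> ordinals.
\<close>
lemma plain_on_exists:
  assumes \<epsilon>: "ord_zero < \<epsilon>" and S: "cute \<epsilon> S"
  shows "\<exists>f. strict_mono_on {..<N::nat} f \<and> plain_on S (f ` {..<N})"
proof (cases "N = 0")
  case True
  then show ?thesis by (auto simp: plain_on_def)
next
  case False
  obtain X :: "ordinal set" where X: "finite X" "card X = N"
    using infinite_arbitrarily_large[OF infinite_ordinals] by blast
  then have X0: "X \<noteq> {}" using False by auto
  obtain g :: "ordinal \<Rightarrow> nat" where g: "inj_on g X"
    using X(1) finite_imp_inj_to_nat_seg by blast
  have "yzr_system \<epsilon> (plain_system X g)" by (rule plain_system) fact+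
  moreover have "finite (yX (plain_system X g))" using X by (simp add: plain_system_def)
  ultimately obtain \<phi> where \<phi>: "quasi_embedding (plain_system X g) S \<phi>"
    using S unfolding cute_def by blast
  define e where "e i = sorted_list_of_set X ! i" for i
  have e: "strict_mono_on {..<N} e"
    using X sorted_wrt_nth_less[OF strict_sorted_list_of_set[of X]]
    by (auto simp: strict_mono_on_def e_def)
  have eX: "e ` {..<N} = X"
    using X set_sorted_list_of_set[OF X(1)] by (auto simp: e_def set_conv_nth image_def)
  have \<phi>m: "strict_mono_on X \<phi>" using \<phi> by (simp add: quasi_embedding_def plain_system_def)
  have "strict_mono_on {..<N} (\<phi> \<circ> e)"
    using e \<phi>m eX by (auto simp: strict_mono_on_def)
  moreover have "(\<phi> \<circ> e) ` {..<N} = \<phi> ` X" by (simp only: image_comp[symmetric] eX)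
  moreover have "plain_on S (\<phi> ` X)"
    by (rule plain_on_image_of[OF \<phi>]) (auto simp: plain_on_def plain_system_def)
  ultimately show ?thesis by metis
qed

section \<open>The order of bricks\<close>

lemma brick_le_refl: "brick_le \<iota> b b"
  by (auto simp: brick_le_def)

lemma brick_leD:
  assumes "brick_le \<iota> b0 b1" "x \<in> b_w b0"
  shows "x \<in> b_w b1" "prefix (b_eta b0 x) (b_eta b1 x)"
    and "y \<in> b_w b0 \<Longrightarrow> x \<noteq> y \<Longrightarrow> i < \<iota> \<Longrightarrow>
      b_h b1 i x y = b_h b0 i x y \<and> prefix (b_g b0 i x y) (b_g b1 i x y)"
proof -
  show "x \<in> b_w b1" "prefix (b_eta b0 x) (b_eta b1 x)"
    using assms by (auto simp: brick_le_def)
  assume "y \<in> b_w b0" "x \<noteq> y" and i: "i < \<iota>"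
  then have "(x, y) \<in> pairs2 (b_w b0)" using assms(2) by (simp add: pairs2_def)
  then show "b_h b1 i x y = b_h b0 i x y \<and> prefix (b_g b0 i x y) (b_g b1 i x y)"
    using assms(1) i unfolding brick_le_def by blast
qed

lemma brick_le_trans:
  assumes "brick_le \<iota> b0 b1" "brick_le \<iota> b1 b2"
  shows "brick_le \<iota> b0 b2"
  unfolding brick_le_def
proof (intro conjI ballI)
  show "b_w b0 \<subseteq> b_w b2" using brick_leD(1) assms by blast
  show "b_n b0 \<le> b_n b2" using assms by (simp add: brick_le_def)
  show "prefix (b_eta b0 a) (b_eta b2 a)" if "a \<in> b_w b0" for a
    using brick_leD(1,2)[OF assms(1) that] brick_leD(2)[OF assms(2)] prefix_order.trans by blast
next
  fix p assume "p \<in> pairs2 (b_w b0)"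
  then obtain x y where p: "p = (x, y)" "x \<in> b_w b0" "y \<in> b_w b0" "x \<noteq> y" by (auto simp: pairs2_def)
  show "case p of (x, y) \<Rightarrow> \<forall>i<\<iota>. b_h b2 i x y = b_h b0 i x y \<and> prefix (b_g b0 i x y) (b_g b2 i x y)"
    using brick_leD(3)[OF assms(1) p(2-4)] p(4)
      brick_leD(3)[OF assms(2) brick_leD(1)[OF assms(1) p(2)] brick_leD(1)[OF assms(1) p(3)]]
    unfolding p(1) by (auto intro: prefix_order.trans)
qed

lemma brick_le_imageD:
  assumes "inj_on \<phi> w" "x \<in> w"
    "brick_le \<iota> (brick_image \<phi> (brick_restrict \<iota> T c b0 w)) (brick_restrict \<iota> T c b1 (\<phi> ` w))"
  shows "prefix (b_eta b0 x) (b_eta b1 (\<phi> x))"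
    and "y \<in> w \<Longrightarrow> x \<noteq> y \<Longrightarrow> i < \<iota> \<Longrightarrow>
      b_h b1 i (\<phi> x) (\<phi> y) = b_h b0 i x y \<and> prefix (b_g b0 i x y) (b_g b1 i (\<phi> x) (\<phi> y))"
proof -
  let ?im = "brick_image \<phi> (brick_restrict \<iota> T c b0 w)"
  have inv: "inv_into w \<phi> (\<phi> a) = a" if "a \<in> w" for a
    using assms(1) that by (rule inv_into_f_f)
  have im: "b_w ?im = \<phi> ` w" "\<And>a. a \<in> w \<Longrightarrow> b_eta ?im (\<phi> a) = b_eta b0 a"
    "\<And>i a a'. a \<in> w \<Longrightarrow> a' \<in> w \<Longrightarrow> b_h ?im i (\<phi> a) (\<phi> a') = b_h b0 i a a'"
    "\<And>i a a'. a \<in> w \<Longrightarrow> a' \<in> w \<Longrightarrow> b_g ?im i (\<phi> a) (\<phi> a') = b_g b0 i a a'"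
    by (simp_all add: brick_image_def brick_restrict_def Let_def inv)
  have re: "b_eta (brick_restrict \<iota> T c b1 (\<phi> ` w)) = b_eta b1"
    "b_h (brick_restrict \<iota> T c b1 (\<phi> ` w)) = b_h b1"
    "b_g (brick_restrict \<iota> T c b1 (\<phi> ` w)) = b_g b1"
    by (simp_all add: brick_restrict_def)
  have x: "\<phi> x \<in> b_w ?im" using assms(2) im(1) by simp
  show "prefix (b_eta b0 x) (b_eta b1 (\<phi> x))"
    using brick_leD(2)[OF assms(3) x] assms(2) by (simp add: im re)
  assume y: "y \<in> w" "x \<noteq> y" "i < \<iota>"
  then have "\<phi> y \<in> b_w ?im" "\<phi> x \<noteq> \<phi> y" using assms(1,2) im(1) by (auto simp: inj_on_eq_iff)
  then show "b_h b1 i (\<phi> x) (\<phi> y) = b_h b0 i x y \<and> prefix (b_g b0 i x y) (b_g b1 i (\<phi> x) (\<phi> y))"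
    using brick_leD(3)[OF assms(3) x, of "\<phi> y" i] y assms(2) by (simp add: im re)
qed

lemma sum_two: "a \<noteq> b \<Longrightarrow> sum f {a, b} = f a + (f b :: 'b::comm_monoid_add)"
  by simp

text \<open>
  Over the two-element field, equal vectors at two indices sum to zero.
\<close>
lemma lin_indep_inj:
  assumes "lin_indep_seqs n w \<eta>" "finite w" "a \<in> w" "b \<in> w" "a \<noteq> b"
  shows "\<eta> a \<noteq> \<eta> b"
proof
  assume eq: "\<eta> a = \<eta> b"
  define z :: "nat \<Rightarrow> bit" where "z x = (if x = a \<or> x = b then 1 else 0)" for x
  have "(\<Sum>x\<in>w. z x * \<eta> x ! k) = 0" for k
  proof -
    have "(\<Sum>x\<in>w. z x * \<eta> x ! k) = (\<Sum>x\<in>{a, b}. z x * \<eta> x ! k)"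
      using assms by (intro sum.mono_neutral_right) (auto simp: z_def)
    also have "\<dots> = z a * \<eta> a ! k + z b * \<eta> b ! k"
      by (rule sum_two) fact
    also have "\<dots> = \<eta> a ! k + \<eta> a ! k" unfolding eq by (simp only: z_def) simp
    finally show ?thesis by simp
  qed
  then have "z a = 0" using assms(1,3) unfolding lin_indep_seqs_def by blast
  then show False by (simp add: z_def)
qed

lemma is_brick_tuple:
  assumes "is_brick S \<iota> T c b"
  shows "\<exists>m\<in>Mfam \<iota> T. m_len m = b_n b \<and> m_set m = b_eta b ` b_w b \<and>
    (\<forall>(x, y)\<in>pairs2 (b_w b). \<forall>i<\<iota>. m_h m i (b_eta b x) (b_eta b y) = b_h b i x y \<and>
       m_g m i (b_eta b x) (b_eta b y) = b_g b i x y)"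
  using assms unfolding is_brick_def
  by (rule conjunct2[THEN conjunct2, THEN conjunct2, THEN conjunct1])

lemma brick_pair:
  assumes b: "is_brick S \<iota> T c b" and xy: "x \<in> b_w b" "y \<in> b_w b" "x \<noteq> y"
  shows "length (b_eta b x) = b_n b" and "b_eta b x \<noteq> b_eta b y"
    and "i < \<iota> \<Longrightarrow> length (b_g b i x y) = b_n b"
    and "i < \<iota> \<Longrightarrow> b_g b i x y \<in> T (b_h b i x y)"
    and "i < \<iota> \<Longrightarrow> list_add (b_eta b x) (b_g b i x y) = list_add (b_eta b y) (b_g b i y x)"
    and "distinct (map (\<lambda>i. b_g b i x y) [0..<\<iota>] @ map (\<lambda>i. b_g b i y x) [0..<\<iota>])"
proof -
  have fin: "finite (b_w b)" and lin: "lin_indep_seqs (b_n b) (b_w b) (b_eta b)"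
    and len: "\<And>a. a \<in> b_w b \<Longrightarrow> length (b_eta b a) = b_n b"
    using b by (auto simp: is_brick_def)
  show "length (b_eta b x) = b_n b" using len xy by simp
  show ne: "b_eta b x \<noteq> b_eta b y" using lin_indep_inj[OF lin fin xy] .
  obtain m where m: "m \<in> Mfam \<iota> T" "m_len m = b_n b" "m_set m = b_eta b ` b_w b"
    "\<forall>(x, y)\<in>pairs2 (b_w b). \<forall>i<\<iota>. m_h m i (b_eta b x) (b_eta b y) = b_h b i x y \<and>
       m_g m i (b_eta b x) (b_eta b y) = b_g b i x y"
    using is_brick_tuple[OF b] by blast
  have hg: "m_h m i (b_eta b x) (b_eta b y) = b_h b i x y" "m_g m i (b_eta b x) (b_eta b y) = b_g b i x y"
    "m_g m i (b_eta b y) (b_eta b x) = b_g b i y x" if "i < \<iota>" for i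
    using m(4) xy that by (auto simp: pairs2_def)
  have p: "(b_eta b x, b_eta b y) \<in> pairs2 (m_set m)" using ne xy m(3) by (auto simp: pairs2_def)
  have "m_g m i (b_eta b x) (b_eta b y) \<in> T (m_h m i (b_eta b x) (b_eta b y)) \<and>
      length (m_g m i (b_eta b x) (b_eta b y)) = m_len m \<and>
      list_add (b_eta b x) (m_g m i (b_eta b x) (b_eta b y)) =
      list_add (b_eta b y) (m_g m i (b_eta b y) (b_eta b x))" if "i < \<iota>" for i
    using m(1) p that unfolding Mfam_def by blast
  then show "i < \<iota> \<Longrightarrow> length (b_g b i x y) = b_n b"
    "i < \<iota> \<Longrightarrow> b_g b i x y \<in> T (b_h b i x y)"
    "i < \<iota> \<Longrightarrow> list_add (b_eta b x) (b_g b i x y) = list_add (b_eta b y) (b_g b i y x)"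
    using hg m(2) by auto
  have "distinct (map (\<lambda>i. m_g m i (b_eta b x) (b_eta b y)) [0..<\<iota>] @
      map (\<lambda>i. m_g m i (b_eta b y) (b_eta b x)) [0..<\<iota>])"
    using m(1) p unfolding Mfam_def by blast
  also have "map (\<lambda>i. m_g m i (b_eta b x) (b_eta b y)) [0..<\<iota>] = map (\<lambda>i. b_g b i x y) [0..<\<iota>]"
    using hg by simp
  also have "map (\<lambda>i. m_g m i (b_eta b y) (b_eta b x)) [0..<\<iota>] = map (\<lambda>i. b_g b i y x) [0..<\<iota>]"
    using hg by simp
  finally show "distinct (map (\<lambda>i. b_g b i x y) [0..<\<iota>] @ map (\<lambda>i. b_g b i y x) [0..<\<iota>])" .
qed

section \<open>Finite configurations along the gluing scheme\<close>

text \<open>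
  What the construction takes from a cute system with controlled amalgamation: plain sets of every
  size, and a sequence of bricks in which two copies of a configuration can be glued.
\<close>
locale brick_tower =
  fixes S :: "nat yzr" and \<iota> :: nat and T :: "nat \<Rightarrow> bit list set" and c :: "nat \<Rightarrow> nat"
    and b :: "nat \<Rightarrow> brick"
  assumes tree: "is_tree (T m)"
    and carrier: "yX S = UNIV"
    and plain_sets: "\<exists>f. strict_mono_on {..<N::nat} f \<and> plain_on S (f ` {..<N})"
    and brick: "is_brick S \<iota> T c (b n)"
    and tower: "brick_le \<iota> (b n) (b (Suc n))"
    and exhaust: "(\<Union>n. b_w (b n)) = UNIV"
    and lengths: "filterlim (\<lambda>n. b_n (b n)) at_top sequentially"
    and amalgamation: "\<lbrakk>u \<subseteq> w; w \<subseteq> b_w (b n); 3 \<le> card w;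
       \<And>v \<delta>. v \<subseteq> u \<Longrightarrow> \<delta> \<in> w - u \<Longrightarrow> yr S (insert \<delta> v) = ord_zero \<Longrightarrow>
          yk S (insert \<delta> v) \<noteq> card {x\<in>v. x < \<delta>};
       quasi_embedding_into S w \<pi>0; quasi_embedding_into S w \<pi>1;
       \<And>a. a \<in> u \<Longrightarrow> \<pi>0 a = \<pi>1 a; \<pi>0 ` (w - u) \<inter> \<pi>1 ` (w - u) = {}\<rbrakk> \<Longrightarrow>
       \<exists>K \<pi>. quasi_embedding_into S (\<pi>0 ` w \<union> \<pi>1 ` w) \<pi> \<and>
              \<pi> ` (\<pi>0 ` w \<union> \<pi>1 ` w) \<subseteq> b_w (b K) \<and>
              brick_le \<iota> (brick_image (\<pi> \<circ> \<pi>0) (brick_restrict \<iota> T c (b n) w))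
                (brick_restrict \<iota> T c (b K) ((\<pi> \<circ> \<pi>0) ` w)) \<and>
              brick_le \<iota> (brick_image (\<pi> \<circ> \<pi>1) (brick_restrict \<iota> T c (b n) w))
                (brick_restrict \<iota> T c (b K) ((\<pi> \<circ> \<pi>1) ` w))"
begin

lemma tower_le: "m \<le> n \<Longrightarrow> brick_le \<iota> (b m) (b n)"
proof (induction n rule: dec_induct)
  case base
  show ?case by (rule brick_le_refl)
next
  case (step n)
  then show ?case using brick_le_trans[OF step.IH tower] by simp
qed

text \<open>
  A configuration at level \<open>n\<close> of the scheme: a brick number and an increasing map of the positions
  onto a plain set inside this brick.
\<close>
definition placed :: "nat \<Rightarrow> nat \<times> (nat \<Rightarrow> nat) \<Rightarrow> bool" where
  "placed n p \<longleftrightarrow> strict_mono_on {..<size_at n} (snd p) \<and> snd p ` {..<size_at n} \<subseteq> b_w (b (fst p)) \<and>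
     plain_on S (snd p ` {..<size_at n}) \<and> n \<le> b_n (b (fst p))"

text \<open>
  The map \<open>f\<close> carries the configuration \<open>p\<close> into \<open>q\<close>: the sequences grow and the tree indices are
  kept.
\<close>
definition refines :: "nat \<Rightarrow> (nat \<Rightarrow> nat) \<Rightarrow> nat \<times> (nat \<Rightarrow> nat) \<Rightarrow> nat \<times> (nat \<Rightarrow> nat) \<Rightarrow> bool" where
  "refines n f p q \<longleftrightarrow> (\<forall>x<size_at n.
     prefix (b_eta (b (fst p)) (snd p x)) (b_eta (b (fst q)) (snd q (f x))) \<and>
     (\<forall>y<size_at n. x \<noteq> y \<longrightarrow> (\<forall>i<\<iota>.
        b_h (b (fst q)) i (snd q (f x)) (snd q (f y)) = b_h (b (fst p)) i (snd p x) (snd p y) \<and>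
        prefix (b_g (b (fst p)) i (snd p x) (snd p y)) (b_g (b (fst q)) i (snd q (f x)) (snd q (f y))))))"

lemma placed_start: "\<exists>p. placed 0 p"
proof -
  obtain f where f: "strict_mono_on {..<size_at 0} f" "plain_on S (f ` {..<size_at 0})"
    using plain_sets by blast
  have "\<exists>K. W \<subseteq> b_w (b K)" if "finite W" for W
    using that
  proof (induction W rule: finite_induct)
    case (insert x W)
    then obtain K where K: "W \<subseteq> b_w (b K)" by blast
    obtain K' where K': "x \<in> b_w (b K')" using exhaust by blast
    have "insert x W \<subseteq> b_w (b (max K K'))"
      using K K' brick_leD(1)[OF tower_le[of K "max K K'"]] brick_leD(1)[OF tower_le[of K' "max K K'"]]
      by auto
    then show ?case by blast
  qed simp
  then obtain K where "f ` {..<size_at 0} \<subseteq> b_w (b K)" by blast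
  then show ?thesis using f by (intro exI[of _ "(K, f)"]) (simp add: placed_def)
qed

text \<open>
  The two copies of level \<open>n\<close> are laid out inside a plain set with as many elements as level
  \<open>n + 1\<close> has positions; there they overlap in the image of an initial segment.  The side condition
  on free amalgamation holds since \<open>k\<close> vanishes: a set of rank \<open>0\<close> has at least two elements, so
  \<open>v\<close> has an element; it lies below \<open>\<delta>\<close>, which therefore is not element number \<open>0\<close>.
\<close>
lemma placed_step:
  assumes p: "placed n p"
  shows "\<exists>q. placed (Suc n) q \<and> (\<forall>d. refines n (shift n d) p q)"
proof -
  define \<phi> where "\<phi> = snd p"
  define K0 where "K0 = fst p"
  have \<phi>: "strict_mono_on {..<size_at n} \<phi>" "\<phi> ` {..<size_at n} \<subseteq> b_w (b K0)"
    "plain_on S (\<phi> ` {..<size_at n})"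
    using p by (simp_all add: placed_def \<phi>_def K0_def)
  obtain \<psi> where \<psi>: "strict_mono_on {..<size_at (Suc n)} \<psi>" "plain_on S (\<psi> ` {..<size_at (Suc n)})"
    using plain_sets by blast
  have \<phi>i: "inj_on \<phi> {..<size_at n}" and \<psi>i: "inj_on \<psi> {..<size_at (Suc n)}"
    using \<phi> \<psi> strict_mono_on_imp_inj_on by auto
  define w where "w = \<phi> ` {..<size_at n}"
  define u where "u = \<phi> ` {..<cut_at n}"
  define \<pi> where "\<pi> d a = \<psi> (shift n d (inv_into {..<size_at n} \<phi> a))" for d a
  have \<pi>\<phi>: "\<pi> d (\<phi> x) = \<psi> (shift n d x)" if "x < size_at n" for d x
    using that \<phi>i by (simp add: \<pi>_def inv_into_f_f)
  have \<pi>w: "\<pi> d ` w \<subseteq> \<psi> ` {..<size_at (Suc n)}" for d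
    using shift_less_size by (auto simp: w_def \<pi>\<phi>)
  have \<pi>m: "strict_mono_on w (\<pi> d)" for d
    unfolding strict_mono_on_def
  proof (intro allI impI; elim conjE)
    fix a a' assume aa: "a \<in> w" "a' \<in> w" "a < a'"
    then obtain x y where xy: "a = \<phi> x" "a' = \<phi> y" "x < size_at n" "y < size_at n" by (auto simp: w_def)
    then have "x < y" using \<phi>(1) aa(3) by (metis lessThan_iff strict_mono_on_less)
    then have "shift n d x < shift n d y" by (rule shift_mono)
    then show "\<pi> d a < \<pi> d a'"
      using xy \<psi>(1) shift_less_size[of _ n d] by (simp add: \<pi>\<phi> strict_mono_on_def)
  qed
  have spec: "plain_on S w" "plain_on S (\<pi> d ` w)" for d
    using \<phi>(3) plain_on_subset[OF \<psi>(2) \<pi>w] by (auto simp: w_def)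
  have qe: "quasi_embedding_into S w (\<pi> d)" for d
    using carrier spec \<pi>m by (intro plain_on_quasi_embedding)
  have cutsz: "cut_at n \<le> size_at n" by (rule cut_le_size)
  have uw: "u \<subseteq> w" using cutsz by (auto simp: u_def w_def)
  have agree: "\<pi> False a = \<pi> True a" if "a \<in> u" for a
    using that cutsz by (auto simp: u_def \<pi>\<phi> shift_def)
  have disj: "\<pi> False ` (w - u) \<inter> \<pi> True ` (w - u) = {}"
  proof (rule ccontr)
    assume "\<not> ?thesis"
    then obtain a a' where a: "a \<in> w - u" "a' \<in> w - u" "\<pi> False a = \<pi> True a'" by blast
    then obtain x y where xy: "a = \<phi> x" "a' = \<phi> y" "x < size_at n" "y < size_at n" by (auto simp: w_def)
    then have "cut_at n \<le> y" using a(2) by (force simp: u_def)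
    then have "x \<noteq> shift n True y" using xy by (simp add: shift_def)
    moreover have "\<psi> x = \<psi> (shift n True y)" using a(3) xy by (simp add: \<pi>\<phi>) (simp add: shift_def)
    moreover have "x < size_at (Suc n)" using xy by (simp add: size_Suc)
    ultimately show False using \<psi>i shift_less_size[OF xy(4), of True] by (simp add: inj_on_eq_iff)
  qed
  have free: "yk S (insert \<delta> v) \<noteq> card {x\<in>v. x < \<delta>}"
    if v: "v \<subseteq> u" "\<delta> \<in> w - u" "yr S (insert \<delta> v) = ord_zero" for v \<delta>
  proof -
    have fin: "finite v" using v(1) finite_subset by (auto simp: u_def)
    have sub: "insert \<delta> v \<subseteq> w" using v uw by auto
    have "v \<noteq> {}"
    proof
      assume "v = {}"
      then have "yr S (insert \<delta> v) = ord_succ ord_zero"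
        using plain_onD(2)[OF spec(1), of "{\<delta>}"] sub by simp
      then show False using v(3) less_ord_succ[of ord_zero] by simp
    qed
    then obtain a where a: "a \<in> v" by blast
    obtain x where x: "a = \<phi> x" "x < cut_at n" using a v(1) by (auto simp: u_def)
    obtain y where y: "\<delta> = \<phi> y" "y < size_at n" "cut_at n \<le> y" using v(2) by (force simp: w_def u_def)
    have "a < \<delta>" using x y \<phi>(1) by (simp add: strict_mono_on_def)
    then have "{x\<in>v. x < \<delta>} \<noteq> {}" using a by blast
    then have "card {x\<in>v. x < \<delta>} \<noteq> 0" using fin by simp
    moreover have "yk S (insert \<delta> v) = 0"
      using plain_onD(1)[OF spec(1) sub] fin by simp
    ultimately show ?thesis by simp
  qed
  have w3: "3 \<le> card w" using size_ge_3[of n] \<phi>i by (simp add: w_def card_image)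
  have wb: "w \<subseteq> b_w (b K0)" using \<phi>(2) by (simp add: w_def)
  obtain K \<rho> where \<rho>: "quasi_embedding_into S (\<pi> False ` w \<union> \<pi> True ` w) \<rho>"
    "\<rho> ` (\<pi> False ` w \<union> \<pi> True ` w) \<subseteq> b_w (b K)"
    "brick_le \<iota> (brick_image (\<rho> \<circ> \<pi> False) (brick_restrict \<iota> T c (b K0) w))
                (brick_restrict \<iota> T c (b K) ((\<rho> \<circ> \<pi> False) ` w))"
    "brick_le \<iota> (brick_image (\<rho> \<circ> \<pi> True) (brick_restrict \<iota> T c (b K0) w))
                (brick_restrict \<iota> T c (b K) ((\<rho> \<circ> \<pi> True) ` w))"
    using amalgamation[OF uw wb w3 free qe qe agree disj] by blast
  have le: "brick_le \<iota> (brick_image (\<rho> \<circ> \<pi> d) (brick_restrict \<iota> T c (b K0) w))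
                (brick_restrict \<iota> T c (b K) ((\<rho> \<circ> \<pi> d) ` w))" for d
    using \<rho>(3,4) by (cases d) auto
  have union: "\<pi> False ` w \<union> \<pi> True ` w = \<psi> ` {..<size_at (Suc n)}"
  proof
    show "\<psi> ` {..<size_at (Suc n)} \<subseteq> \<pi> False ` w \<union> \<pi> True ` w"
    proof (rule image_subsetI)
      fix x assume "x \<in> {..<size_at (Suc n)}"
      then have x: "x < size_at n + (size_at n - cut_at n)" by (simp add: size_Suc)
      show "\<psi> x \<in> \<pi> False ` w \<union> \<pi> True ` w"
      proof (cases "x < size_at n")
        case True
        then have "\<psi> x = \<pi> False (\<phi> x)" by (simp add: \<pi>\<phi> shift_def)
        then show ?thesis using True by (auto simp: w_def)
      next
        case False
        define y where "y = x - (size_at n - cut_at n)"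
        have y: "y < size_at n" "shift n True y = x" using False x cutsz by (auto simp: y_def shift_def)
        then have "\<psi> x = \<pi> True (\<phi> y)" by (simp add: \<pi>\<phi>)
        then show ?thesis using y by (auto simp: w_def)
      qed
    qed
  qed (use \<pi>w in blast)
  obtain K' where K': "K \<le> K'" "Suc n \<le> b_n (b K')"
    using filterlim_at_top[of "\<lambda>n. b_n (b n)" sequentially] lengths
    by (metis eventually_sequentially nat_le_linear)
  have KK: "brick_le \<iota> (b K) (b K')" using tower_le[OF K'(1)] .
  have \<rho>m: "strict_mono_on (\<psi> ` {..<size_at (Suc n)}) \<rho>"
    using \<rho>(1) by (simp add: union quasi_embedding_into_def quasi_embedding_def)
  have "placed (Suc n) (K', \<rho> \<circ> \<psi>)"
  proof -
    have "plain_on S (\<rho> ` \<psi> ` {..<size_at (Suc n)})"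
      using plain_on_image[OF \<rho>(1)] \<psi>(2) by (simp add: union)
    moreover have "strict_mono_on {..<size_at (Suc n)} (\<rho> \<circ> \<psi>)"
      using \<rho>m \<psi>(1) by (auto simp: strict_mono_on_def)
    moreover have "\<rho> ` \<psi> ` {..<size_at (Suc n)} \<subseteq> b_w (b K')"
      using \<rho>(2) brick_leD(1)[OF KK] unfolding union by blast
    ultimately show ?thesis using K' by (simp add: placed_def image_comp)
  qed
  moreover have "refines n (shift n d) p (K', \<rho> \<circ> \<psi>)" for d
  proof -
    have \<rho>\<pi>: "inj_on (\<rho> \<circ> \<pi> d) w"
      using \<pi>m[of d] \<rho>m \<pi>w[of d]
      by (meson comp_inj_on inj_on_subset strict_mono_on_imp_inj_on)
    have ev: "\<rho> (\<psi> (shift n d x)) = (\<rho> \<circ> \<pi> d) (\<phi> x)" if "x < size_at n" for x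
      using that by (simp add: \<pi>\<phi>)
    have inK: "(\<rho> \<circ> \<pi> d) a \<in> b_w (b K)" if "a \<in> w" for a
      using \<rho>(2) that by (cases d) auto
    have aw: "\<phi> x \<in> w" if "x < size_at n" for x using that by (simp add: w_def)
    show ?thesis
      unfolding refines_def
    proof (intro allI impI conjI)
      fix x assume x: "x < size_at n"
      show "prefix (b_eta (b (fst p)) (snd p x)) (b_eta (b (fst (K', \<rho> \<circ> \<psi>))) (snd (K', \<rho> \<circ> \<psi>) (shift n d x)))"
        using brick_le_imageD(1)[OF \<rho>\<pi> aw[OF x] le] brick_leD(2)[OF KK inK[OF aw[OF x]]] ev[OF x]
        by (simp add: \<phi>_def K0_def)
      fix y i assume y: "y < size_at n" "x \<noteq> y" "i < \<iota>"
      have ne: "\<phi> x \<noteq> \<phi> y" using \<phi>i x y by (simp add: inj_on_eq_iff)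
      have ne': "(\<rho> \<circ> \<pi> d) (\<phi> x) \<noteq> (\<rho> \<circ> \<pi> d) (\<phi> y)"
      proof
        assume "(\<rho> \<circ> \<pi> d) (\<phi> x) = (\<rho> \<circ> \<pi> d) (\<phi> y)"
        from inj_onD[OF \<rho>\<pi> this aw[OF x] aw[OF y(1)]] show False using ne by simp
      qed
      note hg = brick_le_imageD(2)[OF \<rho>\<pi> aw[OF x] le aw[OF y(1)] ne y(3)]
        brick_leD(3)[OF KK inK[OF aw[OF x]] inK[OF aw[OF y(1)]] ne' y(3)]
      show "b_h (b (fst (K', \<rho> \<circ> \<psi>))) i (snd (K', \<rho> \<circ> \<psi>) (shift n d x)) (snd (K', \<rho> \<circ> \<psi>) (shift n d y))
          = b_h (b (fst p)) i (snd p x) (snd p y)"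
        "prefix (b_g (b (fst p)) i (snd p x) (snd p y))
          (b_g (b (fst (K', \<rho> \<circ> \<psi>))) i (snd (K', \<rho> \<circ> \<psi>) (shift n d x)) (snd (K', \<rho> \<circ> \<psi>) (shift n d y)))"
        using hg ev[OF x] ev[OF y(1)] by (auto simp: \<phi>_def K0_def)
    qed
  qed
  ultimately show ?thesis by blast
qed

lemma placements: "\<exists>s. \<forall>n. placed n (s n) \<and> (\<forall>d. refines n (shift n d) (s n) (s (Suc n)))"
  by (rule dependent_nat_choice) (use placed_start placed_step in auto)

end

section \<open>Uncountably many overlapping translations\<close>

lemma init_seg_iff: "init_seg l f \<longleftrightarrow> (\<forall>k<length l. l ! k = f k)"
proof
  assume l: "init_seg l f"
  show "\<forall>k<length l. l ! k = f k"
  proof (intro allI impI)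
    fix k assume "k < length l"
    then have "map f [0..<length l] ! k = f k" by simp
    then show "l ! k = f k" using l by (simp only: init_seg_def)
  qed
next
  assume l: "\<forall>k<length l. l ! k = f k"
  show "init_seg l f"
    unfolding init_seg_def by (rule nth_equalityI) (simp_all add: l)
qed

lemma init_seg_take:
  assumes "init_seg l f" "m \<le> length l"
  shows "map f [0..<m] = take m l"
  by (rule nth_equalityI) (use assms in \<open>simp_all add: init_seg_iff\<close>)

lemma tree_prefix: "is_tree T \<Longrightarrow> l \<in> T \<Longrightarrow> prefix k l \<Longrightarrow> k \<in> T"
  unfolding is_tree_def by (metis prefix_order.le_less)

lemma prefix_nth: "prefix a b \<Longrightarrow> k < length a \<Longrightarrow> a ! k = b ! k"
  by (auto simp: prefix_def nth_append)

lemma prefix_chain_limit: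
  fixes L :: "nat \<Rightarrow> bit list"
  assumes "\<And>n. N \<le> n \<Longrightarrow> prefix (L n) (L (Suc n))" "\<And>n. N \<le> n \<Longrightarrow> n \<le> length (L n)"
  shows "\<exists>f. \<forall>n\<ge>N. init_seg (L n) f"
proof -
  have mono: "prefix (L m) (L n)" if "N \<le> m" "m \<le> n" for m n
    using that(2)
  proof (induction n rule: dec_induct)
    case (step n)
    then show ?case using assms(1)[of n] that(1) prefix_order.trans by fastforce
  qed simp
  define f where "f k = L (max N (Suc k)) ! k" for k
  have nth: "L n ! k = f k" if "N \<le> n" "k < length (L n)" for n k
  proof -
    define M where "M = max N (Suc k)"
    have M: "k < length (L M)" using assms(2)[of M] by (simp add: M_def)
    have "L n ! k = L (max n M) ! k" "L M ! k = L (max n M) ! k"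
      using prefix_nth[OF mono[of n "max n M"]] prefix_nth[OF mono[of M "max n M"]] that M
      by (simp_all add: M_def)
    then show ?thesis by (simp add: f_def M_def)
  qed
  then show ?thesis by (intro exI[of _ f]) (simp add: init_seg_iff)
qed

lemma bit_swap: "a + g = b + g' \<Longrightarrow> a + g' = b + (g :: bit)"
  by (cases a; cases b; cases g; cases g') auto

lemma cantor_swap:
  assumes "x + g = y + (g' :: nat \<Rightarrow> bit)"
  shows "x + g' = y + g"
proof
  fix k
  have "x k + g k = y k + g' k" using fun_cong[OF assms, of k] by (simp only: plus_fun_apply)
  from bit_swap[OF this] show "(x + g') k = (y + g) k" by (simp only: plus_fun_apply)
qed

context brick_tower begin

lemma eta_limit:
  assumes s: "\<And>n. placed n (s n)" "\<And>n d. refines n (shift n d) (s n) (s (Suc n))"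
    and x: "\<And>n. x n < size_at n" and N: "coherent {x} N"
  shows "\<exists>f. \<forall>n\<ge>N. init_seg (b_eta (b (fst (s n))) (snd (s n) (x n))) f"
proof (rule prefix_chain_limit)
  fix n assume n: "N \<le> n"
  then obtain d where "x (Suc n) = shift n d (x n)" using N by (auto simp: coherent_def)
  then show "prefix (b_eta (b (fst (s n))) (snd (s n) (x n))) (b_eta (b (fst (s (Suc n)))) (snd (s (Suc n)) (x (Suc n))))"
    using s(2)[of n d] x[of n] by (simp add: refines_def)
  have "snd (s n) (x n) \<in> b_w (b (fst (s n)))" using s(1)[of n] x[of n] by (auto simp: placed_def)
  then have "length (b_eta (b (fst (s n))) (snd (s n) (x n))) = b_n (b (fst (s n)))"
    using brick[of "fst (s n)"] by (simp add: is_brick_def)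
  then show "n \<le> length (b_eta (b (fst (s n))) (snd (s n) (x n)))" using s(1)[of n] by (simp add: placed_def)
qed

lemma coherent_distinct:
  assumes "coherent {x, y} N" "x N \<noteq> y N" "N \<le> n"
  shows "x n \<noteq> (y n :: nat)"
  using assms(2) coherent_order[OF assms(1), of x y n] coherent_order[OF assms(1), of y x n] assms(3)
  by (cases "x N < y N") auto

text \<open>
  While two paths are coherent, the pairs \<open>(x n, y n)\<close> are images of each other.  So the tree index
  does not change, and the nodes increase to a branch of this tree.
\<close>
lemma branch_limit:
  assumes s: "\<And>n. placed n (s n)" "\<And>n d. refines n (shift n d) (s n) (s (Suc n))"
    and xy: "\<And>n. x n < size_at n" "\<And>n. y n < size_at n" and N: "coherent {x, y} N" "x N \<noteq> y N"
    and i: "i < \<iota>"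
  shows "\<exists>G. (\<forall>n\<ge>N. init_seg (b_g (b (fst (s n))) i (snd (s n) (x n)) (snd (s n) (y n))) G) \<and>
    (\<exists>h. G \<in> lim_tree (T h))"
proof -
  define g where "g n = b_g (b (fst (s n))) i (snd (s n) (x n)) (snd (s n) (y n))" for n
  define h where "h n = b_h (b (fst (s n))) i (snd (s n) (x n)) (snd (s n) (y n))" for n
  have ne: "x n \<noteq> y n" if "N \<le> n" for n using coherent_distinct[OF N that] .
  have w: "snd (s n) (x n) \<in> b_w (b (fst (s n)))" "snd (s n) (y n) \<in> b_w (b (fst (s n)))" for n
    using s(1)[of n] xy[of n] by (auto simp: placed_def)
  have ne': "snd (s n) (x n) \<noteq> snd (s n) (y n)" if "N \<le> n" for n
  proof -
    have "inj_on (snd (s n)) {..<size_at n}"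
      using s(1)[of n] strict_mono_on_imp_inj_on unfolding placed_def by blast
    then show ?thesis using ne[OF that] xy[of n] by (simp add: inj_on_eq_iff)
  qed
  have step: "prefix (g n) (g (Suc n)) \<and> h (Suc n) = h n" if n: "N \<le> n" for n
  proof -
    obtain d where "x (Suc n) = shift n d (x n)" "y (Suc n) = shift n d (y n)"
      using N(1) n by (auto simp: coherent_def)
    then show ?thesis
      using s(2)[of n d] xy[of n] ne[OF n] i by (simp add: refines_def g_def h_def)
  qed
  have len: "length (g n) = b_n (b (fst (s n)))" "g n \<in> T (h n)" if "N \<le> n" for n
    using brick_pair(3,4)[OF brick w ne'[OF that] i] by (simp_all add: g_def h_def)
  have ge: "n \<le> length (g n)" if "N \<le> n" for n using len(1)[OF that] s(1)[of n] by (simp add: placed_def)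
  obtain G where G: "\<forall>n\<ge>N. init_seg (g n) G"
    using prefix_chain_limit[of N g] step ge by blast
  have h: "h n = h N" if "N \<le> n" for n
    using that by (induction n rule: dec_induct) (use step in auto)
  have "map G [0..<m] \<in> T (h N)" for m
  proof -
    define n where "n = max N m"
    have "map G [0..<m] = take m (g n)"
      using G ge[of n] by (intro init_seg_take) (auto simp: n_def)
    moreover have "g n \<in> T (h N)" using len(2)[of n] h[of n] by (simp add: n_def)
    ultimately show ?thesis using tree_prefix[OF tree] take_is_prefix by metis
  qed
  then have "G \<in> lim_tree (T (h N))" by (simp add: lim_tree_def)
  then show ?thesis using G unfolding g_def by blast
qed

text \<open>
  The branches \<open>G i\<close> and \<open>G' i\<close> of the two orderings of the pair satisfy
  \<open>ex + G i = ey + G' i\<close>, and, by adding \<open>ex + ey\<close>, also \<open>ex + G' i = ey + G i\<close>.  They are pairwise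
  distinct because their initial segments in the brick are.
\<close>
lemma overlap:
  assumes s: "\<And>n. placed n (s n)" "\<And>n d. refines n (shift n d) (s n) (s (Suc n))"
    and xy: "\<And>n. x n < size_at n" "\<And>n. y n < size_at n" and N: "coherent {x, y} N" "x N \<noteq> y N"
    and ex: "\<forall>\<^sub>F n in sequentially. init_seg (b_eta (b (fst (s n))) (snd (s n) (x n))) ex"
    and ey: "\<forall>\<^sub>F n in sequentially. init_seg (b_eta (b (fst (s n))) (snd (s n) (y n))) ey"
  shows "ex \<noteq> ey \<and> card_ge ((+) ex ` (\<Union>m. lim_tree (T m)) \<inter> (+) ey ` (\<Union>m. lim_tree (T m))) (2 * \<iota>)"
proof -
  let ?B = "\<Union>m. lim_tree (T m)"
  obtain M where M: "N \<le> M" "\<And>n. M \<le> n \<Longrightarrow> init_seg (b_eta (b (fst (s n))) (snd (s n) (x n))) ex"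
    "\<And>n. M \<le> n \<Longrightarrow> init_seg (b_eta (b (fst (s n))) (snd (s n) (y n))) ey"
  proof -
    obtain M1 M2 where "\<forall>n\<ge>M1. init_seg (b_eta (b (fst (s n))) (snd (s n) (x n))) ex"
      "\<forall>n\<ge>M2. init_seg (b_eta (b (fst (s n))) (snd (s n) (y n))) ey"
      using ex ey unfolding eventually_sequentially by blast
    then show thesis by (intro that[of "max N (max M1 M2)"]) auto
  qed
  define X where "X n = snd (s n) (x n)" for n
  define Y where "Y n = snd (s n) (y n)" for n
  define K where "K n = fst (s n)" for n
  have w: "X n \<in> b_w (b (K n))" "Y n \<in> b_w (b (K n))" for n
    using s(1)[of n] xy[of n] by (auto simp: placed_def X_def Y_def K_def)
  have ne: "X n \<noteq> Y n" if "N \<le> n" for n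
  proof -
    have "inj_on (snd (s n)) {..<size_at n}"
      using s(1)[of n] strict_mono_on_imp_inj_on unfolding placed_def by blast
    then show ?thesis using coherent_distinct[OF N that] xy[of n] by (simp add: inj_on_eq_iff X_def Y_def)
  qed
  note pair = brick_pair[OF brick w ne] and pair' = brick_pair[OF brick w(2,1) ne[symmetric]]
  have big: "n \<le> b_n (b (K n))" for n using s(1)[of n] by (simp add: placed_def K_def)
  have "\<forall>i\<in>{..<\<iota>}. \<exists>G. (\<forall>n\<ge>N. init_seg (b_g (b (K n)) i (X n) (Y n)) G) \<and> G \<in> ?B"
    using branch_limit[OF s xy N] unfolding X_def Y_def K_def by blast
  from bchoice[OF this] obtain G where
    G: "\<And>i n. i < \<iota> \<Longrightarrow> N \<le> n \<Longrightarrow> init_seg (b_g (b (K n)) i (X n) (Y n)) (G i)" "\<And>i. i < \<iota> \<Longrightarrow> G i \<in> ?B"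
    by auto
  have N': "coherent {y, x} N" "y N \<noteq> x N" using N by (auto simp: insert_commute)
  have "\<forall>i\<in>{..<\<iota>}. \<exists>G. (\<forall>n\<ge>N. init_seg (b_g (b (K n)) i (Y n) (X n)) G) \<and> G \<in> ?B"
    using branch_limit[OF s xy(2,1) N'] unfolding X_def Y_def K_def by blast
  from bchoice[OF this] obtain G' where
    G': "\<And>i n. i < \<iota> \<Longrightarrow> N \<le> n \<Longrightarrow> init_seg (b_g (b (K n)) i (Y n) (X n)) (G' i)" "\<And>i. i < \<iota> \<Longrightarrow> G' i \<in> ?B"
    by auto
  have "ex \<noteq> ey"
  proof
    assume "ex = ey"
    then have "b_eta (b (K M)) (X M) = b_eta (b (K M)) (Y M)"
      using M(2,3)[of M] pair(1)[OF M(1)] pair'(1)[OF M(1)]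
      by (metis K_def X_def Y_def init_seg_def order_refl)
    then show False using pair(2)[OF M(1)] by simp
  qed
  moreover have sum: "ex + G i = ey + G' i" if i: "i < \<iota>" for i
  proof
    fix k
    define n where "n = max M (Suc k)"
    have n: "M \<le> n" "N \<le> n" "k < b_n (b (K n))" using M(1) big[of n] by (auto simp: n_def)
    have "list_add (b_eta (b (K n)) (X n)) (b_g (b (K n)) i (X n) (Y n)) ! k =
        list_add (b_eta (b (K n)) (Y n)) (b_g (b (K n)) i (Y n) (X n)) ! k"
      using pair(5)[OF n(2) i] by simp
    then show "(ex + G i) k = (ey + G' i) k"
      using M(2,3)[OF n(1)] G(1)[OF i n(2)] G'(1)[OF i n(2)] n(3) pair(1,3)[OF n(2)] pair'(1,3)[OF n(2)] i
      by (simp add: list_add_def init_seg_iff X_def[symmetric] Y_def[symmetric] K_def[symmetric])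
  qed
  moreover have "card_ge ((+) ex ` ?B \<inter> (+) ey ` ?B) (2 * \<iota>)"
  proof -
    define zs where "zs = map G [0..<\<iota>] @ map G' [0..<\<iota>]"
    have "map (\<lambda>f. map f [0..<b_n (b (K N))]) zs =
        map (\<lambda>i. b_g (b (K N)) i (X N) (Y N)) [0..<\<iota>] @ map (\<lambda>i. b_g (b (K N)) i (Y N) (X N)) [0..<\<iota>]"
      using G(1)[of _ N] G'(1)[of _ N] pair(3)[of N] pair'(3)[of N]
      by (simp add: zs_def init_seg_def)
    then have "distinct zs" using pair(6)[of N] by (metis distinct_map order_refl)
    then have "card (set zs) = length zs" by (rule distinct_card)
    then have "card (set zs) = 2 * \<iota>" by (simp add: zs_def)
    then have card: "card ((+) ex ` set zs) = 2 * \<iota>"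
      by (subst card_image) (auto simp: inj_on_def)
    have "(+) ex ` set zs \<subseteq> (+) ex ` ?B \<inter> (+) ey ` ?B"
    proof
      fix z assume "z \<in> (+) ex ` set zs"
      then obtain i where i: "i < \<iota>" "z = ex + G i \<or> z = ex + G' i" by (auto simp: zs_def)
      have "z \<in> (+) ex ` ?B" using i G(2) G'(2) by blast
      moreover have "z = ey + G' i \<or> z = ey + G i" using i(2) sum[OF i(1)] cantor_swap[OF sum[OF i(1)]] by metis
      ultimately show "z \<in> (+) ex ` ?B \<inter> (+) ey ` ?B" using G(2)[OF i(1)] G'(2)[OF i(1)] by blast
    qed
    then show ?thesis using card unfolding card_ge_def by (metis card_mono)
  qed
  ultimately show ?thesis by blast
qed

lemma omega1_overlaps:
  "\<exists>\<eta> :: ordinal \<Rightarrow> nat \<Rightarrow> bit. inj_on \<eta> {..<ord_omega1} \<and>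
     (\<forall>\<alpha><ord_omega1. \<forall>\<beta><ord_omega1.
        card_ge (((+) (\<eta> \<alpha>) ` (\<Union>m. lim_tree (T m))) \<inter> ((+) (\<eta> \<beta>) ` (\<Union>m. lim_tree (T m)))) (2 * \<iota>))"
proof -
  let ?B = "\<Union>m. lim_tree (T m)"
  obtain X where X: "good_family X" "uncountable X" using uncountable_good_family by blast
  obtain s where s: "\<And>n. placed n (s n)" "\<And>n d. refines n (shift n d) (s n) (s (Suc n))"
    using placements by blast
  \<comment> \<open>Eventual agreement determines \<open>e x\<close> from \<open>x\<close> alone, so all partners of \<open>x\<close> get the same point.\<close>
  define e where "e x = (SOME f. \<forall>\<^sub>F n in sequentially. init_seg (b_eta (b (fst (s n))) (snd (s n) (x n))) f)" for x
  have bound: "x n < size_at n" if "x \<in> X" for x n using good_familyD(1)[OF X(1) that] .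
  have e: "\<forall>\<^sub>F n in sequentially. init_seg (b_eta (b (fst (s n))) (snd (s n) (x n))) (e x)" if xX: "x \<in> X" for x
  proof -
    obtain N where N: "coherent {x} N" using good_familyD(2)[OF X(1), of "{x}"] xX by auto
    have "\<exists>f. \<forall>n\<ge>N. init_seg (b_eta (b (fst (s n))) (snd (s n) (x n))) f"
      by (rule eta_limit[OF s bound[OF xX] N])
    then show ?thesis unfolding e_def
      by (intro someI_ex[of "\<lambda>f. \<forall>\<^sub>F n in sequentially. init_seg (b_eta (b (fst (s n))) (snd (s n) (x n))) f"])
        (auto simp: eventually_sequentially)
  qed
  have ov: "e x \<noteq> e y \<and> card_ge ((+) (e x) ` ?B \<inter> (+) (e y) ` ?B) (2 * \<iota>)" if xy: "x \<in> X" "y \<in> X" "x \<noteq> y" for x y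
  proof -
    obtain N where "coherent {x, y} N" "x N \<noteq> y N" using good_familyD(3)[OF X(1) xy] by blast
    then show ?thesis using overlap[OF s bound[OF xy(1)] bound[OF xy(2)] _ _ e[OF xy(1)] e[OF xy(2)]] by blast
  qed
  have ov': "card_ge ((+) (e x) ` ?B \<inter> (+) (e y) ` ?B) (2 * \<iota>)" if xy: "x \<in> X" "y \<in> X" for x y
  proof (cases "x = y")
    case True
    obtain z where z: "z \<in> X" "z \<noteq> x"
      using X(2) by (metis countable_empty countable_insert countable_subset insertCI subsetI)
    \<comment> \<open>The translation by \<open>e x\<close> is large since it already meets another one in a large set.\<close>
    have sub: "(+) (e x) ` ?B \<inter> (+) (e z) ` ?B \<subseteq> (+) (e x) ` ?B \<inter> (+) (e y) ` ?B" using True by blast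
    then show ?thesis using ov[OF xy(1) z(1) z(2)[symmetric]] unfolding card_ge_def
      by (meson card_mono dual_order.trans infinite_super)
  qed (use ov xy in blast)
  obtain f :: "ordinal \<Rightarrow> nat \<Rightarrow> nat" where f: "inj_on f {..<ord_omega1}" "f ` {..<ord_omega1} \<subseteq> X"
    using inj_omega1[OF X(2)] by blast
  have "inj_on e X" by (rule inj_onI) (use ov in blast)
  then have "inj_on (e \<circ> f) {..<ord_omega1}"
    using comp_inj_on[OF f(1)] inj_on_subset[OF _ f(2)] by blast
  then show ?thesis using ov' f(2) by (intro exI[of _ "e \<circ> f"]) (auto simp: image_subset_iff)
qed

end

section \<open>Compactness and category in the Cantor space\<close>

definition agree :: "nat \<Rightarrow> (nat \<Rightarrow> bit) \<Rightarrow> (nat \<Rightarrow> bit) \<Rightarrow> bool" where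
  "agree n x y \<longleftrightarrow> (\<forall>k<n. x k = y k)"

definition stem :: "nat \<Rightarrow> (nat \<Rightarrow> bit) \<Rightarrow> bit list" where
  "stem n x = map x [0..<n]"

lemma length_stem [simp]: "length (stem n x) = n"
  by (simp add: stem_def)

lemma stem_eq_iff: "stem n x = stem n y \<longleftrightarrow> agree n x y"
  by (simp add: stem_def agree_def Ball_def)

lemma take_stem: "m \<le> n \<Longrightarrow> take m (stem n x) = stem m x"
  by (simp add: stem_def take_map)

lemma init_seg_stem: "init_seg (stem n x) x"
  by (simp add: init_seg_def stem_def)

lemma init_seg_stemD: "init_seg g x \<Longrightarrow> g = stem (length g) x"
  by (simp add: init_seg_def stem_def)

lemma prefix_stem: "init_seg g x \<Longrightarrow> length g \<le> n \<Longrightarrow> prefix g (stem n x)"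
  by (metis init_seg_stemD take_is_prefix take_stem)

lemma agree_refl [simp]: "agree n x x"
  by (simp add: agree_def)

lemma agree_sym: "agree n x y \<Longrightarrow> agree n y x"
  by (simp add: agree_def)

lemma agree_trans: "agree n x y \<Longrightarrow> agree n y z \<Longrightarrow> agree n x z"
  by (simp add: agree_def)

lemma agree_le: "agree n x y \<Longrightarrow> m \<le> n \<Longrightarrow> agree m x y"
  by (simp add: agree_def)

lemma agree_all: "(\<And>n. agree n x y) \<Longrightarrow> x = y"
proof
  fix k assume "\<And>n. agree n x y"
  from this[of "Suc k"] show "x k = y k" by (simp add: agree_def)
qed

lemma cantor_add_cancel: "x + (z + x) = (z :: nat \<Rightarrow> bit)" "x + z + x = z"
proof -
  have b: "a + (c + a) = c" for a c :: bit by (cases a; cases c) simp_all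
  show "x + (z + x) = z" by (rule ext) (simp only: plus_fun_apply b)
  then show "x + z + x = z" by (simp only: add.assoc)
qed

lemma openin_cantor:
  "openin cantor_topology U \<longleftrightarrow> (\<forall>x\<in>U. \<exists>n. \<forall>y. agree n x y \<longrightarrow> y \<in> U)"
proof
  assume U: "openin cantor_topology U"
  show "\<forall>x\<in>U. \<exists>n. \<forall>y. agree n x y \<longrightarrow> y \<in> U"
  proof
    fix x assume "x \<in> U"
    then have "\<exists>V. finite {i. V i \<noteq> (UNIV :: bit set)} \<and> x \<in> Pi UNIV V \<and> Pi UNIV V \<subseteq> U"
      using U unfolding cantor_topology_def openin_product_topology_alt by (simp add: PiE_UNIV_domain)
    then obtain V where V: "finite {i. V i \<noteq> (UNIV :: bit set)}" "x \<in> Pi UNIV V" "Pi UNIV V \<subseteq> U"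
      by blast
    obtain n where n: "\<And>i. V i \<noteq> UNIV \<Longrightarrow> i < n"
      using V(1) unfolding finite_nat_set_iff_bounded by blast
    have "y \<in> U" if y: "agree n x y" for y
    proof -
      have "y i \<in> V i" for i
      proof (cases "i < n")
        case True
        then have "x i = y i" using y by (simp add: agree_def)
        then show ?thesis using V(2) by (metis Pi_mem UNIV_I)
      next
        case False
        then have "V i = UNIV" using n by blast
        then show ?thesis by simp
      qed
      then show ?thesis using V(3) by blast
    qed
    then show "\<exists>n. \<forall>y. agree n x y \<longrightarrow> y \<in> U" by blast
  qed
next
  assume U: "\<forall>x\<in>U. \<exists>n. \<forall>y. agree n x y \<longrightarrow> y \<in> U"
  show "openin cantor_topology U"
    unfolding cantor_topology_def openin_product_topology_alt
  proof
    fix x assume "x \<in> U"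
    then obtain n where n: "\<And>y. agree n x y \<Longrightarrow> y \<in> U" using U by blast
    define V where "V i = (if i < n then {x i} else UNIV)" for i
    have "finite {i. V i \<noteq> UNIV}"
      by (rule finite_subset[of _ "{..<n}"]) (auto simp: V_def)
    moreover have "Pi\<^sub>E UNIV V \<subseteq> U"
    proof
      fix y assume "y \<in> Pi\<^sub>E UNIV V"
      then have "y i \<in> V i" for i by blast
      then have "agree n x y" unfolding agree_def V_def by (metis singletonD)
      then show "y \<in> U" by (rule n)
    qed
    moreover have "x \<in> Pi\<^sub>E UNIV V" by (simp add: PiE_UNIV_domain V_def)
    ultimately show "\<exists>V. finite {i \<in> UNIV. V i \<noteq> topspace (discrete_topology UNIV)} \<and>
        (\<forall>i\<in>UNIV. openin (discrete_topology UNIV) (V i)) \<and> x \<in> Pi\<^sub>E UNIV V \<and> Pi\<^sub>E UNIV V \<subseteq> U"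
      by (intro exI[of _ V]) simp
  qed
qed

lemma topspace_cantor: "topspace cantor_topology = UNIV"
  by (simp add: cantor_topology_def)

lemma perfect_setD:
  assumes "perfect_set P"
  shows "P \<noteq> {}" and "x \<notin> P \<Longrightarrow> \<exists>n. \<forall>y. agree n x y \<longrightarrow> y \<notin> P"
    and "x \<in> P \<Longrightarrow> \<exists>y\<in>P. y \<noteq> x \<and> agree n x y"
proof -
  show "P \<noteq> {}" using assms by (simp add: perfect_set_def)
  have "openin cantor_topology (UNIV - P)"
    using assms by (simp add: perfect_set_def closedin_def topspace_cantor)
  then show "x \<notin> P \<Longrightarrow> \<exists>n. \<forall>y. agree n x y \<longrightarrow> y \<notin> P" unfolding openin_cantor by blast
  assume "x \<in> P"
  then have "x \<in> cantor_topology derived_set_of P" using assms by (auto simp: perfect_set_def)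
  moreover have "openin cantor_topology {y. agree n x y}"
    unfolding openin_cantor
  proof (intro ballI exI[of _ n] allI impI)
    show "z \<in> {y. agree n x y}" if "y \<in> {y. agree n x y}" "agree n y z" for y z
      using that agree_trans[of n x y z] by simp
  qed
  moreover have "x \<in> {y. agree n x y}" by simp
  ultimately have "\<exists>y. y \<noteq> x \<and> y \<in> P \<and> y \<in> {y. agree n x y}"
    unfolding in_derived_set_of by meson
  then show "\<exists>y\<in>P. y \<noteq> x \<and> agree n x y" by auto
qed

text \<open>
  Koenig's lemma for binary sequences: a finite sequence is live if it begins witnesses at all levels,
  and a live sequence has a live continuation.
\<close>
lemma cantor_compact:
  assumes mono: "\<And>m n z. m \<le> n \<Longrightarrow> Q n z \<Longrightarrow> Q m z"
    and local: "\<And>n z z'. agree n z z' \<Longrightarrow> Q n z \<Longrightarrow> Q n z'"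
    and ex: "\<And>n. \<exists>z. Q n z"
  shows "\<exists>z. \<forall>n. Q n z"
proof -
  define live where "live l \<longleftrightarrow> (\<forall>n. \<exists>z. init_seg l z \<and> Q n z)" for l
  have "\<exists>d. live (l @ [d])" if l: "live l" for l
  proof (rule ccontr)
    assume "\<nexists>d. live (l @ [d])"
    then have "\<forall>d. \<exists>n. \<forall>z. init_seg (l @ [d]) z \<longrightarrow> \<not> Q n z" by (simp add: live_def)
    then obtain t where t: "\<And>d z. init_seg (l @ [d]) z \<Longrightarrow> \<not> Q (t d) z" by metis
    obtain z where z: "init_seg l z" "Q (max (t 0) (t 1)) z" using l by (auto simp: live_def)
    have "init_seg (l @ [z (length l)]) z" using z(1) by (simp add: init_seg_iff nth_append less_Suc_eq)
    then have "\<not> Q (t (z (length l))) z" by (rule t)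
    moreover have "t (z (length l)) \<le> max (t 0) (t 1)" by (cases "z (length l)") auto
    ultimately show False using mono z(2) by blast
  qed
  then obtain f where f: "\<And>l. live l \<Longrightarrow> live (l @ [f l])" by metis
  define L where "L = rec_nat [] (\<lambda>_ l. l @ [f l])"
  have LS: "L (Suc n) = L n @ [f (L n)]" and L0: "L 0 = []" for n by (simp_all add: L_def)
  have len: "length (L n) = n" for n by (induction n) (simp_all add: LS L0)
  have live: "live (L n)" for n
  proof (induction n)
    case 0
    then show ?case using ex by (simp add: L0 live_def init_seg_def)
  qed (simp add: LS f)
  obtain z where z: "\<And>n. init_seg (L n) z"
    using prefix_chain_limit[of 0 L] LS len by auto
  have "Q n z" for n
  proof -
    obtain z' where z': "init_seg (L n) z'" "Q n z'" using live[of n] by (auto simp: live_def)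
    have "agree n z' z" using z[of n] z'(1) by (simp add: init_seg_iff agree_def len)
    then show ?thesis using local z'(2) by blast
  qed
  then show ?thesis by blast
qed

text \<open>
  Closedness in the square of the Cantor space, in terms of basic neighbourhoods.
\<close>
definition closed_rel :: "((nat \<Rightarrow> bit) \<Rightarrow> (nat \<Rightarrow> bit) \<Rightarrow> bool) \<Rightarrow> bool" where
  "closed_rel R \<longleftrightarrow> (\<forall>x y. \<not> R x y \<longrightarrow> (\<exists>n. \<forall>x' y'. agree n x x' \<and> agree n y y' \<longrightarrow> \<not> R x' y'))"

text \<open>
  The point \<open>z\<close> lies in both translations \<open>x + lim (T a)\<close> and \<open>y + lim (T b)\<close>, and \<open>g\<close>, \<open>g'\<close> are
  initial segments of the two branches by which it is reached.
\<close>
definition meets :: "(nat \<Rightarrow> bit list set) \<Rightarrow> nat \<Rightarrow> nat \<Rightarrow> bit list \<Rightarrow> bit list \<Rightarrow>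
    (nat \<Rightarrow> bit) \<Rightarrow> (nat \<Rightarrow> bit) \<Rightarrow> bool" where
  "meets T a b g g' x y \<longleftrightarrow> (\<exists>z. z + x \<in> lim_tree (T a) \<and> z + y \<in> lim_tree (T b) \<and>
     init_seg g (z + x) \<and> init_seg g' (z + y))"

lemma meets_sym: "meets T a b g g' x y \<Longrightarrow> meets T b a g' g y x"
  by (auto simp: meets_def)

text \<open>
  A projection of a closed set along a compact space.
\<close>
lemma closed_meets: "closed_rel (meets T a b g g')"
  unfolding closed_rel_def
proof (intro allI impI, rule ccontr)
  fix x y assume neg: "\<not> meets T a b g g' x y"
    and "\<nexists>n. \<forall>x' y'. agree n x x' \<and> agree n y y' \<longrightarrow> \<not> meets T a b g g' x' y'"
  then have near: "\<exists>x' y'. agree n x x' \<and> agree n y y' \<and> meets T a b g g' x' y'" for n by blast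
  define Q where "Q n z \<longleftrightarrow> (\<forall>m\<le>n. stem m (z + x) \<in> T a \<and> stem m (z + y) \<in> T b) \<and>
    (\<forall>k<n. (k < length g \<longrightarrow> g ! k = (z + x) k) \<and> (k < length g' \<longrightarrow> g' ! k = (z + y) k))" for n z
  have cong: "stem m (z + x) = stem m (z' + x')" "k < m \<Longrightarrow> (z + x) k = (z' + x') k"
    if "agree n z z'" "agree n x x'" "m \<le> n" for m n k and x x' z z' :: "nat \<Rightarrow> bit"
    using that by (simp_all add: stem_eq_iff agree_def)
  have "\<exists>z. \<forall>n. Q n z"
  proof (rule cantor_compact)
    show "Q m z" if "m \<le> n" "Q n z" for m n z
      using that unfolding Q_def by (meson le_trans less_le_trans)
  next
    fix n z z' assume z: "agree n z z'" "Q n z"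
    have e: "stem m (z + x) = stem m (z' + x)" "stem m (z + y) = stem m (z' + y)"
      "k < n \<Longrightarrow> (z + x) k = (z' + x) k" "k < n \<Longrightarrow> (z + y) k = (z' + y) k" if "m \<le> n" for m k
      using cong[OF z(1), of x x] cong[OF z(1), of y y] that agree_refl by blast+
    show "Q n z'" using z(2) e unfolding Q_def by (metis order_refl)
  next
    fix n
    obtain x' y' z where xy: "agree n x' x" "agree n y' y" and z: "z + x' \<in> lim_tree (T a)"
      "z + y' \<in> lim_tree (T b)" "init_seg g (z + x')" "init_seg g' (z + y')"
      using near[of n] agree_sym unfolding meets_def by metis
    have e: "stem m (z + x') = stem m (z + x)" "stem m (z + y') = stem m (z + y)" if "m \<le> n" for m
      using cong(1)[OF agree_refl xy(1) that] cong(1)[OF agree_refl xy(2) that] by auto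
    have e': "(z + x') k = (z + x) k" "(z + y') k = (z + y) k" if "k < n" for k
      using cong(2)[OF agree_refl xy(1) order_refl that] cong(2)[OF agree_refl xy(2) order_refl that] by auto
    have "stem m (z + x') \<in> T a" "stem m (z + y') \<in> T b" for m
      using z(1,2) by (simp_all add: lim_tree_def stem_def)
    then have "stem m (z + x) \<in> T a" "stem m (z + y) \<in> T b" if "m \<le> n" for m
      using e[OF that] by metis+
    moreover have "k < length g \<Longrightarrow> g ! k = (z + x) k" "k < length g' \<Longrightarrow> g' ! k = (z + y) k" if "k < n" for k
      using z(3,4) e'[OF that] unfolding init_seg_iff by metis+
    ultimately have "Q n z" unfolding Q_def by blast
    then show "\<exists>z. Q n z" by blast
  qed
  then obtain z where z: "\<And>n. Q n z" by blast
  have "z + x \<in> lim_tree (T a)" "z + y \<in> lim_tree (T b)"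
    using z unfolding Q_def lim_tree_def stem_def by blast+
  moreover have "init_seg g (z + x)" "init_seg g' (z + y)"
    using z unfolding Q_def init_seg_iff by blast+
  ultimately show False using neg unfolding meets_def by blast
qed

lemma agree_limit:
  assumes "\<And>k. agree (n k) (x k) (x (Suc k))" "\<And>k. n k < n (Suc k)"
  shows "\<exists>z. \<forall>k. agree (n k) (x k) z"
proof -
  have nm: "strict_mono n" using assms(2) by (simp add: strict_mono_Suc_iff)
  have n_ge: "k \<le> n k" for k using nm by (simp add: strict_mono_imp_increasing)
  have mono: "agree (n k) (x k) (x j)" if "k \<le> j" for k j
    using that
  proof (induction j rule: dec_induct)
    case (step j)
    have "n k \<le> n j" using step(1) nm by (simp add: strict_mono_less_eq)
    then show ?case using step.IH agree_le[OF assms(1)] agree_trans by blast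
  qed simp
  define z where "z i = x (Suc i) i" for i
  have "agree (n k) (x k) z" for k
    unfolding agree_def
  proof (intro allI impI)
    fix i assume i: "i < n k"
    have i': "i < n (Suc i)" using n_ge[of "Suc i"] by simp
    show "x k i = z i"
    proof (cases "k \<le> Suc i")
      case True
      then show ?thesis using mono[OF True] i by (simp add: agree_def z_def)
    next
      case False
      then show ?thesis using mono[of "Suc i" k] i' by (simp add: agree_def z_def)
    qed
  qed
  then show ?thesis by blast
qed

text \<open>
  The Baire category theorem for a rectangle of a perfect set covered by countably many closed
  relations, proved directly: if no relation contained a smaller rectangle, one could leave the
  relations one after the other while shrinking the rectangle to a single pair.
\<close>
lemma baire_rectangle:
  fixes R :: "'c::countable \<Rightarrow> (nat \<Rightarrow> bit) \<Rightarrow> (nat \<Rightarrow> bit) \<Rightarrow> bool"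
  assumes P: "perfect_set P" and R: "\<And>c. closed_rel (R c)" and xy: "x \<in> P" "y \<in> P"
    and cover: "\<And>x' y'. x' \<in> P \<Longrightarrow> y' \<in> P \<Longrightarrow> agree n x x' \<Longrightarrow> agree n y y' \<Longrightarrow> \<exists>c\<in>C. R c x' y'"
  shows "\<exists>x'\<in>P. \<exists>y'\<in>P. \<exists>n'\<ge>n. \<exists>c\<in>C. agree n x x' \<and> agree n y y' \<and>
    (\<forall>x''\<in>P. \<forall>y''\<in>P. agree n' x' x'' \<longrightarrow> agree n' y' y'' \<longrightarrow> R c x'' y'')"
proof (rule ccontr)
  assume neg: "\<not> ?thesis"
  have neg: "\<exists>x''\<in>P. \<exists>y''\<in>P. agree n' x' x'' \<and> agree n' y' y'' \<and> \<not> R c x'' y''"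
    if "x' \<in> P" "y' \<in> P" "n \<le> n'" "c \<in> C" "agree n x x'" "agree n y y'" for x' y' n' c
    using neg that by blast
  define ok where "ok p \<longleftrightarrow> fst p \<in> P \<and> fst (snd p) \<in> P \<and> n \<le> snd (snd p) \<and> agree n x (fst p) \<and>
    agree n y (fst (snd p))" for p :: "(nat \<Rightarrow> bit) \<times> (nat \<Rightarrow> bit) \<times> nat"
  define nxt where "nxt k p p' \<longleftrightarrow> snd (snd p) < snd (snd p') \<and> agree (snd (snd p)) (fst p) (fst p') \<and>
    agree (snd (snd p)) (fst (snd p)) (fst (snd p')) \<and>
    (from_nat k \<in> C \<longrightarrow> (\<forall>u v. agree (snd (snd p')) (fst p') u \<and> agree (snd (snd p')) (fst (snd p')) v
       \<longrightarrow> \<not> R (from_nat k) u v))" for k and p p' :: "(nat \<Rightarrow> bit) \<times> (nat \<Rightarrow> bit) \<times> nat"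
  have "\<exists>s. \<forall>k. ok (s k) \<and> nxt k (s k) (s (Suc k))"
  proof (rule dependent_nat_choice)
    show "\<exists>p. ok p" using xy by (intro exI[of _ "(x, y, n)"]) (simp add: ok_def)
  next
    fix p k assume p: "ok p"
    obtain x1 y1 n1 where p1: "p = (x1, y1, n1)" by (cases p)
    have o: "x1 \<in> P" "y1 \<in> P" "n \<le> n1" "agree n x x1" "agree n y y1" using p by (simp_all add: ok_def p1)
    show "\<exists>p'. ok p' \<and> nxt k p p'"
    proof (cases "from_nat k \<in> C")
      case True
      obtain x2 y2 where x2: "x2 \<in> P" "y2 \<in> P" "agree n1 x1 x2" "agree n1 y1 y2" "\<not> R (from_nat k) x2 y2"
        using neg[OF o(1-3) True o(4,5)] by blast
      \<comment> \<open>The pair \<open>(x2, y2)\<close> has a whole neighbourhood outside the relation number \<open>k\<close>.\<close>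
      obtain n2 where n2: "\<And>u v. agree n2 x2 u \<Longrightarrow> agree n2 y2 v \<Longrightarrow> \<not> R (from_nat k) u v"
        using R[of "from_nat k"] x2(5) unfolding closed_rel_def by blast
      have "agree n x x2" "agree n y y2"
        using o(3-5) x2(3,4) agree_le agree_trans by blast+
      then have "ok (x2, y2, max (Suc n1) n2)" using x2 o(3) by (simp add: ok_def)
      moreover have "nxt k p (x2, y2, max (Suc n1) n2)"
        unfolding nxt_def p1 fst_conv snd_conv
      proof (intro conjI impI allI)
        show "agree n1 x1 x2" "agree n1 y1 y2" by fact+
        show "\<not> R (from_nat k) u v" if "agree (max (Suc n1) n2) x2 u \<and> agree (max (Suc n1) n2) y2 v" for u v
          by (rule n2) (use that agree_le[OF _ max.cobounded2] in blast)+
      qed simp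
      ultimately show ?thesis by blast
    next
      case False
      then show ?thesis using o by (intro exI[of _ "(x1, y1, Suc n1)"]) (simp add: ok_def nxt_def p1)
    qed
  qed
  then obtain s where s: "\<And>k. ok (s k)" "\<And>k. nxt k (s k) (s (Suc k))" by blast
  define m where "m k = snd (snd (s k))" for k
  have mS: "m k < m (Suc k)" for k using s(2)[of k] by (simp add: nxt_def m_def)
  have m_ge: "k \<le> m k" for k using mS by (simp add: strict_mono_Suc_iff strict_mono_imp_increasing)
  obtain u where u: "\<And>k. agree (m k) (fst (s k)) u"
    using agree_limit[of m "\<lambda>k. fst (s k)"] s(2) mS by (auto simp: nxt_def m_def)
  obtain v where v: "\<And>k. agree (m k) (fst (snd (s k))) v"
    using agree_limit[of m "\<lambda>k. fst (snd (s k))"] s(2) mS by (auto simp: nxt_def m_def)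
  have closed: "w \<in> P" if w: "\<And>k. agree (m k) (f k) w" "\<And>k. f k \<in> P" for f w
  proof (rule ccontr)
    assume "w \<notin> P"
    then obtain k where k: "\<And>y. agree k w y \<Longrightarrow> y \<notin> P" using perfect_setD(2)[OF P] by blast
    have "agree k w (f k)" using agree_le[OF w(1) m_ge] agree_sym by blast
    then show False using k w(2) by blast
  qed
  have "u \<in> P" "v \<in> P" using closed[OF u] closed[OF v] s(1) by (auto simp: ok_def)
  moreover have "agree n x u" "agree n y v"
  proof -
    have "n \<le> m 0" "agree n x (fst (s 0))" "agree n y (fst (snd (s 0)))"
      using s(1)[of 0] by (simp_all add: ok_def m_def)
    then show "agree n x u" "agree n y v" using agree_le[OF u] agree_le[OF v] agree_trans by blast+
  qed
  ultimately obtain c where c: "c \<in> C" "R c u v" using cover by blast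
  have "nxt (to_nat c) (s (to_nat c)) (s (Suc (to_nat c)))" by (rule s(2))
  then show False using c u[of "Suc (to_nat c)"] v[of "Suc (to_nat c)"] by (simp add: nxt_def m_def)
qed

text \<open>
  Finitely many points are moved slightly, and their neighbourhoods shrunk, until every one of finitely
  many prescribed pairs of neighbourhoods has a single colour.
\<close>
lemma shrink_boxes:
  fixes R :: "'j \<Rightarrow> 'c::countable \<Rightarrow> (nat \<Rightarrow> bit) \<Rightarrow> (nat \<Rightarrow> bit) \<Rightarrow> bool" and p q :: "'j \<Rightarrow> nat"
  assumes P: "perfect_set P" and R: "\<And>j c. closed_rel (R j c)"
    and J: "finite J" "\<And>j. j \<in> J \<Longrightarrow> p j \<noteq> q j"
    and x: "\<And>j. j \<in> J \<Longrightarrow> x (p j) \<in> P \<and> x (q j) \<in> P"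
    and cover: "\<And>j u v. j \<in> J \<Longrightarrow> u \<in> P \<Longrightarrow> v \<in> P \<Longrightarrow> agree N (x (p j)) u \<Longrightarrow> agree N (x (q j)) v \<Longrightarrow>
      \<exists>c\<in>C j. R j c u v"
  shows "\<exists>x' N' col. N \<le> N' \<and> (\<forall>a. agree N (x a) (x' a) \<and> (x a \<in> P \<longrightarrow> x' a \<in> P)) \<and>
    (\<forall>j\<in>J. col j \<in> C j \<and> (\<forall>u\<in>P. \<forall>v\<in>P. agree N' (x' (p j)) u \<longrightarrow> agree N' (x' (q j)) v \<longrightarrow> R j (col j) u v))"
  using J x cover
proof (induction J rule: finite_induct)
  case empty
  then show ?case by (intro exI[of _ x] exI[of _ N]) auto
next
  case (insert j J)
  have "\<exists>x' N' col. N \<le> N' \<and> (\<forall>a. agree N (x a) (x' a) \<and> (x a \<in> P \<longrightarrow> x' a \<in> P)) \<and>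
    (\<forall>j\<in>J. col j \<in> C j \<and> (\<forall>u\<in>P. \<forall>v\<in>P. agree N' (x' (p j)) u \<longrightarrow> agree N' (x' (q j)) v \<longrightarrow> R j (col j) u v))"
    by (rule insert.IH) (use insert.prems in auto)
  then obtain x1 N1 col where 1: "N \<le> N1" "\<And>a. agree N (x a) (x1 a)" "\<And>a. x a \<in> P \<Longrightarrow> x1 a \<in> P"
    "\<And>j. j \<in> J \<Longrightarrow> col j \<in> C j"
    "\<And>j u v. j \<in> J \<Longrightarrow> u \<in> P \<Longrightarrow> v \<in> P \<Longrightarrow> agree N1 (x1 (p j)) u \<Longrightarrow> agree N1 (x1 (q j)) v \<Longrightarrow> R j (col j) u v"
    by blast
  have pq: "p j \<noteq> q j" "x1 (p j) \<in> P" "x1 (q j) \<in> P" using insert.prems(1,2)[of j] 1(3) by auto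
  have cov: "\<exists>c\<in>C j. R j c u v" if "u \<in> P" "v \<in> P" "agree N1 (x1 (p j)) u" "agree N1 (x1 (q j)) v" for u v
  proof -
    have "agree N (x (p j)) u" "agree N (x (q j)) v"
      using 1(1,2) that(3,4) agree_le agree_trans by blast+
    then show ?thesis using insert.prems(3)[of j] that by simp
  qed
  obtain u v N2 c where 2: "u \<in> P" "v \<in> P" "N1 \<le> N2" "c \<in> C j" "agree N1 (x1 (p j)) u" "agree N1 (x1 (q j)) v"
    "\<And>u' v'. u' \<in> P \<Longrightarrow> v' \<in> P \<Longrightarrow> agree N2 u u' \<Longrightarrow> agree N2 v v' \<Longrightarrow> R j c u' v'"
    using baire_rectangle[where R = "R j" and C = "C j", OF P R pq(2,3) cov] by blast
  define x2 where "x2 = x1(p j := u, q j := v)"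
  have x2: "agree N1 (x1 a) (x2 a)" "x1 a \<in> P \<Longrightarrow> x2 a \<in> P" for a
    using 2 by (auto simp: x2_def)
  have x2j: "x2 (p j) = u" "x2 (q j) = v" using pq(1) by (auto simp: x2_def)
  show ?case
  proof (intro exI conjI allI ballI impI)
    show "N \<le> N2" using 1(1) 2(3) by simp
    show "agree N (x a) (x2 a)" for a using 1(1,2) x2(1) agree_le agree_trans by blast
    show "x2 a \<in> P" if "x a \<in> P" for a using that 1(3) x2(2) by blast
  next
    fix j' assume "j' \<in> insert j J"
    then show "(col(j := c)) j' \<in> C j'" using 1(4) 2(4) by auto
  next
    fix j' u' v' assume j': "j' \<in> insert j J" and uv: "u' \<in> P" "v' \<in> P" "agree N2 (x2 (p j')) u'" "agree N2 (x2 (q j')) v'"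
    show "R j' ((col(j := c)) j') u' v'"
    proof (cases "j' = j")
      case True
      then show ?thesis using 2(7) uv x2j by simp
    next
      case False
      then have "j' \<in> J" using j' by simp
      moreover have "agree N1 (x1 (p j')) u'" "agree N1 (x1 (q j')) v'"
        using uv(3,4) x2(1) 2(3) agree_le agree_trans by blast+
      ultimately show ?thesis using 1(5) uv(1,2) False by simp
    qed
  qed
qed

section \<open>Colours of overlapping pairs\<close>

lemma cantor_shift_rel: "z + y = (z + x + y) + (x :: nat \<Rightarrow> bit)" "(z + x + y) + y = z + x"
  "z + x + y = z \<Longrightarrow> x = y"
proof -
  have b: "c + e = (c + a + e) + a" "(c + a + e) + e = c + a" for a c e :: bit
    by (cases a; cases c; cases e; simp)+
  show "z + y = (z + x + y) + x" "(z + x + y) + y = z + x"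
    by (rule ext, simp only: plus_fun_apply b(1)[symmetric] b(2))+
  assume z: "z + x + y = z"
  have b': "c + a + e = c \<Longrightarrow> a = e" for a c e :: bit
    by (cases a; cases c; cases e; simp)
  show "x = y"
  proof
    fix k
    have "z k + x k + y k = z k" using fun_cong[OF z, of k] by (simp only: plus_fun_apply)
    then show "x k = y k" by (rule b')
  qed
qed

lemma card_ge_Diff_ex:
  assumes "card_ge S m" "finite F" "card F < m"
  shows "\<exists>z\<in>S. z \<notin> F"
proof (rule ccontr)
  assume "\<not> ?thesis"
  then have "S \<subseteq> F" by blast
  then have "finite S" "card S \<le> card F" using assms(2) finite_subset card_mono by auto
  then show False using assms by (simp add: card_ge_def)
qed

text \<open>
  Greedy choice; fewer than \<open>2 * m\<close> points are excluded at each step.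
\<close>
lemma paired_points:
  fixes x y :: "nat \<Rightarrow> bit"
  assumes S: "card_ge S (2 * m)" and \<tau>: "\<And>z. \<tau> (\<tau> z) = z" "\<And>z. \<tau> z \<noteq> z"
  shows "\<exists>zs. length zs = m \<and> set zs \<subseteq> S \<and> distinct (zs @ map \<tau> zs)"
proof -
  have "\<exists>zs. length zs = k \<and> set zs \<subseteq> S \<and> distinct (zs @ map \<tau> zs)" if "k \<le> m" for k
    using that
  proof (induction k)
    case (Suc k)
    then obtain zs where zs: "length zs = k" "set zs \<subseteq> S" "distinct (zs @ map \<tau> zs)" by auto
    have "card (set (zs @ map \<tau> zs)) \<le> length (zs @ map \<tau> zs)" by (rule card_length)
    also have "\<dots> < 2 * m" using zs(1) Suc.prems by simp
    finally obtain z where z: "z \<in> S" "z \<notin> set (zs @ map \<tau> zs)"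
      using card_ge_Diff_ex[OF S, of "set (zs @ map \<tau> zs)"] by auto
    have "\<tau> z \<notin> set zs" using z(2) \<tau>(1) by (metis Un_iff image_eqI list.set_map set_append)
    moreover have "\<tau> z \<notin> set (map \<tau> zs)" using z(2) \<tau>(1) by (metis Un_iff imageE list.set_map set_append)
    ultimately have "distinct ((z # zs) @ map \<tau> (z # zs))"
      using zs(3) z(2) \<tau>(2)[of z] by auto
    then show ?case using zs z by (intro exI[of _ "z # zs"]) simp
  qed simp
  then show ?thesis by blast
qed

lemma stems_separate:
  assumes "finite A"
  shows "\<exists>l. inj_on (stem l) A"
proof -
  have "\<forall>x y. \<exists>l. x \<noteq> y \<longrightarrow> \<not> agree l x y"
    using agree_all by blast
  then obtain f where f: "\<And>x y. x \<noteq> y \<Longrightarrow> \<not> agree (f x y) x y" by metis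
  define l where "l = Max (insert 0 ((\<lambda>p. f (fst p) (snd p)) ` (A \<times> A)))"
  have le: "f x y \<le> l" if "x \<in> A" "y \<in> A" for x y
  proof -
    have "f x y \<in> (\<lambda>p. f (fst p) (snd p)) ` (A \<times> A)"
      using that by (intro image_eqI[of _ _ "(x, y)"]) auto
    then show ?thesis using assms unfolding l_def by (intro Max_ge) auto
  qed
  have "inj_on (stem l) A"
  proof (rule inj_onI)
    fix x y assume xy: "x \<in> A" "y \<in> A" "stem l x = stem l y"
    then have "agree (f x y) x y" using agree_le le[OF xy(1,2)] by (simp add: stem_eq_iff)
    then show "x = y" using f by blast
  qed
  then show ?thesis by blast
qed

instance bit :: countable
  by (rule countable_classI[of "\<lambda>d. if d = 0 then 0 else 1"]) (auto split: if_splits)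

text \<open>
  The common points of translations by \<open>x\<close> and \<open>y\<close> come in pairs \<open>z\<close>, \<open>z + x + y\<close>.  An entry
  \<open>(a, b, g, g')\<close> records one such pair: the trees through which \<open>z + x\<close> and \<open>z + y\<close> run, and initial
  segments of these two branches.
\<close>
type_synonym colour = "(nat \<times> nat \<times> bit list \<times> bit list) list"

definition separated :: "nat \<Rightarrow> colour \<Rightarrow> bool" where
  "separated \<iota> L \<longleftrightarrow> length L = \<iota> \<and>
     (\<exists>l. \<forall>(a, b, g, g')\<in>set L. length g = l \<and> length g' = l) \<and>
     distinct (map (\<lambda>(a, b, g, g'). g) L @ map (\<lambda>(a, b, g, g'). g') L)"

definition coloured :: "(nat \<Rightarrow> bit list set) \<Rightarrow> colour \<Rightarrow> (nat \<Rightarrow> bit) \<Rightarrow> (nat \<Rightarrow> bit) \<Rightarrow> bool" where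
  "coloured T L x y \<longleftrightarrow> (\<forall>(a, b, g, g')\<in>set L. meets T a b g g' x y)"

lemma closed_coloured: "closed_rel (coloured T L)"
  unfolding closed_rel_def
proof (intro allI impI)
  fix x y assume "\<not> coloured T L x y"
  then obtain a b g g' where e: "(a, b, g, g') \<in> set L" "\<not> meets T a b g g' x y"
    unfolding coloured_def by blast
  then obtain n where "\<forall>x' y'. agree n x x' \<and> agree n y y' \<longrightarrow> \<not> meets T a b g g' x' y'"
    using closed_meets unfolding closed_rel_def by blast
  then show "\<exists>n. \<forall>x' y'. agree n x x' \<and> agree n y y' \<longrightarrow> \<not> coloured T L x' y'"
    using e(1) unfolding coloured_def by blast
qed

text \<open>
  One point from each of \<open>\<iota>\<close> different pairs \<open>z\<close>, \<open>z + x + y\<close> of common points gives \<open>2 * \<iota>\<close> different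
  branches \<open>z + x\<close>, \<open>z + y\<close>, which are separated at some finite level.
\<close>
lemma overlap_coloured:
  fixes x y :: "nat \<Rightarrow> bit"
  assumes ov: "card_ge (((+) x ` B) \<inter> ((+) y ` B)) (2 * \<iota>)" and xy: "x \<noteq> y"
    and B: "B = (\<Union>m. lim_tree (T m))"
  shows "\<exists>L. separated \<iota> L \<and> coloured T L x y"
proof -
  obtain zs where zs: "length zs = \<iota>" "set zs \<subseteq> ((+) x ` B) \<inter> ((+) y ` B)"
    "distinct (zs @ map (\<lambda>z. z + x + y) zs)"
  proof -
    have "z + x + y + x + y = z" for z
      using cantor_shift_rel(2)[of "z + x + y" x y] cantor_shift_rel(2)[of z x y] cantor_add_cancel
      by (metis add.assoc add.commute)
    moreover have "z + x + y \<noteq> z" for z using cantor_shift_rel(3) xy by blast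
    ultimately show thesis using paired_points[OF ov, of "\<lambda>z. z + x + y"] that by blast
  qed
  have mem: "\<exists>a b. z + x \<in> lim_tree (T a) \<and> z + y \<in> lim_tree (T b)" if z: "z \<in> set zs" for z
  proof -
    obtain \<beta> \<gamma> where "z = x + \<beta>" "\<beta> \<in> B" "z = y + \<gamma>" "\<gamma> \<in> B" using zs(2) z by blast
    then have "z + x = \<beta>" "z + y = \<gamma>" "\<beta> \<in> B" "\<gamma> \<in> B"
      using cantor_add_cancel(2)[of x \<beta>] cantor_add_cancel(2)[of y \<gamma>] by (simp_all only:)
    then show ?thesis unfolding B by blast
  qed
  then obtain a b where ab: "\<And>z. z \<in> set zs \<Longrightarrow> z + x \<in> lim_tree (T (a z))"
    "\<And>z. z \<in> set zs \<Longrightarrow> z + y \<in> lim_tree (T (b z))" by metis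
  define A where "A = set (map (\<lambda>z. z + x) zs @ map (\<lambda>z. z + y) zs)"
  obtain l where l: "inj_on (stem l) A" using stems_separate[of A] by (auto simp: A_def)
  define L where "L = map (\<lambda>z. (a z, b z, stem l (z + x), stem l (z + y))) zs"
  have "map (\<lambda>z. z + x) zs @ map (\<lambda>z. z + y) zs = map (\<lambda>z. z + x) (zs @ map (\<lambda>z. z + x + y) zs)"
    using cantor_shift_rel(1) by simp
  moreover have "inj (\<lambda>z. z + x)" by (simp add: inj_on_def)
  ultimately have "distinct (map (\<lambda>z. z + x) zs @ map (\<lambda>z. z + y) zs)"
    using zs(3) by (metis distinct_map inj_on_subset subset_UNIV)
  then have "distinct (map (stem l) (map (\<lambda>z. z + x) zs @ map (\<lambda>z. z + y) zs))"
    using l unfolding distinct_map A_def by blast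
  then have "distinct (map (\<lambda>(a, b, g, g'). g) L @ map (\<lambda>(a, b, g, g'). g') L)"
    by (simp add: L_def comp_def)
  moreover have "\<forall>(a, b, g, g')\<in>set L. length g = l \<and> length g' = l"
    by (auto simp: L_def)
  ultimately have "separated \<iota> L" using zs(1) by (auto simp: separated_def L_def)
  moreover have "meets T (a z) (b z) (stem l (z + x)) (stem l (z + y)) x y" if "z \<in> set zs" for z
    unfolding meets_def using ab[OF that] init_seg_stem by blast
  then have "coloured T L x y" by (auto simp: coloured_def L_def)
  ultimately show ?thesis by blast
qed

abbreviation col_h :: "colour \<Rightarrow> nat \<Rightarrow> nat" where "col_h L i \<equiv> fst (L ! i)"
abbreviation col_h' :: "colour \<Rightarrow> nat \<Rightarrow> nat" where "col_h' L i \<equiv> fst (snd (L ! i))"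
abbreviation col_g :: "colour \<Rightarrow> nat \<Rightarrow> bit list" where "col_g L i \<equiv> fst (snd (snd (L ! i)))"
abbreviation col_g' :: "colour \<Rightarrow> nat \<Rightarrow> bit list" where "col_g' L i \<equiv> snd (snd (snd (L ! i)))"

lemma separatedD:
  assumes "separated \<iota> L"
  shows "\<exists>k. \<forall>i<\<iota>. length (col_g L i) = k \<and> length (col_g' L i) = k"
    and "distinct (map (col_g L) [0..<\<iota>] @ map (col_g' L) [0..<\<iota>])"
    and "coloured T L x y \<Longrightarrow> i < \<iota> \<Longrightarrow>
      meets T (col_h L i) (col_h' L i) (col_g L i) (col_g' L i) x y"
proof -
  have len: "length L = \<iota>" using assms by (simp add: separated_def)
  have mem: "(col_h L i, col_h' L i, col_g L i, col_g' L i) \<in> set L" if "i < \<iota>" for i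
    using nth_mem[of i L] that len by simp
  show "\<exists>k. \<forall>i<\<iota>. length (col_g L i) = k \<and> length (col_g' L i) = k"
  proof -
    obtain k where k: "\<forall>(a, b, g, g')\<in>set L. length g = k \<and> length g' = k"
      using assms unfolding separated_def by (elim conjE exE)
    have "length (col_g L i) = k \<and> length (col_g' L i) = k" if "i < \<iota>" for i
      using bspec[OF k mem[OF that]] by (simp add: case_prod_beta)
    then show ?thesis by (intro exI[of _ k]) simp
  qed
  have "map (\<lambda>(a, b, g, g'). g) L = map (col_g L) [0..<\<iota>]"
    "map (\<lambda>(a, b, g, g'). g') L = map (col_g' L) [0..<\<iota>]"
    by (rule nth_equalityI; simp add: len split: prod.split)+
  then show "distinct (map (col_g L) [0..<\<iota>] @ map (col_g' L) [0..<\<iota>])"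
    using assms by (simp only: separated_def)
  show "meets T (col_h L i) (col_h' L i) (col_g L i) (col_g' L i) x y" if "coloured T L x y" "i < \<iota>"
    using bspec[OF that(1)[unfolded coloured_def] mem[OF that(2)]] by (simp add: case_prod_beta)
qed

lemma distinct_of_take:
  assumes "distinct xs" "map (take l) ys = xs"
  shows "distinct ys"
  using assms by (metis distinct_map)

section \<open>A perfect set of overlapping translations makes the rank infinite\<close>

text \<open>
  By compactness, colours are closed relations, and there are only countably many of them; so category
  applies to the square of \<open>P\<close>.
\<close>
locale perfect_overlaps =
  fixes P :: "(nat \<Rightarrow> bit) set" and \<iota> :: nat and T :: "nat \<Rightarrow> bit list set"
  assumes P: "perfect_set P"
    and overlaps: "x \<in> P \<Longrightarrow> y \<in> P \<Longrightarrow> x \<noteq> y \<Longrightarrow> \<exists>L. separated \<iota> L \<and> coloured T L x y"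
begin

text \<open>
  The tuple \<open>m\<close> is realised by a whole box: its vectors are the initial segments of points \<open>x a\<close> of
  \<open>P\<close>, and its pairs of nodes extend to common points for every two elements of \<open>P\<close> near \<open>x a\<close> and
  \<open>x b\<close>.  This is the property that survives the splitting of a vector.
\<close>
definition large :: "mtuple \<Rightarrow> nat \<Rightarrow> (nat \<Rightarrow> nat \<Rightarrow> bit) \<Rightarrow> nat \<Rightarrow> (nat \<Rightarrow> nat \<Rightarrow> nat \<Rightarrow> nat) \<Rightarrow>
    (nat \<Rightarrow> nat \<Rightarrow> nat \<Rightarrow> bit list) \<Rightarrow> bool" where
  "large m q x N H G \<longleftrightarrow> 2 \<le> q \<and> 0 < m_len m \<and> m_len m \<le> N \<and> (\<forall>a<q. x a \<in> P) \<and>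
     m_set m = (\<lambda>a. stem (m_len m) (x a)) ` {..<q} \<and>
     (\<forall>a<q. \<forall>b<q. a \<noteq> b \<longrightarrow> \<not> agree (m_len m) (x a) (x b) \<and>
       distinct (map (\<lambda>i. G i a b) [0..<\<iota>] @ map (\<lambda>i. G i b a) [0..<\<iota>]) \<and>
       (\<forall>i<\<iota>. length (G i a b) = m_len m \<and>
         m_h m i (stem (m_len m) (x a)) (stem (m_len m) (x b)) = H i a b \<and>
         m_g m i (stem (m_len m) (x a)) (stem (m_len m) (x b)) = G i a b \<and>
         (\<forall>u\<in>P. \<forall>v\<in>P. agree N (x a) u \<longrightarrow> agree N (x b) v \<longrightarrow>
            meets T (H i a b) (H i b a) (G i a b) (G i b a) u v)))"

lemma large_pairD:
  assumes m: "large m q x N H G" and ab: "a < q" "b < q" "a \<noteq> b"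
  shows "\<not> agree (m_len m) (x a) (x b)"
    and "distinct (map (\<lambda>i. G i a b) [0..<\<iota>] @ map (\<lambda>i. G i b a) [0..<\<iota>])"
    and "i < \<iota> \<Longrightarrow> length (G i a b) = m_len m"
    and "i < \<iota> \<Longrightarrow> m_h m i (stem (m_len m) (x a)) (stem (m_len m) (x b)) = H i a b"
    and "i < \<iota> \<Longrightarrow> m_g m i (stem (m_len m) (x a)) (stem (m_len m) (x b)) = G i a b"
    and "i < \<iota> \<Longrightarrow> u \<in> P \<Longrightarrow> v \<in> P \<Longrightarrow> agree N (x a) u \<Longrightarrow> agree N (x b) v \<Longrightarrow>
      meets T (H i a b) (H i b a) (G i a b) (G i b a) u v"
proof -
  note D = m[unfolded large_def, THEN conjunct2, THEN conjunct2, THEN conjunct2, THEN conjunct2,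
      THEN conjunct2, THEN spec, THEN mp, OF ab(1), THEN spec, THEN mp, OF ab(2), THEN mp, OF ab(3)]
  show "\<not> agree (m_len m) (x a) (x b)"
    "distinct (map (\<lambda>i. G i a b) [0..<\<iota>] @ map (\<lambda>i. G i b a) [0..<\<iota>])"
    by (rule D[THEN conjunct1] D[THEN conjunct2, THEN conjunct1])+
  assume "i < \<iota>"
  note E = D[THEN conjunct2, THEN conjunct2, THEN spec, THEN mp, OF this]
  show "length (G i a b) = m_len m"
    "m_h m i (stem (m_len m) (x a)) (stem (m_len m) (x b)) = H i a b"
    "m_g m i (stem (m_len m) (x a)) (stem (m_len m) (x b)) = G i a b"
    by (rule E[THEN conjunct1] E[THEN conjunct2, THEN conjunct1]
        E[THEN conjunct2, THEN conjunct2, THEN conjunct1])+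
  assume "u \<in> P" "v \<in> P" "agree N (x a) u" "agree N (x b) v"
  then show "meets T (H i a b) (H i b a) (G i a b) (G i b a) u v"
    using E[THEN conjunct2, THEN conjunct2, THEN conjunct2] by blast
qed

lemma large_Mfam:
  assumes "large m q x N H G"
  shows "m \<in> Mfam \<iota> T"
proof -
  define l where "l = m_len m"
  have L: "2 \<le> q" "0 < l" "\<And>a. a < q \<Longrightarrow> x a \<in> P"
    "m_set m = (\<lambda>a. stem l (x a)) ` {..<q}"
    using assms by (auto simp: large_def l_def)
  have pr: "\<not> agree l (x a) (x b)"
      "distinct (map (\<lambda>i. G i a b) [0..<\<iota>] @ map (\<lambda>i. G i b a) [0..<\<iota>])"
      "i < \<iota> \<Longrightarrow> length (G i a b) = l"
      "i < \<iota> \<Longrightarrow> m_h m i (stem l (x a)) (stem l (x b)) = H i a b"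
      "i < \<iota> \<Longrightarrow> m_g m i (stem l (x a)) (stem l (x b)) = G i a b"
      "i < \<iota> \<Longrightarrow> meets T (H i a b) (H i b a) (G i a b) (G i b a) (x a) (x b)"
    if "a < q" "b < q" "a \<noteq> b" for a b i
    using large_pairD[OF assms that] L(3) that agree_refl unfolding l_def by auto
  have inj: "inj_on (\<lambda>a. stem l (x a)) {..<q}"
    using pr(1) by (auto simp: inj_on_def stem_eq_iff)
  define idx where "idx = inv_into {..<q} (\<lambda>a. stem l (x a))"
  have idx: "idx (stem l (x a)) = a" if "a < q" for a
    using inv_into_f_f[OF inj, of a] that by (simp add: idx_def)
  have "\<forall>p. \<exists>z. (case p of (i, a, b) \<Rightarrow> a < b \<longrightarrow> b < q \<longrightarrow> i < \<iota> \<longrightarrow>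
      z + x a \<in> lim_tree (T (H i a b)) \<and> z + x b \<in> lim_tree (T (H i b a)) \<and>
      init_seg (G i a b) (z + x a) \<and> init_seg (G i b a) (z + x b))"
  proof
    fix p :: "nat \<times> nat \<times> nat"
    obtain i a b where p: "p = (i, a, b)" by (cases p)
    show "\<exists>z. (case p of (i, a, b) \<Rightarrow> a < b \<longrightarrow> b < q \<longrightarrow> i < \<iota> \<longrightarrow>
      z + x a \<in> lim_tree (T (H i a b)) \<and> z + x b \<in> lim_tree (T (H i b a)) \<and>
      init_seg (G i a b) (z + x a) \<and> init_seg (G i b a) (z + x b))"
    proof (cases "a < b \<and> b < q \<and> i < \<iota>")
      case True
      then show ?thesis using pr(6)[of a b i] unfolding meets_def p by auto
    qed (auto simp: p)
  qed
  from choice[OF this] obtain Z0 where Z0: "\<And>i a b. a < b \<Longrightarrow> b < q \<Longrightarrow> i < \<iota> \<Longrightarrow>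
      Z0 (i, a, b) + x a \<in> lim_tree (T (H i a b)) \<and> Z0 (i, a, b) + x b \<in> lim_tree (T (H i b a)) \<and>
      init_seg (G i a b) (Z0 (i, a, b) + x a) \<and> init_seg (G i b a) (Z0 (i, a, b) + x b)"
    by auto
  \<comment> \<open>The two orders of a pair must be served by the same common point.\<close>
  define Z where "Z i a b = Z0 (i, min a b, max a b)" for i a b
  have Zsym: "Z i a b = Z i b a" for i a b by (simp add: Z_def min.commute max.commute)
  have Z: "Z i a b + x a \<in> lim_tree (T (H i a b))" "init_seg (G i a b) (Z i a b + x a)"
    if "a < q" "b < q" "a \<noteq> b" "i < \<iota>" for i a b
    using Z0[of a b i] Z0[of b a i] that by (cases "a < b"; simp add: Z_def min_def max_def)+
  have Gstem: "G i a b = stem l (Z i a b + x a)" if "a < q" "b < q" "a \<noteq> b" "i < \<iota>" for i a b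
    using init_seg_stemD[OF Z(2)[OF that]] pr(3)[OF that] by simp
  have pairs: "\<exists>a b. a < q \<and> b < q \<and> a \<noteq> b \<and> \<eta> = stem l (x a) \<and> \<nu> = stem l (x b)"
    if "(\<eta>, \<nu>) \<in> pairs2 (m_set m)" for \<eta> \<nu>
    using that L(4) by (auto simp: pairs2_def)
  have add_stem: "list_add (stem l u) (stem l v) = stem l (u + v)" for u v
    by (rule nth_equalityI) (simp_all add: list_add_def stem_def)
  have "card (m_set m) = q" using card_image[OF inj] by (simp add: L(4))
  moreover have "\<forall>\<eta>\<in>m_set m. length \<eta> = m_len m" by (auto simp: L(4) l_def)
  moreover have "\<forall>(\<eta>, \<nu>)\<in>pairs2 (m_set m). \<forall>i<\<iota>.
        m_g m i \<eta> \<nu> \<in> T (m_h m i \<eta> \<nu>) \<and> length (m_g m i \<eta> \<nu>) = m_len m \<and>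
        list_add \<eta> (m_g m i \<eta> \<nu>) = list_add \<nu> (m_g m i \<nu> \<eta>)"
  proof (safe)
    fix \<eta> \<nu> i assume p: "(\<eta>, \<nu>) \<in> pairs2 (m_set m)" and i: "i < \<iota>"
    obtain a b where ab: "a < q" "b < q" "a \<noteq> b" "\<eta> = stem l (x a)" "\<nu> = stem l (x b)"
      using pairs[OF p] by blast
    have g: "m_g m i \<eta> \<nu> = stem l (Z i a b + x a)" "m_h m i \<eta> \<nu> = H i a b"
      "m_g m i \<nu> \<eta> = stem l (Z i a b + x b)"
      using pr(4,5)[OF ab(1-3) i] pr(5)[OF ab(2,1) ab(3)[symmetric] i] Gstem[OF ab(1-3) i]
        Gstem[OF ab(2,1) ab(3)[symmetric] i] Zsym[of i a b] by (simp_all add: ab(4,5))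
    show "m_g m i \<eta> \<nu> \<in> T (m_h m i \<eta> \<nu>)"
      using Z(1)[OF ab(1-3) i] unfolding g lim_tree_def stem_def by blast
    show "length (m_g m i \<eta> \<nu>) = m_len m" by (simp add: g l_def)
    show "list_add \<eta> (m_g m i \<eta> \<nu>) = list_add \<nu> (m_g m i \<nu> \<eta>)"
      unfolding g(1,3) by (simp only: ab(4,5) add_stem cantor_add_cancel(1))
  qed
  moreover have "\<forall>(\<eta>, \<nu>)\<in>pairs2 (m_set m).
        distinct (map (\<lambda>i. m_g m i \<eta> \<nu>) [0..<\<iota>] @ map (\<lambda>i. m_g m i \<nu> \<eta>) [0..<\<iota>])"
  proof (safe)
    fix \<eta> \<nu> assume p: "(\<eta>, \<nu>) \<in> pairs2 (m_set m)"
    obtain a b where ab: "a < q" "b < q" "a \<noteq> b" "\<eta> = stem l (x a)" "\<nu> = stem l (x b)"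
      using pairs[OF p] by blast
    have "map (\<lambda>i. m_g m i \<eta> \<nu>) [0..<\<iota>] = map (\<lambda>i. G i a b) [0..<\<iota>]"
      "map (\<lambda>i. m_g m i \<nu> \<eta>) [0..<\<iota>] = map (\<lambda>i. G i b a) [0..<\<iota>]"
      using pr(5)[OF ab(1-3)] pr(5)[OF ab(2,1) ab(3)[symmetric]] by (simp_all add: ab(4,5))
    then show "distinct (map (\<lambda>i. m_g m i \<eta> \<nu>) [0..<\<iota>] @ map (\<lambda>i. m_g m i \<nu> \<eta>) [0..<\<iota>])"
      using pr(2)[OF ab(1-3)] by (simp only:)
  qed
  moreover have "\<exists>(F :: bit list \<Rightarrow> nat \<Rightarrow> bit) (G :: nat \<Rightarrow> bit list \<Rightarrow> bit list \<Rightarrow> nat \<Rightarrow> bit).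
        (\<forall>\<eta>\<in>m_set m. init_seg \<eta> (F \<eta>)) \<and>
        (\<forall>(\<eta>, \<nu>)\<in>pairs2 (m_set m). \<forall>i<\<iota>.
           init_seg (m_g m i \<eta> \<nu>) (G i \<eta> \<nu>) \<and>
           G i \<eta> \<nu> \<in> lim_tree (T (m_h m i \<eta> \<nu>)) \<and>
           F \<eta> + G i \<eta> \<nu> = F \<nu> + G i \<nu> \<eta>)"
  proof (intro exI conjI)
    show "\<forall>\<eta>\<in>m_set m. init_seg \<eta> (x (idx \<eta>))"
      by (auto simp: L(4) idx init_seg_stem)
    show "\<forall>(\<eta>, \<nu>)\<in>pairs2 (m_set m). \<forall>i<\<iota>.
           init_seg (m_g m i \<eta> \<nu>) (Z i (idx \<eta>) (idx \<nu>) + x (idx \<eta>)) \<and>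
           Z i (idx \<eta>) (idx \<nu>) + x (idx \<eta>) \<in> lim_tree (T (m_h m i \<eta> \<nu>)) \<and>
           x (idx \<eta>) + (Z i (idx \<eta>) (idx \<nu>) + x (idx \<eta>)) = x (idx \<nu>) + (Z i (idx \<nu>) (idx \<eta>) + x (idx \<nu>))"
    proof (safe)
      fix \<eta> \<nu> i assume p: "(\<eta>, \<nu>) \<in> pairs2 (m_set m)" and i: "i < \<iota>"
      obtain a b where ab: "a < q" "b < q" "a \<noteq> b" "\<eta> = stem l (x a)" "\<nu> = stem l (x b)"
        using pairs[OF p] by blast
      have g: "m_g m i \<eta> \<nu> = G i a b" "m_h m i \<eta> \<nu> = H i a b" "idx \<eta> = a" "idx \<nu> = b"
        using pr(4,5)[OF ab(1-3) i] idx[OF ab(1)] idx[OF ab(2)] by (simp_all add: ab(4,5))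
      show "init_seg (m_g m i \<eta> \<nu>) (Z i (idx \<eta>) (idx \<nu>) + x (idx \<eta>))"
        "Z i (idx \<eta>) (idx \<nu>) + x (idx \<eta>) \<in> lim_tree (T (m_h m i \<eta> \<nu>))"
        unfolding g using Z[OF ab(1-3) i] by simp_all
      show "x (idx \<eta>) + (Z i (idx \<eta>) (idx \<nu>) + x (idx \<eta>)) = x (idx \<nu>) + (Z i (idx \<nu>) (idx \<eta>) + x (idx \<nu>))"
        unfolding cantor_add_cancel(1) using Zsym .
    qed
  qed
  ultimately show ?thesis using L(1,2) by (simp add: Mfam_def l_def)
qed

text \<open>
  Nodes \<open>G\<close> of any lengths up to \<open>l\<close> can be extended to length exactly \<open>l\<close>: the extensions colour the
  pairs with finitely many closed colours, so smaller boxes have constant extensions.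
\<close>
lemma large_in_boxes:
  assumes q: "2 \<le> q" and N: "N \<le> l" "0 < l" and x: "\<And>a. a < q \<Longrightarrow> x a \<in> P"
    and apart: "\<And>a b. a < q \<Longrightarrow> b < q \<Longrightarrow> a \<noteq> b \<Longrightarrow> \<not> agree N (x a) (x b)"
    and len: "\<And>a b. a < q \<Longrightarrow> b < q \<Longrightarrow> a \<noteq> b \<Longrightarrow> \<exists>k\<le>l. \<forall>i<\<iota>. length (G i a b) = k \<and> length (G i b a) = k"
    and dist: "\<And>a b. a < q \<Longrightarrow> b < q \<Longrightarrow> a \<noteq> b \<Longrightarrow>
      distinct (map (\<lambda>i. G i a b) [0..<\<iota>] @ map (\<lambda>i. G i b a) [0..<\<iota>])"
    and meet: "\<And>a b i u v. a < q \<Longrightarrow> b < q \<Longrightarrow> a \<noteq> b \<Longrightarrow> i < \<iota> \<Longrightarrow> u \<in> P \<Longrightarrow> v \<in> P \<Longrightarrow>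
      agree N (x a) u \<Longrightarrow> agree N (x b) v \<Longrightarrow> meets T (H i a b) (H i b a) (G i a b) (G i b a) u v"
  shows "\<exists>m x' N' G'. large m q x' N' H G' \<and> m_len m = l \<and> (\<forall>a. agree N (x a) (x' a)) \<and>
    (\<forall>a<q. \<forall>b<q. a \<noteq> b \<longrightarrow> (\<forall>i<\<iota>. prefix (G i a b) (G' i a b)))"
proof -
  \<comment> \<open>Each pair is coloured once, smaller index first; the other order gets the transposed colour.\<close>
  define J where "J = {(a, b, i). a < b \<and> b < q \<and> i < \<iota>}"
  have "finite J" by (rule finite_subset[of _ "{..<q} \<times> {..<q} \<times> {..<\<iota>}"]) (auto simp: J_def)
  define R :: "nat \<times> nat \<times> nat \<Rightarrow> bit list \<times> bit list \<Rightarrow> (nat \<Rightarrow> bit) \<Rightarrow> (nat \<Rightarrow> bit) \<Rightarrow> bool" where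
    "R = (\<lambda>(a, b, i) c. meets T (H i a b) (H i b a) (fst c) (snd c))"
  define C :: "nat \<times> nat \<times> nat \<Rightarrow> (bit list \<times> bit list) set" where
    "C = (\<lambda>(a, b, i). {c. prefix (G i a b) (fst c) \<and> prefix (G i b a) (snd c) \<and>
      length (fst c) = l \<and> length (snd c) = l})"
  have "\<exists>x' N' col. N \<le> N' \<and> (\<forall>a. agree N (x a) (x' a) \<and> (x a \<in> P \<longrightarrow> x' a \<in> P)) \<and>
    (\<forall>j\<in>J. col j \<in> C j \<and> (\<forall>u\<in>P. \<forall>v\<in>P. agree N' (x' (fst j)) u \<longrightarrow>
       agree N' (x' (fst (snd j))) v \<longrightarrow> R j (col j) u v))"
  proof (rule shrink_boxes[where p = fst and q = "\<lambda>j. fst (snd j)" and R = R and C = C and x = x and N = N, OF P])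
    show "closed_rel (R j c)" for j c by (cases j) (simp add: R_def closed_meets)
    show "finite J" by fact
    show "fst j \<noteq> fst (snd j)" if "j \<in> J" for j using that by (auto simp: J_def)
    show "x (fst j) \<in> P \<and> x (fst (snd j)) \<in> P" if "j \<in> J" for j using that x by (auto simp: J_def)
  next
    fix j u v assume j: "j \<in> J" and uv: "u \<in> P" "v \<in> P" "agree N (x (fst j)) u" "agree N (x (fst (snd j))) v"
    obtain a b i where abi: "j = (a, b, i)" "a < q" "b < q" "a \<noteq> b" "i < \<iota>" using j by (auto simp: J_def)
    obtain z where z: "z + u \<in> lim_tree (T (H i a b))" "z + v \<in> lim_tree (T (H i b a))"
      "init_seg (G i a b) (z + u)" "init_seg (G i b a) (z + v)"
      using meet[OF abi(2-5) uv(1,2)] uv(3,4) by (auto simp: abi(1) meets_def)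
    have "length (G i a b) \<le> l" "length (G i b a) \<le> l" using len[OF abi(2-4)] abi(5) by auto
    then have "(stem l (z + u), stem l (z + v)) \<in> C j"
      using prefix_stem z(3,4) by (simp add: C_def abi(1))
    moreover have "R j (stem l (z + u), stem l (z + v)) u v"
      using z(1,2) init_seg_stem by (auto simp: R_def abi(1) meets_def)
    ultimately show "\<exists>c\<in>C j. R j c u v" by blast
  qed
  then obtain x' N0 col where x': "N \<le> N0" "\<And>a. agree N (x a) (x' a)" "\<And>a. x a \<in> P \<Longrightarrow> x' a \<in> P"
    and col: "\<And>j. j \<in> J \<Longrightarrow> col j \<in> C j"
    "\<And>j u v. j \<in> J \<Longrightarrow> u \<in> P \<Longrightarrow> v \<in> P \<Longrightarrow> agree N0 (x' (fst j)) u \<Longrightarrow>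
       agree N0 (x' (fst (snd j))) v \<Longrightarrow> R j (col j) u v"
    by blast
  define G' where "G' i a b = (if a < b then fst (col (a, b, i)) else snd (col (b, a, i)))" for i a b
  have G': "prefix (G i a b) (G' i a b) \<and> length (G' i a b) = l"
    if "a < q" "b < q" "a \<noteq> b" "i < \<iota>" for i a b
    using that col(1)[of "(a, b, i)"] col(1)[of "(b, a, i)"]
    by (cases "a < b") (auto simp: G'_def C_def J_def)
  define N' where "N' = max N0 l"
  have meet': "meets T (H i a b) (H i b a) (G' i a b) (G' i b a) u v"
    if ab: "a < q" "b < q" "a \<noteq> b" "i < \<iota>" and uv: "u \<in> P" "v \<in> P" "agree N' (x' a) u" "agree N' (x' b) v"
    for a b i u v
  proof -
    have uv0: "agree N0 (x' a) u" "agree N0 (x' b) v" using uv agree_le by (auto simp: N'_def)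
    show ?thesis
    proof (cases "a < b")
      case True
      then show ?thesis using col(2)[of "(a, b, i)" u v] ab uv(1,2) uv0 by (simp add: J_def R_def G'_def)
    next
      case False
      then have "b < a" using ab(3) by simp
      then have "meets T (H i b a) (H i a b) (G' i b a) (G' i a b) v u"
        using col(2)[of "(b, a, i)" v u] ab uv(1,2) uv0 by (simp add: J_def R_def G'_def)
      then show ?thesis by (rule meets_sym)
    qed
  qed
  have apart': "\<not> agree l (x' a) (x' b)" if "a < q" "b < q" "a \<noteq> b" for a b
  proof
    assume "agree l (x' a) (x' b)"
    then have "agree N (x' a) (x' b)" using N(1) agree_le by blast
    then have "agree N (x a) (x b)" using x'(2)[of a] x'(2)[of b] agree_sym agree_trans by blast
    then show False using apart[OF that] by simp
  qed
  have inj: "inj_on (\<lambda>a. stem l (x' a)) {..<q}"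
    using apart' by (auto simp: inj_on_def stem_eq_iff)
  define idx where "idx = inv_into {..<q} (\<lambda>a. stem l (x' a))"
  have idx: "idx (stem l (x' a)) = a" if "a < q" for a
    using inv_into_f_f[OF inj, of a] that by (simp add: idx_def)
  define m where "m = \<lparr>m_len = l, m_set = (\<lambda>a. stem l (x' a)) ` {..<q},
    m_h = (\<lambda>i \<eta> \<nu>. H i (idx \<eta>) (idx \<nu>)), m_g = (\<lambda>i \<eta> \<nu>. G' i (idx \<eta>) (idx \<nu>))\<rparr>"
  have m: "m_len m = l" "m_set m = (\<lambda>a. stem l (x' a)) ` {..<q}"
    "m_h m i (stem l (x' a)) (stem l (x' b)) = H i a b"
    "m_g m i (stem l (x' a)) (stem l (x' b)) = G' i a b" if "a < q" "b < q" for a b i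
    using that by (simp_all add: m_def idx)
  have m0: "m_len m = l" "m_set m = (\<lambda>a. stem l (x' a)) ` {..<q}" by (simp_all add: m_def)
  have dist': "distinct (map (\<lambda>i. G' i a b) [0..<\<iota>] @ map (\<lambda>i. G' i b a) [0..<\<iota>])"
    if ab: "a < q" "b < q" "a \<noteq> b" for a b
  proof -
    obtain k where k: "\<And>i. i < \<iota> \<Longrightarrow> length (G i a b) = k \<and> length (G i b a) = k" using len[OF ab] by blast
    have "take k (G' i a b) = G i a b" "take k (G' i b a) = G i b a" if "i < \<iota>" for i
      using G'[OF ab that] G'[OF ab(2,1) ab(3)[symmetric] that] k[OF that] by (auto simp: prefix_def)
    then have "map (take k) (map (\<lambda>i. G' i a b) [0..<\<iota>] @ map (\<lambda>i. G' i b a) [0..<\<iota>]) =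
        map (\<lambda>i. G i a b) [0..<\<iota>] @ map (\<lambda>i. G i b a) [0..<\<iota>]" by simp
    then show ?thesis by (rule distinct_of_take[OF dist[OF ab]])
  qed
  have "large m q x' N' H G'"
    unfolding large_def m0(1)
  proof (intro conjI allI impI ballI)
    show "2 \<le> q" "0 < l" by fact+
    show "l \<le> N'" by (simp add: N'_def)
    show "x' a \<in> P" if "a < q" for a using x x'(3) that by blast
    show "m_set m = (\<lambda>a. stem l (x' a)) ` {..<q}" by fact
    fix a b assume ab: "a < q" "b < q" "a \<noteq> b"
    show "\<not> agree l (x' a) (x' b)" by (rule apart'[OF ab])
    show "distinct (map (\<lambda>i. G' i a b) [0..<\<iota>] @ map (\<lambda>i. G' i b a) [0..<\<iota>])" by (rule dist'[OF ab])
    fix i assume i: "i < \<iota>"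
    show "length (G' i a b) = l" using G'[OF ab i] by simp
    show "m_h m i (stem l (x' a)) (stem l (x' b)) = H i a b"
      "m_g m i (stem l (x' a)) (stem l (x' b)) = G' i a b" by (rule m(3,4)[OF ab(1,2)])+
    show "meets T (H i a b) (H i b a) (G' i a b) (G' i b a) u v"
      if "u \<in> P" "v \<in> P" "agree N' (x' a) u" "agree N' (x' b) v" for u v
      by (rule meet'[OF ab i that])
  qed
  then show ?thesis using m0(1) x'(2) G' by blast
qed

text \<open>
  At level \<open>N0\<close> the rectangle avoids the diagonal, so all its pairs have a colour.
\<close>
lemma new_pair:
  assumes "x \<in> P" "y \<in> P" "x \<noteq> y"
  shows "\<exists>u v N' L. u \<in> P \<and> v \<in> P \<and> N \<le> N' \<and> agree N x u \<and> agree N y v \<and> \<not> agree N' u v \<and> separated \<iota> L \<and>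
    (\<forall>u'\<in>P. \<forall>v'\<in>P. agree N' u u' \<longrightarrow> agree N' v v' \<longrightarrow> coloured T L u' v')"
proof -
  obtain k where k: "\<not> agree k x y" using agree_all assms(3) by blast
  define N0 where "N0 = max N k"
  have N0: "\<not> agree N0 u v" if uv: "agree N0 x u" "agree N0 y v" for u v
  proof
    assume "agree N0 u v"
    then have "agree N0 x y" using uv agree_sym agree_trans by blast
    then show False using k agree_le[of N0 x y k] by (simp add: N0_def)
  qed
  have cover: "\<exists>L\<in>Collect (separated \<iota>). coloured T L u v"
    if uv: "u \<in> P" "v \<in> P" "agree N0 x u" "agree N0 y v" for u v
  proof -
    have "u \<noteq> v" using N0[OF uv(3,4)] agree_refl by blast
    then show ?thesis using overlaps[OF uv(1,2)] by blast
  qed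
  obtain u v N' L where uv: "u \<in> P" "v \<in> P" "N0 \<le> N'" "separated \<iota> L" "agree N0 x u" "agree N0 y v"
    "\<And>u' v'. u' \<in> P \<Longrightarrow> v' \<in> P \<Longrightarrow> agree N' u u' \<Longrightarrow> agree N' v v' \<Longrightarrow> coloured T L u' v'"
    using baire_rectangle[where R = "coloured T" and C = "Collect (separated \<iota>)", OF P closed_coloured
        assms(1,2) cover] by blast
  have "\<not> agree N' u v" using agree_le[of N' u v N0] uv(3) N0[OF uv(5,6)] by blast
  moreover have "agree N x u" "agree N y v" "N \<le> N'"
    using agree_le[OF uv(5), of N] agree_le[OF uv(6), of N] uv(3) by (simp_all add: N0_def)
  ultimately show ?thesis using uv(1,2,4,7) by blast
qed

text \<open>
  A perfect set contains two points, and a rectangle of one colour near them is a box for a tuple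
  with two vectors.
\<close>
lemma large_exists: "\<exists>m q x N H G. large m q x N H G"
proof -
  obtain x where x: "x \<in> P" using perfect_setD(1)[OF P] by blast
  obtain y where y: "y \<in> P" "y \<noteq> x" using perfect_setD(3)[OF P x] by blast
  obtain u v N L where uv: "u \<in> P" "v \<in> P" "\<not> agree N u v" "separated \<iota> L"
    "\<And>u' v'. u' \<in> P \<Longrightarrow> v' \<in> P \<Longrightarrow> agree N u u' \<Longrightarrow> agree N v v' \<Longrightarrow> coloured T L u' v'"
    using new_pair[OF x y(1) y(2)[symmetric]] by blast
  obtain k where k: "\<And>i. i < \<iota> \<Longrightarrow> length (col_g L i) = k \<and> length (col_g' L i) = k"
    using separatedD(1)[OF uv(4)] by blast
  define pt where "pt a = (if a = 0 then u else v)" for a :: nat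
  define H where "H i a (b :: nat) = (if a = 0 then col_h L i else col_h' L i)" for i a :: nat and b
  define G where "G i a (b :: nat) = (if a = 0 then col_g L i else col_g' L i)" for i a :: nat and b
  have two: "a = 0 \<and> b = 1 \<or> a = 1 \<and> b = 0" if "a < 2" "b < 2" "a \<noteq> b" for a b :: nat
    using that by linarith
  have "\<exists>m x' N' G'. large m 2 x' N' H G' \<and> m_len m = Suc (max N k) \<and> (\<forall>a. agree N (pt a) (x' a)) \<and>
    (\<forall>a<2. \<forall>b<2. a \<noteq> b \<longrightarrow> (\<forall>i<\<iota>. prefix (G i a b) (G' i a b)))"
  proof (rule large_in_boxes)
    show "pt a \<in> P" for a using uv(1,2) by (simp add: pt_def)
    fix a b :: nat assume "a < 2" "b < 2" "a \<noteq> b"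
    note ab = two[OF this]
    show "\<not> agree N (pt a) (pt b)" using ab uv(3) agree_sym by (auto simp: pt_def)
    show "\<exists>k'\<le>Suc (max N k). \<forall>i<\<iota>. length (G i a b) = k' \<and> length (G i b a) = k'"
      using k by (intro exI[of _ k]) (auto simp: G_def)
    show "distinct (map (\<lambda>i. G i a b) [0..<\<iota>] @ map (\<lambda>i. G i b a) [0..<\<iota>])"
      using ab separatedD(2)[OF uv(4)] by (auto simp: G_def)
    show "meets T (H i a b) (H i b a) (G i a b) (G i b a) u' v'"
      if i: "i < \<iota>" and w: "u' \<in> P" "v' \<in> P" "agree N (pt a) u'" "agree N (pt b) v'" for i u' v'
      using ab
    proof
      assume "a = 0 \<and> b = 1"
      then show ?thesis
        using separatedD(3)[OF uv(4) uv(5)[OF w(1,2)] i] w(3,4) by (simp add: pt_def H_def G_def)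
    next
      assume "a = 1 \<and> b = 0"
      then show ?thesis
        using meets_sym[OF separatedD(3)[OF uv(4) uv(5)[OF w(2,1)] i]] w(3,4) by (simp add: pt_def H_def G_def)
    qed
  qed simp_all
  then show ?thesis by blast
qed

text \<open>
  The point \<open>x c\<close> above \<open>\<nu>\<close> is not isolated.  It is replaced by two nearby points \<open>u\<close> and \<open>v\<close>
  whose neighbourhoods form a rectangle of one colour, and the old pairs keep their common points
  because \<open>u\<close> and \<open>v\<close> are in the old box.
\<close>
lemma large_step:
  assumes m: "large m q x N H G" and \<nu>: "\<nu> \<in> m_set m"
  shows "\<exists>n q' x' N' H' G'. large n q' x' N' H' G' \<and> m_len m < m_len n \<and> m_extends \<iota> m n \<and>
    2 \<le> card {\<eta>\<in>m_set n. strict_prefix \<nu> \<eta>}"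
proof -
  define l where "l = m_len m"
  have L: "2 \<le> q" "0 < l" "l \<le> N" "\<And>a. a < q \<Longrightarrow> x a \<in> P"
    "m_set m = (\<lambda>a. stem l (x a)) ` {..<q}"
    using m by (auto simp: large_def l_def)
  have pr: "\<not> agree l (x a) (x b)"
      "distinct (map (\<lambda>i. G i a b) [0..<\<iota>] @ map (\<lambda>i. G i b a) [0..<\<iota>])"
      "i < \<iota> \<Longrightarrow> length (G i a b) = l"
      "i < \<iota> \<Longrightarrow> m_h m i (stem l (x a)) (stem l (x b)) = H i a b"
      "i < \<iota> \<Longrightarrow> m_g m i (stem l (x a)) (stem l (x b)) = G i a b"
      "i < \<iota> \<Longrightarrow> u \<in> P \<Longrightarrow> v \<in> P \<Longrightarrow> agree N (x a) u \<Longrightarrow> agree N (x b) v \<Longrightarrow>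
        meets T (H i a b) (H i b a) (G i a b) (G i b a) u v"
    if "a < q" "b < q" "a \<noteq> b" for a b i u v
    using large_pairD[OF m that] unfolding l_def by auto
  obtain c where c: "c < q" "\<nu> = stem l (x c)" using \<nu> L(5) by auto
  obtain y where y: "y \<in> P" "y \<noteq> x c" "agree N (x c) y" using perfect_setD(3)[OF P L(4)[OF c(1)]] by blast
  obtain u v N1 C where uv: "u \<in> P" "v \<in> P" "N \<le> N1" "agree N (x c) u" "agree N y v" "\<not> agree N1 u v"
    "separated \<iota> C"
    "\<And>u' v'. u' \<in> P \<Longrightarrow> v' \<in> P \<Longrightarrow> agree N1 u u' \<Longrightarrow> agree N1 v v' \<Longrightarrow> coloured T C u' v'"
    using new_pair[OF L(4)[OF c(1)] y(1) y(2)[symmetric], of N] by blast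
  obtain k where k: "\<And>i. i < \<iota> \<Longrightarrow> length (col_g C i) = k \<and> length (col_g' C i) = k"
    using separatedD(1)[OF uv(7)] by blast
  \<comment> \<open>The new point has index \<open>q\<close>; \<open>p\<close> maps an index to the index of the old point near it.\<close>
  define p where "p a = (if a = q then c else a)" for a
  define x1 where "x1 = x(c := u, q := v)"
  define H1 where "H1 i a b = (if p a \<noteq> p b then H i (p a) (p b) else if a = c then col_h C i else col_h' C i)"
    for i a b
  define G1 where "G1 i a b = (if p a \<noteq> p b then G i (p a) (p b) else if a = c then col_g C i else col_g' C i)"
    for i a b
  define l' where "l' = Suc (max N1 (max k l))"
  have pq: "p a < q" if "a < Suc q" for a using that c(1) by (auto simp: p_def)
  have cq: "c \<noteq> q" using c(1) by simp
  have x1: "agree N (x (p a)) (x1 a)" if "a < Suc q" for a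
    using uv(4) agree_trans[OF y(3) uv(5)] cq by (auto simp: x1_def p_def)
  have x1v: "x1 c = u" "x1 q = v" using cq by (simp_all add: x1_def)
  have split: "a = c \<and> b = q \<or> a = q \<and> b = c" if "p a = p b" "a \<noteq> b" for a b
    using that by (auto simp: p_def split: if_splits)
  have "\<exists>n x' N' G'. large n (Suc q) x' N' H1 G' \<and> m_len n = l' \<and> (\<forall>a. agree N1 (x1 a) (x' a)) \<and>
    (\<forall>a<Suc q. \<forall>b<Suc q. a \<noteq> b \<longrightarrow> (\<forall>i<\<iota>. prefix (G1 i a b) (G' i a b)))"
  proof (rule large_in_boxes)
    show "2 \<le> Suc q" "N1 \<le> l'" "0 < l'" using L(1) by (simp_all add: l'_def)
    show "x1 a \<in> P" if "a < Suc q" for a using that L(4) uv(1,2) by (simp add: x1_def)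
    fix a b assume ab: "a < Suc q" "b < Suc q" "a \<noteq> b"
    have far: "\<not> agree N1 (x1 a) (x1 b)" if ne: "p a \<noteq> p b"
    proof
      assume "agree N1 (x1 a) (x1 b)"
      then have "agree l (x1 a) (x1 b)" using uv(3) L(3) agree_le by simp
      moreover have "agree l (x (p a)) (x1 a)" "agree l (x (p b)) (x1 b)"
        using agree_le[OF x1[OF ab(1)] L(3)] agree_le[OF x1[OF ab(2)] L(3)] by auto
      ultimately have "agree l (x (p a)) (x (p b))" using agree_sym agree_trans by blast
      then show False using pr(1)[OF pq[OF ab(1)] pq[OF ab(2)] ne] by simp
    qed
    show "\<not> agree N1 (x1 a) (x1 b)"
      using far split[OF _ ab(3)] uv(6) agree_sym x1v by metis
    show "\<exists>k'\<le>l'. \<forall>i<\<iota>. length (G1 i a b) = k' \<and> length (G1 i b a) = k'"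
    proof (cases "p a = p b")
      case True
      then show ?thesis using k by (intro exI[of _ k]) (auto simp: G1_def l'_def)
    next
      case False
      then show ?thesis using pr(3)[OF pq[OF ab(1)] pq[OF ab(2)] False]
          pr(3)[OF pq[OF ab(2)] pq[OF ab(1)] False[symmetric]]
        by (intro exI[of _ l]) (auto simp: G1_def l'_def)
    qed
    show "distinct (map (\<lambda>i. G1 i a b) [0..<\<iota>] @ map (\<lambda>i. G1 i b a) [0..<\<iota>])"
    proof (cases "p a = p b")
      case True
      then show ?thesis using split[OF True ab(3)] separatedD(2)[OF uv(7)] cq by (auto simp: G1_def)
    next
      case False
      then show ?thesis using pr(2)[OF pq[OF ab(1)] pq[OF ab(2)] False] by (simp add: G1_def)
    qed
    fix i u' v' assume i: "i < \<iota>" and w: "u' \<in> P" "v' \<in> P" "agree N1 (x1 a) u'" "agree N1 (x1 b) v'"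
    show "meets T (H1 i a b) (H1 i b a) (G1 i a b) (G1 i b a) u' v'"
    proof (cases "p a = p b")
      case False
      have "agree N (x (p a)) u'" "agree N (x (p b)) v'"
        using agree_trans[OF x1[OF ab(1)] agree_le[OF w(3) uv(3)]]
          agree_trans[OF x1[OF ab(2)] agree_le[OF w(4) uv(3)]] by auto
      then show ?thesis
        using pr(6)[OF pq[OF ab(1)] pq[OF ab(2)] False i w(1,2)] False by (simp add: H1_def G1_def)
    next
      case True
      from split[OF True ab(3)] show ?thesis
      proof
        assume e: "a = c \<and> b = q"
        then have "coloured T C u' v'" using uv(8)[OF w(1,2)] w(3,4) x1v by simp
        from separatedD(3)[OF uv(7) this i] show ?thesis using e True cq by (simp add: H1_def G1_def)
      next
        assume e: "a = q \<and> b = c"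
        then have "coloured T C v' u'" using uv(8)[OF w(2,1)] w(3,4) x1v by simp
        from meets_sym[OF separatedD(3)[OF uv(7) this i]] show ?thesis using e True cq
          by (simp add: H1_def G1_def)
      qed
    qed
  qed
  then obtain n x' N' G' where n: "large n (Suc q) x' N' H1 G'" "m_len n = l'" "\<And>a. agree N1 (x1 a) (x' a)"
    and G': "\<And>a b i. a < Suc q \<Longrightarrow> b < Suc q \<Longrightarrow> a \<noteq> b \<Longrightarrow> i < \<iota> \<Longrightarrow> prefix (G1 i a b) (G' i a b)"
    by blast
  have nset: "m_set n = (\<lambda>a. stem l' (x' a)) ` {..<Suc q}"
    using n(1) by (simp add: large_def n(2))
  have npr: "\<And>a b. a < Suc q \<Longrightarrow> b < Suc q \<Longrightarrow> a \<noteq> b \<Longrightarrow> \<not> agree l' (x' a) (x' b)"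
    and nh: "\<And>a b i. a < Suc q \<Longrightarrow> b < Suc q \<Longrightarrow> a \<noteq> b \<Longrightarrow> i < \<iota> \<Longrightarrow>
      m_h n i (stem l' (x' a)) (stem l' (x' b)) = H1 i a b \<and> m_g n i (stem l' (x' a)) (stem l' (x' b)) = G' i a b"
    using large_pairD(1,4,5)[OF n(1)] unfolding n(2) by auto
  have ll: "l < l'" by (simp add: l'_def)
  have take: "take l (stem l' (x' a)) = stem l (x (p a))" if "a < Suc q" for a
  proof -
    have "agree l (x (p a)) (x' a)"
      using agree_trans[OF agree_le[OF x1[OF that] L(3)] agree_le[OF n(3), of l a]] uv(3) L(3) by simp
    then show ?thesis using ll take_stem[of l l' "x' a"] by (simp add: stem_eq_iff agree_sym)
  qed
  have "m_extends \<iota> m n"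
    unfolding m_extends_def n(2) l_def[symmetric]
  proof (intro conjI)
    show "l \<le> l'" using ll by simp
    have "p ` {..<Suc q} = {..<q}" using c(1) by (auto simp: p_def image_iff)
    then have "m_set m = (\<lambda>a. stem l (x (p a))) ` {..<Suc q}" unfolding L(5) by (metis image_image)
    also have "\<dots> = take l ` m_set n" unfolding nset image_image by (rule image_cong) (simp_all add: take)
    finally show "m_set m = take l ` m_set n" .
    show "\<forall>(\<eta>, \<nu>)\<in>pairs2 (m_set n). take l \<eta> \<noteq> take l \<nu> \<longrightarrow> (\<forall>i<\<iota>.
        m_h m i (take l \<eta>) (take l \<nu>) = m_h n i \<eta> \<nu> \<and> m_g m i (take l \<eta>) (take l \<nu>) = take l (m_g n i \<eta> \<nu>))"
    proof (intro ballI, clarify)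
      fix \<eta> \<nu> i assume p2: "(\<eta>, \<nu>) \<in> pairs2 (m_set n)" and ne: "take l \<eta> \<noteq> take l \<nu>" and i: "i < \<iota>"
      obtain a b where ab: "a < Suc q" "b < Suc q" "\<eta> = stem l' (x' a)" "\<nu> = stem l' (x' b)"
        using p2 nset by (auto simp: pairs2_def)
      have pab: "p a \<noteq> p b" using ne take[OF ab(1)] take[OF ab(2)] by (auto simp: ab(3,4))
      then have "a \<noteq> b" by auto
      have "prefix (G i (p a) (p b)) (G' i a b)" using G'[OF ab(1,2) \<open>a \<noteq> b\<close> i] pab by (simp add: G1_def)
      then have "take l (G' i a b) = G i (p a) (p b)"
        using pr(3)[OF pq[OF ab(1)] pq[OF ab(2)] pab i] by (auto simp: prefix_def)
      then show "m_h m i (take l \<eta>) (take l \<nu>) = m_h n i \<eta> \<nu> \<and>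
          m_g m i (take l \<eta>) (take l \<nu>) = take l (m_g n i \<eta> \<nu>)"
        using nh[OF ab(1,2) \<open>a \<noteq> b\<close> i] pr(4,5)[OF pq[OF ab(1)] pq[OF ab(2)] pab i] pab
        unfolding ab(3,4) take[OF ab(1)] take[OF ab(2)] by (simp add: H1_def)
    qed
  qed
  moreover have "2 \<le> card {\<eta>\<in>m_set n. strict_prefix \<nu> \<eta>}"
  proof -
    have ext: "stem l' (x' a) \<in> {\<eta>\<in>m_set n. strict_prefix \<nu> \<eta>}" if a: "a < Suc q" "p a = c" for a
    proof -
      have "prefix \<nu> (stem l' (x' a))" using take[OF a(1)] take_is_prefix[of l "stem l' (x' a)"] c(2) a(2) by simp
      moreover have "length \<nu> \<noteq> length (stem l' (x' a))" using c(2) ll by simp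
      ultimately have "strict_prefix \<nu> (stem l' (x' a))" by (auto simp: strict_prefix_def)
      then show ?thesis using nset a(1) by auto
    qed
    have "{stem l' (x' c), stem l' (x' q)} \<subseteq> {\<eta>\<in>m_set n. strict_prefix \<nu> \<eta>}"
      using ext[of c] ext[of q] c(1) by (simp add: p_def)
    moreover have "stem l' (x' c) \<noteq> stem l' (x' q)" using npr[of c q] c(1) by (simp add: stem_eq_iff)
    then have "card {stem l' (x' c), stem l' (x' q)} = 2" by simp
    moreover have "finite {\<eta>\<in>m_set n. strict_prefix \<nu> \<eta>}" by (simp add: nset)
    ultimately show ?thesis by (metis card_mono)
  qed
  moreover have "m_len m < m_len n" using ll by (simp add: n(2) l_def)
  ultimately show ?thesis using n(1) by blast
qed

text \<open>
  A large tuple can be split at every vector into a large tuple again, so no ordinal bounds its rank.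
\<close>
lemma large_rank:
  "large m q x N H G \<Longrightarrow> ndrk_ge \<iota> T \<alpha> m"
proof (induction \<alpha> arbitrary: m q x N H G rule: less_induct)
  case (less \<alpha>)
  note mem = large_Mfam[OF less.prems]
  consider "\<alpha> = ord_zero" | \<beta> where "\<alpha> = ord_succ \<beta>" | "ord_limit \<alpha>"
    by (auto simp: ord_limit_def)
  then show ?case
  proof cases
    case 1
    then show ?thesis using ndrk_ge.zero[OF mem] by simp
  next
    case 2
    have "\<exists>n. n \<in> Mfam \<iota> T \<and> m_len m < m_len n \<and> m_extends \<iota> m n \<and>
        ndrk_ge \<iota> T \<beta> n \<and> 2 \<le> card {\<eta>\<in>m_set n. strict_prefix \<nu> \<eta>}" if "\<nu> \<in> m_set m" for \<nu>
      using large_step[OF less.prems that] large_Mfam less.IH[of \<beta>] less_ord_succ[of \<beta>] 2 by metis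
    then show ?thesis unfolding 2 by (intro ndrk_ge.succ mem) blast
  next
    case 3
    then show ?thesis using less.IH[OF _ less.prems] by (intro ndrk_ge.limit mem) auto
  qed
qed

lemma ndrk_trees_infinite: "ndrk_trees \<iota> T = Infty"
proof -
  obtain m q x N H G where m: "large m q x N H G" using large_exists by blast
  have "ndrk \<iota> T m = Infty" using large_rank[OF m] by (simp add: ndrk_def)
  then have "Infty \<in> ndrk \<iota> T ` Mfam \<iota> T" using large_Mfam[OF m] by (metis imageI)
  then show ?thesis
    unfolding ndrk_trees_def ord_inf_Sup_def
    by (intro Least_equality) (auto simp: less_eq_ord_inf_def)
qed

end

section \<open>The two halves combined\<close>

text \<open>
  Cuteness provides the plain sets, controlled amalgamation the gluing of two copies.
\<close>
lemma controlled_amalgamation_tower: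
  assumes "ord_zero < \<epsilon>" "cute \<epsilon> S" "\<And>m. is_tree (T m)" "controlled_amalgamation \<iota> T c S"
  shows "\<exists>b. brick_tower S \<iota> T c b"
proof -
  from assms(4) obtain b where b: "\<forall>n. is_brick S \<iota> T c (b n)" "\<forall>n. brick_le \<iota> (b n) (b (Suc n))"
    "(\<Union>n. b_w (b n)) = UNIV" "filterlim (\<lambda>n. b_n (b n)) at_top sequentially"
    and am: "\<forall>n u w \<pi>0 \<pi>1.
           u \<subseteq> w \<and> w \<subseteq> b_w (b n) \<and> 3 \<le> card w \<and>
           (\<forall>v \<delta>. v \<subseteq> u \<and> \<delta> \<in> w - u \<and> yr S (insert \<delta> v) = ord_zero \<longrightarrow>
              yk S (insert \<delta> v) \<noteq> card {x\<in>v. x < \<delta>}) \<and>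
           quasi_embedding_into S w \<pi>0 \<and> quasi_embedding_into S w \<pi>1 \<and>
           (\<forall>a\<in>u. \<pi>0 a = \<pi>1 a) \<and> \<pi>0 ` (w - u) \<inter> \<pi>1 ` (w - u) = {} \<longrightarrow>
           (\<exists>K \<pi>. quasi_embedding_into S (\<pi>0 ` w \<union> \<pi>1 ` w) \<pi> \<and>
              \<pi> ` (\<pi>0 ` w \<union> \<pi>1 ` w) \<subseteq> b_w (b K) \<and>
              brick_le \<iota> (brick_image (\<pi> \<circ> \<pi>0) (brick_restrict \<iota> T c (b n) w))
                (brick_restrict \<iota> T c (b K) ((\<pi> \<circ> \<pi>0) ` w)) \<and>
              brick_le \<iota> (brick_image (\<pi> \<circ> \<pi>1) (brick_restrict \<iota> T c (b n) w))
                (brick_restrict \<iota> T c (b K) ((\<pi> \<circ> \<pi>1) ` w)))"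
    unfolding controlled_amalgamation_def by (elim exE conjE)
  have "brick_tower S \<iota> T c b"
  proof
    show "yX S = UNIV" using assms(2) by (simp add: cute_def)
    show "\<exists>f. strict_mono_on {..<N::nat} f \<and> plain_on S (f ` {..<N})" for N
      by (rule plain_on_exists[OF assms(1,2)])
    show "(\<Union>n. b_w (b n)) = UNIV" "filterlim (\<lambda>n. b_n (b n)) at_top sequentially" by (rule b)+
    show "is_brick S \<iota> T c (b n)" "brick_le \<iota> (b n) (b (Suc n))" for n using b(1,2) by auto
    show "is_tree (T m)" for m by (rule assms(3))
  next
    fix u w n \<pi>0 \<pi>1
    assume h: "u \<subseteq> w" "w \<subseteq> b_w (b n)" "3 \<le> card w"
      "\<And>v \<delta>. v \<subseteq> u \<Longrightarrow> \<delta> \<in> w - u \<Longrightarrow> yr S (insert \<delta> v) = ord_zero \<Longrightarrow>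
        yk S (insert \<delta> v) \<noteq> card {x\<in>v. x < \<delta>}"
      "quasi_embedding_into S w \<pi>0" "quasi_embedding_into S w \<pi>1"
      "\<And>a. a \<in> u \<Longrightarrow> \<pi>0 a = \<pi>1 a" "\<pi>0 ` (w - u) \<inter> \<pi>1 ` (w - u) = {}"
    show "\<exists>K \<pi>. quasi_embedding_into S (\<pi>0 ` w \<union> \<pi>1 ` w) \<pi> \<and>
              \<pi> ` (\<pi>0 ` w \<union> \<pi>1 ` w) \<subseteq> b_w (b K) \<and>
              brick_le \<iota> (brick_image (\<pi> \<circ> \<pi>0) (brick_restrict \<iota> T c (b n) w))
                (brick_restrict \<iota> T c (b K) ((\<pi> \<circ> \<pi>0) ` w)) \<and>
              brick_le \<iota> (brick_image (\<pi> \<circ> \<pi>1) (brick_restrict \<iota> T c (b n) w))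
                (brick_restrict \<iota> T c (b K) ((\<pi> \<circ> \<pi>1) ` w))"
      by (rule am[THEN spec, THEN spec, THEN spec, THEN spec, THEN spec, THEN mp])
        (intro conjI allI impI ballI; (elim conjE)?; rule h; assumption?)
  qed
  then show ?thesis by blast
qed

theorem corollary5p3:
  fixes \<epsilon> :: ordinal and \<iota> :: nat and S :: "nat yzr"
    and T :: "nat \<Rightarrow> bit list set" and c :: "nat \<Rightarrow> nat" and B :: "(nat \<Rightarrow> bit) set"
  assumes "ord_zero < \<epsilon>" and "\<epsilon> < ord_omega1"
    and "2 \<le> \<iota>"
    and "cute \<epsilon> S"
    and "\<And>m. is_tree (T m)" and "\<And>m. no_maximal_nodes (T m)"
    and "controlled_amalgamation \<iota> T c S"
    and "Fin \<epsilon> \<le> ndrk_trees \<iota> T"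
    and "ndrk_trees \<iota> T
      \<le> Fin (ord_succ (ord_succ (ord_mult ord_omega (ord_succ (ord_succ \<epsilon>)))))"
    and "B = (\<Union>m. lim_tree (T m))"
  shows "(\<exists>\<eta> :: ordinal \<Rightarrow> nat \<Rightarrow> bit.
            inj_on \<eta> {..<ord_omega1} \<and>
            (\<forall>\<alpha><ord_omega1. \<forall>\<beta><ord_omega1.
               card_ge (((+) (\<eta> \<alpha>) ` B) \<inter> ((+) (\<eta> \<beta>) ` B)) (2 * \<iota>))) \<and>
         \<not> (\<exists>P. perfect_set P \<and>
              (\<forall>x\<in>P. \<forall>y\<in>P. card_ge (((+) x ` B) \<inter> ((+) y ` B)) (2 * \<iota>)))"
proof (intro conjI notI)
  obtain b where "brick_tower S \<iota> T c b"
    using controlled_amalgamation_tower[OF assms(1,4,5,7)] by blast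
  then show "\<exists>\<eta> :: ordinal \<Rightarrow> nat \<Rightarrow> bit. inj_on \<eta> {..<ord_omega1} \<and>
      (\<forall>\<alpha><ord_omega1. \<forall>\<beta><ord_omega1.
         card_ge (((+) (\<eta> \<alpha>) ` B) \<inter> ((+) (\<eta> \<beta>) ` B)) (2 * \<iota>))"
    unfolding assms(10) by (rule brick_tower.omega1_overlaps)
next
  assume "\<exists>P. perfect_set P \<and> (\<forall>x\<in>P. \<forall>y\<in>P. card_ge (((+) x ` B) \<inter> ((+) y ` B)) (2 * \<iota>))"
  then obtain P where P: "perfect_set P"
    "\<And>x y. x \<in> P \<Longrightarrow> y \<in> P \<Longrightarrow> card_ge (((+) x ` B) \<inter> ((+) y ` B)) (2 * \<iota>)" by blast
  interpret perfect_overlaps P \<iota> T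
  proof
    show "\<exists>L. separated \<iota> L \<and> coloured T L x y" if "x \<in> P" "y \<in> P" "x \<noteq> y" for x y
      using overlap_coloured[OF P(2)[OF that(1,2)] that(3) assms(10)] .
  qed (rule P(1))
  show False using assms(9) by (simp add: ndrk_trees_infinite less_eq_ord_inf_def)
qed

end
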